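(* Let $G$ be a linear algebraic group over an algebraically closed field $\Bbbk$ of characteristic $p>0$. Then $\sigma(G)$ is finite if and only if $|G|$ is finite.
   Context: A $G$-module is a finite-dimensional rational representation $V$ of $G$ over $\Bbbk$. $\Bbbk[V]\cong S(V^* )$ is the ring of polynomial functions on $V$, with $G$-action $(g\cdot f)(v)=f(g^{-1}v)$ and invariant ring $\Bbbk[V]^G$, graded by degree. $\Bbbk[V]^G_{\le d}$ is the set of invariants of degree at most $d$. For $S\subseteq \Bbbk[V]$, $S_+$ is the set of elements of $S$ with constant term zero. The nullcone $\mathcal{N}_{G,V}\subseteq V$ is the common zero set of $\Bbbk[V]^G_+$. A subset $S\subseteq\Bbbk[V]^G$ is a $\sigma$-set if for every $v\in V\setminus\mathcal{N}_{G,V}$ there is $f\in S_+$ with $f(v)\neq 0$. Define $\sigma(G,V)=\min\{d\ge 0 : \Bbbk[V]^G_{\le d}\text{ is a }\sigma\text{-set}\}$ and $\sigma(G)=\sup\{\sigma(G,V): V\text{ a }G\text{-module}\}$ (equal to $\infty$ if unbounded). *)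

theory Defs
  imports
    "Jordan_Normal_Form.Determinant"
    "HOL-Library.Poly_Mapping"
    "HOL-Library.Extended_Nat"
    "HOL-Computational_Algebra.Polynomial"
    "HOL-Algebra.Group"
begin

type_synonym ('x, 'k) mpoly = "('x \<Rightarrow>\<^sub>0 nat) \<Rightarrow>\<^sub>0 'k"

definition mpoly_vars :: "('x, 'k::zero) mpoly \<Rightarrow> 'x set" where
  "mpoly_vars P = (\<Union>m\<in>Poly_Mapping.keys P. Poly_Mapping.keys m)"

definition mpoly_eval :: "('x \<Rightarrow> 'k) \<Rightarrow> ('x, 'k::comm_semiring_1) mpoly \<Rightarrow> 'k" where
  "mpoly_eval a P =
    (\<Sum>m\<in>Poly_Mapping.keys P. Poly_Mapping.lookup P m *
      (\<Prod>x\<in>Poly_Mapping.keys m. a x ^ Poly_Mapping.lookup m x))"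

definition mpoly_degree_le :: "('x, 'k::zero) mpoly \<Rightarrow> nat \<Rightarrow> bool" where
  "mpoly_degree_le P d \<longleftrightarrow>
    (\<forall>m\<in>Poly_Mapping.keys P. (\<Sum>x\<in>Poly_Mapping.keys m. Poly_Mapping.lookup m x) \<le> d)"

definition mpoly_const_term :: "('x, 'k::zero) mpoly \<Rightarrow> 'k" where
  "mpoly_const_term P = Poly_Mapping.lookup P 0"


definition GL :: "nat \<Rightarrow> ('k::field) mat monoid" where
  "GL n = units_of (ring_mat TYPE('k) n ())"

text \<open>A linear algebraic group is a Zariski closed subgroup of some \<open>GL n\<close>.\<close>

definition matrix_polys :: "nat \<Rightarrow> (nat \<times> nat, 'k::field) mpoly set" where
  "matrix_polys n = {P. mpoly_vars P \<subseteq> {..<n} \<times> {..<n}}"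

definition linear_algebraic_group :: "nat \<Rightarrow> ('k::field) mat set \<Rightarrow> bool" where
  "linear_algebraic_group n G \<longleftrightarrow>
     subgroup G (GL n) \<and>
     (\<exists>I \<subseteq> matrix_polys n.
        G = {A \<in> carrier (GL n). \<forall>P\<in>I. mpoly_eval (($$) A) P = 0})"

text \<open>The coordinate ring of a closed subgroup of \<open>GL n\<close> is a quotient of the polynomial ring in
  the matrix entries localised at the determinant.\<close>

definition regular_function :: "nat \<Rightarrow> ('k::field) mat set \<Rightarrow> ('k mat \<Rightarrow> 'k) \<Rightarrow> bool" where
  "regular_function n G \<phi> \<longleftrightarrow>
     (\<exists>P\<in>matrix_polys n. \<exists>e::nat. \<forall>A\<in>G. \<phi> A = mpoly_eval (($$) A) P * inverse (det A) ^ e)"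

text \<open>A module of dimension \<open>m\<close> is given in coordinates, as a rational representation on
  \<open>carrier_vec m\<close>.\<close>

definition G_module ::
    "nat \<Rightarrow> ('k::field) mat set \<Rightarrow> nat \<Rightarrow> ('k mat \<Rightarrow> 'k mat) \<Rightarrow> bool" where
  "G_module n G m \<rho> \<longleftrightarrow>
     \<rho> \<in> hom ((GL n)\<lparr>carrier := G\<rparr>) (GL m) \<and>
     (\<forall>i<m. \<forall>j<m. regular_function n G (\<lambda>A. \<rho> A $$ (i, j)))"


text \<open>Over an infinite field, polynomial functions on \<open>carrier_vec m\<close> are the same as polynomials in
  the coordinates; the polynomials are used so that degree and constant term are available.\<close>

definition coord_ring :: "nat \<Rightarrow> (nat, 'k::field) mpoly set" where
  "coord_ring m = {f. mpoly_vars f \<subseteq> {..<m}}"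

definition poly_fun :: "(nat, 'k::field) mpoly \<Rightarrow> 'k vec \<Rightarrow> 'k" where
  "poly_fun f v = mpoly_eval (($) v) f"

definition invariants ::
    "nat \<Rightarrow> ('k::field) mat set \<Rightarrow> nat \<Rightarrow> ('k mat \<Rightarrow> 'k mat) \<Rightarrow> (nat, 'k) mpoly set" where
  "invariants n G m \<rho> =
     {f \<in> coord_ring m. \<forall>g\<in>G. \<forall>v\<in>carrier_vec m.
        poly_fun f (\<rho> (inv\<^bsub>GL n\<^esub> g) *\<^sub>v v) = poly_fun f v}"

definition invariants_le ::
    "nat \<Rightarrow> ('k::field) mat set \<Rightarrow> nat \<Rightarrow> ('k mat \<Rightarrow> 'k mat) \<Rightarrow> nat \<Rightarrow> (nat, 'k) mpoly set" where
  "invariants_le n G m \<rho> d = {f \<in> invariants n G m \<rho>. mpoly_degree_le f d}"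

definition plus_part :: "(nat, 'k::field) mpoly set \<Rightarrow> (nat, 'k) mpoly set" where
  "plus_part S = {f \<in> S. mpoly_const_term f = 0}"

definition nullcone ::
    "nat \<Rightarrow> ('k::field) mat set \<Rightarrow> nat \<Rightarrow> ('k mat \<Rightarrow> 'k mat) \<Rightarrow> 'k vec set" where
  "nullcone n G m \<rho> =
     {v \<in> carrier_vec m. \<forall>f\<in>plus_part (invariants n G m \<rho>). poly_fun f v = 0}"

definition sigma_set ::
    "nat \<Rightarrow> ('k::field) mat set \<Rightarrow> nat \<Rightarrow> ('k mat \<Rightarrow> 'k mat) \<Rightarrow> (nat, 'k) mpoly set \<Rightarrow> bool" where
  "sigma_set n G m \<rho> S \<longleftrightarrow>
     S \<subseteq> invariants n G m \<rho> \<and>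
     (\<forall>v \<in> carrier_vec m - nullcone n G m \<rho>. \<exists>f\<in>plus_part S. poly_fun f v \<noteq> 0)"

text \<open>The set of degrees below is nonempty, since the ideal generated by the invariants without
  constant term is finitely generated by such invariants; so the infimum in \<^typ>\<open>enat\<close> is a minimum.\<close>

definition sigma_module ::
    "nat \<Rightarrow> ('k::field) mat set \<Rightarrow> nat \<Rightarrow> ('k mat \<Rightarrow> 'k mat) \<Rightarrow> enat" where
  "sigma_module n G m \<rho> = (INF d\<in>{d. sigma_set n G m \<rho> (invariants_le n G m \<rho> d)}. enat d)"

definition sigma :: "nat \<Rightarrow> ('k::field) mat set \<Rightarrow> enat" where
  "sigma n G = (SUP (m, \<rho>)\<in>{(m, \<rho>). G_module n G m \<rho>}. sigma_module n G m \<rho>)"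

end

theory Submission
  imports Defs "Jordan_Normal_Form.Jordan_Normal_Form_Existence" "Jordan_Normal_Form.DL_Rank"
begin

text \<open>
  If \<open>G\<close> is finite and \<open>v \<noteq> 0\<close>, choose a linear form \<open>l\<close> that vanishes nowhere on the orbit of \<open>v\<close>;
  then \<open>\<Prod>g. l \<circ> g\<close> is an invariant of degree \<open>|G|\<close> that does not vanish at \<open>v\<close>.

  If \<open>G\<close> is infinite, take a module \<open>E\<close> of minimal dimension on which \<open>G\<close> acts through an infinite
  group. Fix \<open>d\<close>; we look for a module and a vector at which some invariant without constant term is
  nonzero although all such invariants of degree at most \<open>d\<close> vanish.

  \<^item> If \<open>E\<close> is irreducible, then by Burnside's theorem \<open>G\<close> has infinitely many traces on \<open>E\<close>, so some
    \<open>g\<close> has an eigenvalue \<open>\<lambda>\<close> of large order, and after replacing \<open>g\<close> by a \<open>p\<close>-power it is diagonalizable.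
    On the sum of the dual of \<open>E\<close> and the Frobenius twist of \<open>E\<close> by \<open>q = p ^ s > d\<close> the
    pairing \<open>(\<phi>, w) \<mapsto> \<Sum>i. \<phi> i ^ q * w i\<close> is invariant. At a pair of eigenvectors of \<open>g\<close>
    it is nonzero, while \<open>g\<close> scales the two components by \<open>\<lambda> ^ -1\<close> and \<open>\<lambda> ^ q\<close>, so
    that an invariant of degree at most \<open>d\<close> takes the same value there as at \<open>0\<close>.

  \<^item> If \<open>E\<close> is reducible, then by minimality \<open>G\<close> acts through finite groups on a submodule and on the
    quotient, so that a subgroup \<open>M\<close> of finite index has an additive character \<open>\<chi>\<close> with infinite
    image, which contains a finite group \<open>H\<close> of order \<open>q = p ^ s > d\<close>. Via \<open>\<chi>\<close>, \<open>M\<close> acts by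
    translations on the space \<open>L\<close> of polynomials of degree less than \<open>q\<close>, and \<open>L\<close> is free of rank one
    over \<open>H\<close>. Hence the identity of \<open>L\<close> is a trace \<open>\<Sum>h\<in>H. h u h ^ -1\<close>. An invariant of degree
    less than \<open>|H|\<close> vanishes at every trace of a \<open>p\<close>-group \<open>H\<close>, but the determinant does not vanish at
    the identity. Inducing the module \<open>End L\<close> from \<open>M\<close> to \<open>G\<close> yields the claim.
\<close>

section \<open>Polynomial functions\<close>

definition monom_fun :: "('x \<Rightarrow> 'k) \<Rightarrow> ('x \<Rightarrow>\<^sub>0 nat) \<Rightarrow> 'k::comm_semiring_1" where
  "monom_fun a m = (\<Prod>x\<in>Poly_Mapping.keys m. a x ^ Poly_Mapping.lookup m x)"

definition monom_deg :: "('x \<Rightarrow>\<^sub>0 nat) \<Rightarrow> nat" where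
  "monom_deg m = (\<Sum>x\<in>Poly_Mapping.keys m. Poly_Mapping.lookup m x)"

lemma monom_fun_superset:
  assumes "finite S" "Poly_Mapping.keys m \<subseteq> S"
  shows "monom_fun a m = (\<Prod>x\<in>S. a x ^ Poly_Mapping.lookup m x)"
  unfolding monom_fun_def using assms
  by (intro prod.mono_neutral_left) (auto simp: in_keys_iff)

lemma monom_deg_superset:
  assumes "finite S" "Poly_Mapping.keys m \<subseteq> S"
  shows "monom_deg m = (\<Sum>x\<in>S. Poly_Mapping.lookup m x)"
  unfolding monom_deg_def using assms
  by (intro sum.mono_neutral_left) (auto simp: in_keys_iff)

lemma monom_fun_add: "monom_fun a (m + m') = monom_fun a m * monom_fun a m'"
proof -
  define S where "S = Poly_Mapping.keys m \<union> Poly_Mapping.keys m'"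
  have S: "finite S" "Poly_Mapping.keys m \<subseteq> S" "Poly_Mapping.keys m' \<subseteq> S"
    "Poly_Mapping.keys (m + m') \<subseteq> S"
    using keys_add[of m m'] by (auto simp: S_def)
  show ?thesis
    by (simp add: monom_fun_superset[OF S(1,2)] monom_fun_superset[OF S(1,3)]
        monom_fun_superset[OF S(1,4)] lookup_add power_add prod.distrib)
qed

lemma monom_deg_add: "monom_deg (m + m') = monom_deg m + monom_deg m'"
proof -
  define S where "S = Poly_Mapping.keys m \<union> Poly_Mapping.keys m'"
  have S: "finite S" "Poly_Mapping.keys m \<subseteq> S" "Poly_Mapping.keys m' \<subseteq> S"
    "Poly_Mapping.keys (m + m') \<subseteq> S"
    using keys_add[of m m'] by (auto simp: S_def)
  show ?thesis
    by (simp add: monom_deg_superset[OF S(1,2)] monom_deg_superset[OF S(1,3)]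
        monom_deg_superset[OF S(1,4)] lookup_add sum.distrib)
qed

lemma mpoly_eval_superset:
  assumes "finite K" "Poly_Mapping.keys P \<subseteq> K"
  shows "mpoly_eval a P = (\<Sum>m\<in>K. Poly_Mapping.lookup P m * monom_fun a m)"
  unfolding mpoly_eval_def monom_fun_def[symmetric] using assms
  by (intro sum.mono_neutral_left) (auto simp: in_keys_iff)

lemma mpoly_eval_zero [simp]: "mpoly_eval a 0 = 0"
  by (simp add: mpoly_eval_def)

lemma mpoly_eval_add: "mpoly_eval a (P + Q) = mpoly_eval a P + mpoly_eval a Q"
proof -
  define K where "K = Poly_Mapping.keys P \<union> Poly_Mapping.keys Q"
  have K: "finite K" "Poly_Mapping.keys P \<subseteq> K" "Poly_Mapping.keys Q \<subseteq> K"
    "Poly_Mapping.keys (P + Q) \<subseteq> K"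
    using keys_add[of P Q] by (auto simp: K_def)
  show ?thesis
    by (simp add: mpoly_eval_superset[OF K(1,2)] mpoly_eval_superset[OF K(1,3)]
        mpoly_eval_superset[OF K(1,4)] lookup_add algebra_simps sum.distrib)
qed

lemma mpoly_eval_sum: "mpoly_eval a (sum P A) = (\<Sum>x\<in>A. mpoly_eval a (P x))"
  by (induction A rule: infinite_finite_induct) (auto simp: mpoly_eval_add)

lemma mpoly_eval_single: "mpoly_eval a (Poly_Mapping.single m c) = c * monom_fun a m"
  by (subst mpoly_eval_superset[of "{m}"]) auto

lemma poly_mapping_eq_sum_single:
  "P = (\<Sum>m\<in>Poly_Mapping.keys P. Poly_Mapping.single m (Poly_Mapping.lookup P m))"
proof (rule poly_mapping_eqI)
  fix k
  show "Poly_Mapping.lookup P k = Poly_Mapping.lookup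
      (\<Sum>m\<in>Poly_Mapping.keys P. Poly_Mapping.single m (Poly_Mapping.lookup P m)) k"
    by (simp add: lookup_sum lookup_single when_def sum.delta in_keys_iff)
qed

lemma mpoly_eval_mult: "mpoly_eval a (P * Q) = mpoly_eval a P * mpoly_eval a Q"
proof -
  have "P * Q = (\<Sum>m\<in>Poly_Mapping.keys P. \<Sum>m'\<in>Poly_Mapping.keys Q.
      Poly_Mapping.single (m + m') (Poly_Mapping.lookup P m * Poly_Mapping.lookup Q m'))"
    by (subst poly_mapping_eq_sum_single[of P], subst poly_mapping_eq_sum_single[of Q])
       (simp add: sum_product mult_single)
  then have "mpoly_eval a (P * Q) = (\<Sum>m\<in>Poly_Mapping.keys P. \<Sum>m'\<in>Poly_Mapping.keys Q.
      (Poly_Mapping.lookup P m * Poly_Mapping.lookup Q m') * monom_fun a (m + m'))"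
    by (simp only: mpoly_eval_sum mpoly_eval_single)
  then show ?thesis
    by (simp add: monom_fun_add mpoly_eval_superset[OF finite_keys order_refl] sum_product mult_ac)
qed

lemma mpoly_degree_le_iff: "mpoly_degree_le P d \<longleftrightarrow> (\<forall>m\<in>Poly_Mapping.keys P. monom_deg m \<le> d)"
  by (simp add: mpoly_degree_le_def monom_deg_def)

lemma mpoly_vars_add: "mpoly_vars (P + Q) \<subseteq> mpoly_vars P \<union> mpoly_vars Q"
  using keys_add[of P Q] by (auto simp: mpoly_vars_def)

lemma mpoly_vars_mult:
  "mpoly_vars (P * Q) \<subseteq> mpoly_vars P \<union> mpoly_vars (Q :: ('x, 'k::comm_semiring_1) mpoly)"
proof
  fix x assume "x \<in> mpoly_vars (P * Q)"
  then obtain m where m: "m \<in> Poly_Mapping.keys (P * Q)" "x \<in> Poly_Mapping.keys m"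
    by (auto simp: mpoly_vars_def)
  then obtain a b where "m = a + b" "a \<in> Poly_Mapping.keys P" "b \<in> Poly_Mapping.keys Q"
    using keys_mult[of P Q] by blast
  then show "x \<in> mpoly_vars P \<union> mpoly_vars Q"
    using m(2) keys_add[of a b] by (auto simp: mpoly_vars_def)
qed

text \<open>Functions take the place of polynomials in the later arguments, so that sums, products
  and substitutions need no syntactic computation; \<open>d\<close> only bounds the degree of some
  representing polynomial.\<close>

definition polynomial_fun :: "'x set \<Rightarrow> nat \<Rightarrow> (('x \<Rightarrow> 'k) \<Rightarrow> 'k::comm_ring_1) \<Rightarrow> bool" where
  "polynomial_fun I d F \<longleftrightarrow>
     (\<exists>P. mpoly_vars P \<subseteq> I \<and> mpoly_degree_le P d \<and> (\<forall>v. F v = mpoly_eval v P))"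

lemma polynomial_fun_const: "polynomial_fun I d (\<lambda>v. c)"
  unfolding polynomial_fun_def
  by (rule exI[of _ "Poly_Mapping.single 0 c"])
     (auto simp: mpoly_vars_def mpoly_degree_le_iff mpoly_eval_single monom_fun_def monom_deg_def
       split: if_splits)

lemma polynomial_fun_var: "i \<in> I \<Longrightarrow> polynomial_fun I 1 (\<lambda>v. v i)"
  unfolding polynomial_fun_def
  by (rule exI[of _ "Poly_Mapping.single (Poly_Mapping.single i 1) 1"])
     (auto simp: mpoly_vars_def mpoly_degree_le_iff mpoly_eval_single monom_fun_def monom_deg_def
       split: if_splits)

lemma polynomial_fun_add:
  assumes "polynomial_fun I d F" "polynomial_fun I d F'"
  shows "polynomial_fun I d (\<lambda>v. F v + F' v)"
proof -
  obtain P Q where P: "mpoly_vars P \<subseteq> I" "mpoly_degree_le P d" "\<And>v. F v = mpoly_eval v P"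
    and Q: "mpoly_vars Q \<subseteq> I" "mpoly_degree_le Q d" "\<And>v. F' v = mpoly_eval v Q"
    using assms unfolding polynomial_fun_def by metis
  show ?thesis
    unfolding polynomial_fun_def
  proof (intro exI[of _ "P + Q"] conjI)
    show "mpoly_vars (P + Q) \<subseteq> I" using mpoly_vars_add[of P Q] P Q by blast
    show "mpoly_degree_le (P + Q) d" using keys_add[of P Q] P(2) Q(2)
      by (auto simp: mpoly_degree_le_iff)
  qed (simp add: mpoly_eval_add P Q)
qed

lemma polynomial_fun_mult:
  assumes "polynomial_fun I d F" "polynomial_fun I e F'"
  shows "polynomial_fun I (d + e) (\<lambda>v. F v * F' v)"
proof -
  obtain P Q where P: "mpoly_vars P \<subseteq> I" "mpoly_degree_le P d" "\<And>v. F v = mpoly_eval v P"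
    and Q: "mpoly_vars Q \<subseteq> I" "mpoly_degree_le Q e" "\<And>v. F' v = mpoly_eval v Q"
    using assms unfolding polynomial_fun_def by metis
  show ?thesis
    unfolding polynomial_fun_def
  proof (intro exI[of _ "P * Q"] conjI)
    show "mpoly_vars (P * Q) \<subseteq> I" using mpoly_vars_mult[of P Q] P Q by blast
    show "mpoly_degree_le (P * Q) (d + e)"
      unfolding mpoly_degree_le_iff
    proof
      fix m assume "m \<in> Poly_Mapping.keys (P * Q)"
      then obtain a b where "m = a + b" "a \<in> Poly_Mapping.keys P" "b \<in> Poly_Mapping.keys Q"
        using keys_mult[of P Q] by blast
      then show "monom_deg m \<le> d + e"
        using P(2) Q(2) by (auto simp: mpoly_degree_le_iff monom_deg_add intro!: add_mono)
    qed
  qed (simp add: mpoly_eval_mult P Q)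
qed

lemma polynomial_fun_mono: "polynomial_fun I d F \<Longrightarrow> d \<le> e \<Longrightarrow> polynomial_fun I e F"
  unfolding polynomial_fun_def mpoly_degree_le_iff by (meson order_trans)

lemma polynomial_fun_cmult: "polynomial_fun I d F \<Longrightarrow> polynomial_fun I d (\<lambda>v. c * F v)"
  using polynomial_fun_mult[OF polynomial_fun_const[of I 0]] by fastforce

lemma polynomial_fun_sum:
  assumes "\<And>x. x \<in> A \<Longrightarrow> polynomial_fun I d (F x)"
  shows "polynomial_fun I d (\<lambda>v. \<Sum>x\<in>A. F x v)"
  using assms
  by (induction A rule: infinite_finite_induct)
     (auto intro: polynomial_fun_const polynomial_fun_add)

lemma polynomial_fun_prod:
  assumes "\<And>x. x \<in> A \<Longrightarrow> polynomial_fun I (d x) (F x)"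
  shows "polynomial_fun I (\<Sum>x\<in>A. d x) (\<lambda>v. \<Prod>x\<in>A. F x v)"
  using assms
  by (induction A rule: infinite_finite_induct)
     (auto intro: polynomial_fun_const polynomial_fun_mult)

lemma polynomial_fun_power:
  "polynomial_fun I d F \<Longrightarrow> polynomial_fun I (d * e) (\<lambda>v. F v ^ e)"
  by (induction e) (auto intro: polynomial_fun_const polynomial_fun_mult)

lemma polynomial_fun_linear:
  assumes "\<And>x. x \<in> A \<Longrightarrow> g x \<in> I"
  shows "polynomial_fun I 1 (\<lambda>v. \<Sum>x\<in>A. c x * v (g x))"
  using assms by (intro polynomial_fun_sum polynomial_fun_cmult polynomial_fun_var)

lemma polynomial_funE:
  assumes "polynomial_fun I d F"
  obtains K c where "finite K" "\<And>m. m \<in> K \<Longrightarrow> Poly_Mapping.keys m \<subseteq> I"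
    "\<And>m. m \<in> K \<Longrightarrow> monom_deg m \<le> d" "\<And>v. F v = (\<Sum>m\<in>K. c m * monom_fun v m)"
proof -
  obtain P where P: "mpoly_vars P \<subseteq> I" "mpoly_degree_le P d" "\<And>v. F v = mpoly_eval v P"
    using assms unfolding polynomial_fun_def by metis
  show ?thesis
    by (rule that[of "Poly_Mapping.keys P" "Poly_Mapping.lookup P"])
       (use P in \<open>auto simp: mpoly_vars_def mpoly_degree_le_iff mpoly_eval_def monom_fun_def\<close>)
qed

text \<open>Each variable of a monomial is replaced by a factor of degree at most 1, so the bound
  survives. Renaming of variables is a special case.\<close>

lemma polynomial_fun_comp:
  assumes "polynomial_fun I d F" "\<And>i. i \<in> I \<Longrightarrow> polynomial_fun J 1 (\<lambda>v. L v i)"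
  shows "polynomial_fun J d (\<lambda>v. F (L v))"
proof -
  obtain K c where K: "\<And>m. m \<in> K \<Longrightarrow> Poly_Mapping.keys m \<subseteq> I"
    "\<And>m. m \<in> K \<Longrightarrow> monom_deg m \<le> d" "\<And>v. F v = (\<Sum>m\<in>K. c m * monom_fun v m)"
    using polynomial_funE[OF assms(1)] by metis
  have "polynomial_fun J d (\<lambda>v. monom_fun (L v) m)" if "m \<in> K" for m
  proof -
    have "polynomial_fun J (\<Sum>x\<in>Poly_Mapping.keys m. 1 * Poly_Mapping.lookup m x)
        (\<lambda>v. \<Prod>x\<in>Poly_Mapping.keys m. L v x ^ Poly_Mapping.lookup m x)"
      using K(1)[OF that] by (intro polynomial_fun_prod polynomial_fun_power assms) auto
    then show ?thesis
      using K(2)[OF that] by (auto simp: monom_fun_def monom_deg_def intro: polynomial_fun_mono)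
  qed
  then show ?thesis
    unfolding K(3) by (intro polynomial_fun_sum polynomial_fun_cmult)
qed

text \<open>Only coordinates in \<open>I\<close> enter the monomials, so it is irrelevant how a
  family is extended outside \<open>I\<close>.\<close>

lemma polynomial_fun_cong_on:
  assumes "polynomial_fun I d F" "\<And>i. i \<in> I \<Longrightarrow> v i = w i"
  shows "F v = F w"
proof -
  obtain K c where K: "\<And>m. m \<in> K \<Longrightarrow> Poly_Mapping.keys m \<subseteq> I"
    "\<And>v. F v = (\<Sum>m\<in>K. c m * monom_fun v m)"
    using polynomial_funE[OF assms(1)] by metis
  show ?thesis
    unfolding K(2) using K(1) assms(2)
    by (intro sum.cong arg_cong2[where f = "(*)"]) (auto simp: monom_fun_def subset_iff intro!: prod.cong)
qed

lemma polynomial_fun_vec: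
  assumes "f \<in> coord_ring m" "mpoly_degree_le f d"
  shows "polynomial_fun {..<m} d (\<lambda>v. mpoly_eval v f)"
  using assms unfolding polynomial_fun_def coord_ring_def by blast

lemma mpoly_has_degree: "\<exists>d. mpoly_degree_le P d"
proof -
  have "monom_deg m \<le> (\<Sum>m\<in>Poly_Mapping.keys P. monom_deg m)" if "m \<in> Poly_Mapping.keys P" for m
    using that by (intro member_le_sum) auto
  then show ?thesis unfolding mpoly_degree_le_iff by blast
qed

lemma mpoly_eval_0:
  fixes P :: "('x, 'k::comm_semiring_1) mpoly"
  shows "mpoly_eval (\<lambda>_. 0) P = mpoly_const_term P"
proof -
  have "monom_fun (\<lambda>_. 0) m = (if m = 0 then 1 else (0::'k))" for m :: "'x \<Rightarrow>\<^sub>0 nat"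
  proof (cases "m = 0")
    case False
    then obtain x where "x \<in> Poly_Mapping.keys m" by fastforce
    then have "\<exists>x\<in>Poly_Mapping.keys m. (0::'k) ^ Poly_Mapping.lookup m x = 0"
      by (intro bexI[of _ x] zero_power) (auto simp: in_keys_iff)
    then show ?thesis using False
      unfolding monom_fun_def by (simp only: prod_zero[OF finite_keys] if_False)
  qed (auto simp: monom_fun_def)
  then have "mpoly_eval (\<lambda>_. 0) P = (\<Sum>m\<in>insert 0 (Poly_Mapping.keys P).
      Poly_Mapping.lookup P m * (if m = 0 then 1 else 0))"
    by (subst mpoly_eval_superset[of "insert 0 (Poly_Mapping.keys P)"]) auto
  then show ?thesis by (simp add: mpoly_const_term_def if_distrib sum.delta cong: if_cong)
qed

lemma polynomial_fun_det:
  fixes h :: "nat \<Rightarrow> nat \<Rightarrow> 'x" and I :: "'x set"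
  assumes "\<And>i j. i < q \<Longrightarrow> j < q \<Longrightarrow> h i j \<in> I"
  shows "polynomial_fun I q (\<lambda>v :: 'x \<Rightarrow> 'k::comm_ring_1. det (mat q q (\<lambda>(i, j). v (h i j))))"
proof -
  have "polynomial_fun I (\<Sum>i=0..<q. 1)
      (\<lambda>v :: 'x \<Rightarrow> 'k. \<Sum>p | p permutes {0..<q}. signof p * (\<Prod>i = 0..<q. v (h i (p i))))"
    by (intro polynomial_fun_sum polynomial_fun_cmult polynomial_fun_prod polynomial_fun_var assms)
       (auto dest: permutes_in_image)
  moreover have "det (mat q q (\<lambda>(i, j). v (h i j))) = (\<Sum>p | p permutes {0..<q}. signof p * (\<Prod>i = 0..<q. v (h i (p i))))"
    for v :: "'x \<Rightarrow> 'k"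
    by (subst det_def'[of _ q]) (auto intro!: sum.cong prod.cong arg_cong2[where f = "(*)"] dest: permutes_in_image)
  ultimately show ?thesis by simp
qed

section \<open>Regular functions\<close>

lemma carrier_GL: "carrier (GL n) = {A \<in> carrier_mat n n. det A \<noteq> 0}"
  unfolding GL_def units_of_carrier
  using unit_imp_det_non_zero[where 'a = 'a and n = n and b = "()"] det_non_zero_imp_unit[where 'a = 'a and n = n and b = "()"]
  by (auto simp: Units_def ring_mat_def)

lemma mult_GL: "A \<otimes>\<^bsub>GL n\<^esub> B = A * B"
  by (simp add: GL_def units_of_mult ring_mat_def)

lemma one_GL: "\<one>\<^bsub>GL n\<^esub> = 1\<^sub>m n"
  by (simp add: GL_def units_of_one ring_mat_def)

lemma group_GL: "group (GL n :: 'k::field mat monoid)"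
proof -
  interpret ring "ring_mat TYPE('k) n ()" by (rule ring_mat)
  show ?thesis unfolding GL_def by (rule units_group)
qed

locale linear_group =
  fixes n :: nat and G :: "'k::field mat set"
  assumes subgroup_GL: "subgroup G (GL n)"
begin

abbreviation ginv :: "'k mat \<Rightarrow> 'k mat" where "ginv A \<equiv> inv\<^bsub>GL n\<^esub> A"

lemma G_carrier: "A \<in> G \<Longrightarrow> A \<in> carrier_mat n n"
  and G_det: "A \<in> G \<Longrightarrow> det A \<noteq> 0"
  using subgroup.subset[OF subgroup_GL] by (auto simp: carrier_GL)

lemma G_one: "1\<^sub>m n \<in> G"
  using subgroup.one_closed[OF subgroup_GL] by (simp add: one_GL)

lemma G_mult: "A \<in> G \<Longrightarrow> B \<in> G \<Longrightarrow> A * B \<in> G"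
  using subgroup.m_closed[OF subgroup_GL] by (simp add: mult_GL)

lemma G_inv: "A \<in> G \<Longrightarrow> ginv A \<in> G"
  using subgroup.m_inv_closed[OF subgroup_GL] by simp

lemma G_inv_left: "A \<in> G \<Longrightarrow> ginv A * A = 1\<^sub>m n"
  using group.l_inv[OF group_GL, of A n] subgroup.mem_carrier[OF subgroup_GL]
  by (simp add: mult_GL one_GL)

lemma G_inv_right: "A \<in> G \<Longrightarrow> A * ginv A = 1\<^sub>m n"
  using group.r_inv[OF group_GL, of A n] subgroup.mem_carrier[OF subgroup_GL]
  by (simp add: mult_GL one_GL)

lemma G_inv_inv: "A \<in> G \<Longrightarrow> ginv (ginv A) = A"
  using group.inv_inv[OF group_GL, of A n] subgroup.mem_carrier[OF subgroup_GL] by simp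

lemma G_inv_mult: "A \<in> G \<Longrightarrow> B \<in> G \<Longrightarrow> ginv (A * B) = ginv B * ginv A"
  using group.inv_mult_group[OF group_GL, of A n B] subgroup.mem_carrier[OF subgroup_GL]
  by (simp add: mult_GL)

lemma G_inv_one: "ginv (1\<^sub>m n) = 1\<^sub>m n"
  using monoid.inv_one[OF group.is_monoid[OF group_GL]] by (simp add: one_GL)

lemma G_assoc: "A \<in> G \<Longrightarrow> B \<in> G \<Longrightarrow> C \<in> G \<Longrightarrow> A * B * C = A * (B * C)"
  using G_carrier by (metis assoc_mult_mat)

lemma G_mult_one: "A \<in> G \<Longrightarrow> 1\<^sub>m n * A = A" "A \<in> G \<Longrightarrow> A * 1\<^sub>m n = A"
  using G_carrier by (metis left_mult_one_mat, metis right_mult_one_mat)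

lemma G_cancel: "A \<in> G \<Longrightarrow> B \<in> G \<Longrightarrow> ginv A * (A * B) = B" "A \<in> G \<Longrightarrow> B \<in> G \<Longrightarrow> A * (ginv A * B) = B"
  by (simp_all add: G_assoc[symmetric] G_inv G_inv_left G_inv_right G_mult_one)

abbreviation regular :: "('k mat \<Rightarrow> 'k) \<Rightarrow> bool" where "regular \<equiv> regular_function n G"

lemma regularI:
  assumes "polynomial_fun ({..<n} \<times> {..<n}) d F"
    and "\<And>A. A \<in> G \<Longrightarrow> \<phi> A = F (($$) A) * inverse (det A) ^ e"
  shows "regular \<phi>"
proof -
  obtain P where "mpoly_vars P \<subseteq> {..<n} \<times> {..<n}" "\<And>v. F v = mpoly_eval v P"
    using assms(1) unfolding polynomial_fun_def by metis
  then show ?thesis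
    unfolding regular_function_def matrix_polys_def using assms(2)
    by (intro bexI[of _ P] exI[of _ e]) auto
qed

lemma regularE:
  assumes "regular \<phi>"
  obtains d F e where "polynomial_fun ({..<n} \<times> {..<n}) d F"
    and "\<And>A. A \<in> G \<Longrightarrow> \<phi> A = F (($$) A) * inverse (det A) ^ e"
proof -
  obtain P e where P: "mpoly_vars P \<subseteq> {..<n} \<times> {..<n}"
      "\<And>A. A \<in> G \<Longrightarrow> \<phi> A = mpoly_eval (($$) A) P * inverse (det A) ^ e"
    using assms unfolding regular_function_def matrix_polys_def by blast
  obtain d where "mpoly_degree_le P d" using mpoly_has_degree by blast
  then have "polynomial_fun ({..<n} \<times> {..<n}) d (\<lambda>v. mpoly_eval v P)"
    unfolding polynomial_fun_def using P(1) by blast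
  from that[OF this P(2)] show ?thesis .
qed

lemma regular_cong: "regular \<phi> \<Longrightarrow> (\<And>A. A \<in> G \<Longrightarrow> \<psi> A = \<phi> A) \<Longrightarrow> regular \<psi>"
  unfolding regular_function_def by (metis (no_types, lifting))

lemma regular_const: "regular (\<lambda>_. c)"
  by (rule regularI[OF polynomial_fun_const[of _ 0 c], where e = 0]) auto

lemma regular_entry: "i < n \<Longrightarrow> j < n \<Longrightarrow> regular (\<lambda>A. A $$ (i, j))"
  by (rule regularI[OF polynomial_fun_var[of "(i, j)"], where e = 0]) auto

lemma regular_inverse_det: "regular (\<lambda>A. inverse (det A))"
  by (rule regularI[OF polynomial_fun_const[of _ 0 1], where e = 1]) auto

lemma regular_mult:
  assumes "regular \<phi>" "regular \<psi>"
  shows "regular (\<lambda>A. \<phi> A * \<psi> A)"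
proof -
  obtain d F e where F: "polynomial_fun ({..<n} \<times> {..<n}) d F"
    "\<And>A. A \<in> G \<Longrightarrow> \<phi> A = F (($$) A) * inverse (det A) ^ e"
    using regularE[OF assms(1)] by metis
  obtain d' F' e' where F': "polynomial_fun ({..<n} \<times> {..<n}) d' F'"
    "\<And>A. A \<in> G \<Longrightarrow> \<psi> A = F' (($$) A) * inverse (det A) ^ e'"
    using regularE[OF assms(2)] by metis
  show ?thesis
    by (rule regularI[OF polynomial_fun_mult[OF F(1) F'(1)], where e = "e + e'"])
       (simp add: F F' power_add)
qed

lemma regular_add:
  assumes "regular \<phi>" "regular \<psi>"
  shows "regular (\<lambda>A. \<phi> A + \<psi> A)"
proof -
  let ?I = "{..<n} \<times> {..<n}"
  obtain d F e where F: "polynomial_fun ?I d F"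
    "\<And>A. A \<in> G \<Longrightarrow> \<phi> A = F (($$) A) * inverse (det A) ^ e"
    using regularE[OF assms(1)] by metis
  obtain d' F' e' where F': "polynomial_fun ?I d' F'"
    "\<And>A. A \<in> G \<Longrightarrow> \<psi> A = F' (($$) A) * inverse (det A) ^ e'"
    using regularE[OF assms(2)] by metis
  \<comment> \<open>The determinant as a polynomial in the entries: \<open>F\<close> and
    \<open>F'\<close> are multiplied by powers of it to reach the common denominator
    \<open>det A ^ (e + e')\<close>.\<close>
  define D :: "(nat \<times> nat \<Rightarrow> 'k) \<Rightarrow> 'k" where "D v = det (mat n n (\<lambda>(i, j). v (i, j)))" for v
  have D: "polynomial_fun ?I n D" unfolding D_def by (rule polynomial_fun_det) auto
  have D_det: "D (($$) A) = det A" if "A \<in> G" for A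
    unfolding D_def using G_carrier[OF that] by (intro arg_cong[where f = det] eq_matI) auto
  let ?m = "d + n * e' + (d' + n * e)"
  have 1: "polynomial_fun ?I (d + n * e') (\<lambda>v. F v * D v ^ e')"
    by (intro polynomial_fun_mult polynomial_fun_power F D)
  have 2: "polynomial_fun ?I (d' + n * e) (\<lambda>v. F' v * D v ^ e)"
    by (intro polynomial_fun_mult polynomial_fun_power F' D)
  have "polynomial_fun ?I ?m (\<lambda>v. F v * D v ^ e' + F' v * D v ^ e)"
    by (intro polynomial_fun_add polynomial_fun_mono[OF 1] polynomial_fun_mono[OF 2]) auto
  moreover have "\<phi> A + \<psi> A
      = (F (($$) A) * D (($$) A) ^ e' + F' (($$) A) * D (($$) A) ^ e) * inverse (det A) ^ (e + e')"
    if "A \<in> G" for A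
    using G_det[OF that] by (simp add: F F' that D_det power_add field_simps)
  ultimately show ?thesis by (rule regularI)
qed

lemma regular_sum: "(\<And>x. x \<in> X \<Longrightarrow> regular (\<phi> x)) \<Longrightarrow> regular (\<lambda>A. \<Sum>x\<in>X. \<phi> x A)"
  by (induction X rule: infinite_finite_induct) (auto intro: regular_const regular_add)

lemma regular_prod: "(\<And>x. x \<in> X \<Longrightarrow> regular (\<phi> x)) \<Longrightarrow> regular (\<lambda>A. \<Prod>x\<in>X. \<phi> x A)"
  by (induction X rule: infinite_finite_induct) (auto intro: regular_const regular_mult)

lemma regular_power: "regular \<phi> \<Longrightarrow> regular (\<lambda>A. \<phi> A ^ e)"
  by (induction e) (auto intro: regular_const regular_mult)

lemma regular_polynomial_fun:
  assumes "polynomial_fun I d F" "\<And>i. i \<in> I \<Longrightarrow> regular (\<lambda>A. L A i)"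
  shows "regular (\<lambda>A. F (L A))"
proof -
  obtain K c where K: "\<And>m. m \<in> K \<Longrightarrow> Poly_Mapping.keys m \<subseteq> I"
    "\<And>v. F v = (\<Sum>m\<in>K. c m * monom_fun v m)"
    using polynomial_funE[OF assms(1)] by metis
  show ?thesis
    unfolding K(2) monom_fun_def using K(1)
    by (intro regular_sum regular_mult[OF regular_const] regular_prod regular_power assms(2)) auto
qed

lemma regular_det:
  assumes "\<And>i j. i < m \<Longrightarrow> j < m \<Longrightarrow> regular (\<lambda>A. M A $$ (i, j))"
    and "\<And>A. A \<in> G \<Longrightarrow> M A \<in> carrier_mat m m"
  shows "regular (\<lambda>A. det (M A))"
proof -
  have "regular (\<lambda>A. \<Sum>p | p permutes {0..<m}. signof p * (\<Prod>i = 0..<m. M A $$ (i, p i)))"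
    by (intro regular_sum regular_mult[OF regular_const] regular_prod assms(1))
       (auto dest: permutes_in_image)
  then show ?thesis
    by (rule regular_cong) (simp add: det_def'[OF assms(2)])
qed

lemma regular_comp:
  assumes "regular \<phi>" "\<And>A. A \<in> G \<Longrightarrow> \<theta> A \<in> G"
    and "\<And>i j. i < n \<Longrightarrow> j < n \<Longrightarrow> regular (\<lambda>A. \<theta> A $$ (i, j))"
    and "regular (\<lambda>A. inverse (det (\<theta> A)))"
  shows "regular (\<lambda>A. \<phi> (\<theta> A))"
proof -
  obtain d F e where F: "polynomial_fun ({..<n} \<times> {..<n}) d F"
    "\<And>A. A \<in> G \<Longrightarrow> \<phi> A = F (($$) A) * inverse (det A) ^ e"
    using regularE[OF assms(1)] by metis
  have "regular (\<lambda>A. F (($$) (\<theta> A)) * inverse (det (\<theta> A)) ^ e)"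
    using assms(3) by (intro regular_mult regular_power regular_polynomial_fun[OF F(1)] assms(4)) auto
  then show ?thesis
    by (rule regular_cong) (simp add: F(2) assms(2))
qed

text \<open>The inverse is the adjugate divided by the determinant, so its entries are cofactors
  times \<open>inverse (det A)\<close>; the inverse of its determinant is \<open>det A\<close>
  itself.\<close>

lemma regular_inv:
  assumes "regular \<phi>"
  shows "regular (\<lambda>A. \<phi> (ginv A))"
proof (rule regular_comp[OF assms G_inv])
  have inv_eq: "ginv A = inverse (det A) \<cdot>\<^sub>m adj_mat A" if "A \<in> G" for A
  proof -
    note A = G_carrier[OF that] G_carrier[OF G_inv[OF that]]
    have "ginv A * (A * adj_mat A) = ginv A * A * adj_mat A"
      using A adj_mat(1)[OF A(1)] by (simp add: assoc_mult_mat)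
    also have "\<dots> = adj_mat A" using adj_mat(1)[OF A(1)] by (simp add: G_inv_left that)
    finally have "adj_mat A = det A \<cdot>\<^sub>m ginv A"
      using A by (simp add: adj_mat(2)[OF A(1)] mult_smult_distrib[where n = n and nc = n])
    then show ?thesis using G_det[OF that] A(2)
      by (intro eq_matI) (auto simp: field_simps)
  qed
  show "regular (\<lambda>A. ginv A $$ (i, j))" if ij: "i < n" "j < n" for i j
  proof -
    have "regular (\<lambda>A. det (mat_delete A j i))"
    proof (rule regular_det[of "n - 1"])
      fix a b assume ab: "a < n - 1" "b < n - 1"
      have "regular (\<lambda>A. A $$ (if a < j then a else Suc a, if b < i then b else Suc b))"
        by (rule regular_entry) (use ab in auto)
      then show "regular (\<lambda>A. mat_delete A j i $$ (a, b))"
        by (rule regular_cong) (use ab in \<open>auto simp: mat_delete_def dest: G_carrier\<close>)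
    next
      fix A assume "A \<in> G"
      then show "mat_delete A j i \<in> carrier_mat (n - 1) (n - 1)"
        using G_carrier by (metis mat_delete_carrier)
    qed
    then have "regular (\<lambda>A. inverse (det A) * ((-1) ^ (j + i) * det (mat_delete A j i)))"
      by (intro regular_mult regular_const regular_inverse_det)
    then show ?thesis
      by (rule regular_cong) (use ij in \<open>auto simp: inv_eq adj_mat_def cofactor_def dest!: G_carrier\<close>)
  qed
  have "regular (\<lambda>A. det A)"
    by (rule regular_det[of n]) (auto intro: regular_entry G_carrier)
  then show "regular (\<lambda>A. inverse (det (ginv A)))"
  proof (rule regular_cong)
    fix A assume A: "A \<in> G"
    have "det A * det (ginv A) = 1"
      using det_mult[OF G_carrier[OF A] G_carrier[OF G_inv[OF A]]] by (simp add: G_inv_right A)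
    then show "inverse (det (ginv A)) = det A"
      by (metis inverse_unique mult.commute)
  qed
qed

lemma regular_translate:
  assumes "regular \<phi>" "B \<in> G" "C \<in> G"
  shows "regular (\<lambda>A. \<phi> (B * A * C))"
proof (rule regular_comp[OF assms(1)])
  note BC = G_carrier[OF assms(2)] G_carrier[OF assms(3)]
  show "B * A * C \<in> G" if "A \<in> G" for A using that assms by (intro G_mult)
  show "regular (\<lambda>A. (B * A * C) $$ (i, j))" if ij: "i < n" "j < n" for i j
  proof -
    have "regular (\<lambda>A. \<Sum>k = 0..<n. B $$ (i, k) * (\<Sum>l = 0..<n. A $$ (k, l) * C $$ (l, j)))"
      by (intro regular_sum regular_mult regular_const regular_entry) auto
    then show ?thesis
      proof (rule regular_cong)
      fix A assume "A \<in> G"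
      then show "(B * A * C) $$ (i, j)
          = (\<Sum>k = 0..<n. B $$ (i, k) * (\<Sum>l = 0..<n. A $$ (k, l) * C $$ (l, j)))"
        using ij BC G_carrier[OF \<open>A \<in> G\<close>] by (simp add: scalar_prod_def)
    qed
  qed
  show "regular (\<lambda>A. inverse (det (B * A * C)))"
  proof (rule regular_cong[OF regular_mult[OF regular_const[of "inverse (det B * det C)"] regular_inverse_det]])
    fix A assume "A \<in> G"
    note A = G_carrier[OF this]
    show "inverse (det (B * A * C)) = inverse (det B * det C) * inverse (det A)"
      using det_mult[OF mult_carrier_mat[OF BC(1) A] BC(2)] det_mult[OF BC(1) A] by simp
  qed
qed

text \<open>Lagrange interpolation at the finitely many values of \<open>\<phi>\<close>: the product
  of \<open>(x - b) / (c - b)\<close> over the other values \<open>b\<close> is 1 at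
  \<open>c\<close> and 0 at each \<open>b\<close>.\<close>

lemma regular_indicator:
  assumes "regular \<phi>" "finite (\<phi> ` G)"
  shows "regular (\<lambda>A. if \<phi> A = c then 1 else 0)"
proof (cases "c \<in> \<phi> ` G")
  case False
  show ?thesis by (rule regular_cong[OF regular_const[of 0]]) (use False in auto)
next
  case True
  have "regular (\<lambda>A. \<Prod>b\<in>\<phi> ` G - {c}. inverse (c - b) * (\<phi> A + - b))"
    by (intro regular_prod regular_mult regular_const regular_add assms(1))
  then show ?thesis
  proof (rule regular_cong)
    fix A assume A: "A \<in> G"
    show "(if \<phi> A = c then 1 else 0) = (\<Prod>b\<in>\<phi> ` G - {c}. inverse (c - b) * (\<phi> A + - b))"
    proof (cases "\<phi> A = c")
      case True
      then have "(\<Prod>b\<in>\<phi> ` G - {c}. inverse (c - b) * (\<phi> A + - b)) = 1"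
        by (intro prod.neutral) (auto simp: field_simps)
      then show ?thesis using True by simp
    next
      case False
      then have "\<exists>b\<in>\<phi> ` G - {c}. inverse (c - b) * (\<phi> A + - b) = 0"
        using A by (intro bexI[of _ "\<phi> A"]) auto
      then show ?thesis using False assms(2) by (simp only: prod_zero[OF finite_Diff] if_False)
    qed
  qed
qed

end

section \<open>From modules and their invariants to lower bounds for \<open>sigma\<close>\<close>

lemma mult_mat_vec_index_sum:
  assumes "A \<in> carrier_mat r s" "v \<in> carrier_vec s" "i < r"
  shows "(A *\<^sub>v v) $ i = (\<Sum>j<s. A $$ (i, j) * v $ j)"
  using assms by (simp add: scalar_prod_def lessThan_atLeast0)

text \<open>The supremum bounds the value of each module. An infimum over the empty set would be
  infinite, so the set of degrees is nonempty, and as \<open>enat\<close> is well-ordered, the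
  infimum is attained at some \<open>d'\<close>.\<close>

lemma sigma_set_if_sigma_le:
  assumes "sigma n G \<le> enat d" "G_module n G m \<rho>"
  shows "\<exists>d'\<le>d. sigma_set n G m \<rho> (invariants_le n G m \<rho> d')"
proof -
  have "sigma_module n G m \<rho> \<le> sigma n G"
    unfolding sigma_def by (rule SUP_upper2[of "(m, \<rho>)"]) (use assms(2) in auto)
  then have le: "sigma_module n G m \<rho> \<le> enat d" using assms(1) by order
  let ?D = "{d. sigma_set n G m \<rho> (invariants_le n G m \<rho> d)}"
  have "?D \<noteq> {}"
  proof
    assume "?D = {}"
    then have "sigma_module n G m \<rho> = \<infinity>" unfolding sigma_module_def by (simp add: top_enat_def)
    with le show False by simp
  qed
  then obtain x where "x \<in> ?D" by blast
  then have "sigma_module n G m \<rho> \<in> enat ` ?D"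
    unfolding sigma_module_def by (intro wellorder_InfI[of "enat x"]) blast
  then show ?thesis using le by auto
qed

lemma poly_fun_0:
  assumes "f \<in> coord_ring m"
  shows "poly_fun f (0\<^sub>v m) = mpoly_const_term f"
proof -
  obtain d where "mpoly_degree_le f d" using mpoly_has_degree by blast
  from polynomial_fun_cong_on[OF polynomial_fun_vec[OF assms this], of "($) (0\<^sub>v m)" "\<lambda>_. 0"]
  show ?thesis by (simp add: poly_fun_def mpoly_eval_0)
qed

context linear_group
begin

text \<open>A module may be given on any finite index set in place of an initial segment of the naturals.\<close>

definition rep_on :: "'i set \<Rightarrow> ('k mat \<Rightarrow> 'i \<Rightarrow> 'i \<Rightarrow> 'k) \<Rightarrow> bool" where
  "rep_on I R \<longleftrightarrow> finite I \<and>
     (\<forall>i\<in>I. \<forall>j\<in>I. regular (\<lambda>g. R g i j) \<and> R (1\<^sub>m n) i j = (if i = j then 1 else 0) \<and>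
       (\<forall>g\<in>G. \<forall>h\<in>G. R (g * h) i j = (\<Sum>k\<in>I. R g i k * R h k j)))"

text \<open>Acting by \<open>g\<close> instead of its inverse gives the same notion, since the
  condition ranges over all of the group \<open>G\<close>.\<close>

definition invariant_on :: "'i set \<Rightarrow> ('k mat \<Rightarrow> 'i \<Rightarrow> 'i \<Rightarrow> 'k) \<Rightarrow> (('i \<Rightarrow> 'k) \<Rightarrow> 'k) \<Rightarrow> bool" where
  "invariant_on I R F \<longleftrightarrow> (\<forall>g\<in>G. \<forall>v. F (\<lambda>i. \<Sum>j\<in>I. R g i j * v j) = F v)"

text \<open>This criterion yields all the lower bounds. The invariant \<open>f\<close> puts
  \<open>v\<close> outside the nullcone; if \<open>sigma n G\<close> were at most \<open>d\<close>,
  an invariant of degree at most \<open>d\<close> without constant term would also be nonzero at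
  \<open>v\<close>, against \<open>vanish\<close>.\<close>

lemma less_sigma:
  fixes R :: "'k mat \<Rightarrow> 'i \<Rightarrow> 'i \<Rightarrow> 'k"
  assumes R: "rep_on I R"
    and f: "polynomial_fun I e f" "invariant_on I R f" "f (\<lambda>_. 0) = 0" "f v \<noteq> 0"
    and vanish: "\<And>F. polynomial_fun I d F \<Longrightarrow> invariant_on I R F \<Longrightarrow> F (\<lambda>_. 0) = 0 \<Longrightarrow> F v = 0"
  shows "enat d < sigma n G"
proof (rule ccontr)
  assume "\<not> ?thesis"
  then have sigma_le: "sigma n G \<le> enat d" by simp
  have I: "finite I" using R by (simp add: rep_on_def)
  define m where "m = card I"
  obtain b where b: "bij_betw b {..<m} I"
    using ex_bij_betw_nat_finite[OF I] by (auto simp: m_def lessThan_atLeast0)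
  define b' where "b' = inv_into {..<m} b"
  have b'b: "b' (b x) = x" if "x < m" for x
    using b that by (simp add: b'_def bij_betw_inv_into_left)
  have bb': "b (b' i) = i" and b'_less: "b' i < m" if "i \<in> I" for i
    using b bij_betw_inv_into[OF b] that
    by (auto simp: b'_def bij_betw_inv_into_right dest: bij_betwE)
  have bI: "b x \<in> I" if "x < m" for x using b that by (auto dest: bij_betwE)
  have sum_b: "(\<Sum>x<m. h (b x)) = (\<Sum>i\<in>I. h i)" for h :: "'i \<Rightarrow> 'k"
    by (rule sum.reindex_bij_betw[OF b])
  define \<rho> where "\<rho> g = mat m m (\<lambda>(x, y). R g (b x) (b y))" for g
  define toF :: "'k vec \<Rightarrow> 'i \<Rightarrow> 'k" where "toF w i = (if i \<in> I then w $ (b' i) else 0)" for w i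
  define toV :: "('i \<Rightarrow> 'k) \<Rightarrow> 'k vec" where "toV w = vec m (\<lambda>x. w (b x))" for w
  have \<rho>_carrier: "\<rho> g \<in> carrier_mat m m" for g by (simp add: \<rho>_def)
  have \<rho>_mult: "\<rho> (g * h) = \<rho> g * \<rho> h" if "g \<in> G" "h \<in> G" for g h
  proof (rule eq_matI)
    fix x y assume "x < dim_row (\<rho> g * \<rho> h)" "y < dim_col (\<rho> g * \<rho> h)"
    then have xy: "x < m" "y < m" by (simp_all add: \<rho>_def)
    have "\<rho> (g * h) $$ (x, y) = (\<Sum>k\<in>I. R g (b x) k * R h k (b y))"
      using R that xy by (simp add: \<rho>_def rep_on_def bI)
    also have "\<dots> = (\<Sum>z<m. R g (b x) (b z) * R h (b z) (b y))"
      by (rule sum_b[symmetric])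
    also have "\<dots> = (\<rho> g * \<rho> h) $$ (x, y)"
      using xy by (simp add: \<rho>_def scalar_prod_def lessThan_atLeast0)
    finally show "\<rho> (g * h) $$ (x, y) = (\<rho> g * \<rho> h) $$ (x, y)" .
  qed (simp_all add: \<rho>_def)
  have \<rho>_one: "\<rho> (1\<^sub>m n) = 1\<^sub>m m"
    using R inj_onD[OF bij_betw_imp_inj_on[OF b]]
    by (intro eq_matI) (auto simp: \<rho>_def rep_on_def bI)
  have det_\<rho>: "det (\<rho> g) \<noteq> 0" if "g \<in> G" for g
  proof -
    have "\<rho> g * \<rho> (ginv g) = 1\<^sub>m m"
      using that by (simp flip: \<rho>_mult add: G_inv G_inv_right \<rho>_one)
    then have "det (\<rho> g) * det (\<rho> (ginv g)) = 1"
      using det_mult[OF \<rho>_carrier \<rho>_carrier, of g "ginv g"] by simp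
    then show ?thesis by auto
  qed
  have module: "G_module n G m \<rho>"
    unfolding G_module_def
  proof (intro conjI allI impI)
    show "\<rho> \<in> hom (GL n\<lparr>carrier := G\<rparr>) (GL m)"
      by (rule homI) (auto simp: carrier_GL mult_GL \<rho>_carrier det_\<rho> \<rho>_mult)
    show "regular (\<lambda>g. \<rho> g $$ (x, y))" if "x < m" "y < m" for x y
      using R that by (simp add: \<rho>_def rep_on_def bI)
  qed
  have act: "toF (\<rho> g *\<^sub>v w) i = (\<Sum>j\<in>I. R g i j * toF w j)"
    if "w \<in> carrier_vec m" "i \<in> I" for g w i
  proof -
    have "toF (\<rho> g *\<^sub>v w) i = (\<Sum>y<m. R g i (b y) * w $ y)"
      using that unfolding toF_def \<rho>_def
      by (subst mult_mat_vec_index_sum[of _ m m]) (auto simp: b'_less bb')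
    also have "\<dots> = (\<Sum>y<m. R g i (b y) * toF w (b y))"
      by (intro sum.cong) (auto simp: toF_def bI b'b)
    also have "\<dots> = (\<Sum>j\<in>I. R g i j * toF w j)" by (rule sum_b)
    finally show ?thesis .
  qed
  have toF_toV: "toF (toV w) i = w i" if "i \<in> I" for w i
    using that by (simp add: toF_def toV_def bb' b'_less)
  have toV_carrier: "toV w \<in> carrier_vec m" for w by (simp add: toV_def)

  \<comment> \<open>In coordinates \<open>f\<close> becomes an invariant polynomial
    \<open>P\<close>, which places \<open>toV v\<close> outside the nullcone.\<close>
  have "polynomial_fun {..<m} e (\<lambda>w. f (\<lambda>i. w (b' i)))"
    by (rule polynomial_fun_comp[OF f(1)]) (rule polynomial_fun_var, simp add: b'_less)
  then obtain P where P: "mpoly_vars P \<subseteq> {..<m}" "\<And>w. f (\<lambda>i. w (b' i)) = mpoly_eval w P"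
    unfolding polynomial_fun_def by metis
  have P_eq: "poly_fun P w = f (toF w)" for w
    unfolding poly_fun_def P(2)[symmetric]
    by (rule polynomial_fun_cong_on[OF f(1)]) (simp add: toF_def)
  have P_coord: "P \<in> coord_ring m" using P(1) by (simp add: coord_ring_def)
  have P_inv: "P \<in> invariants n G m \<rho>"
    unfolding invariants_def
  proof (intro CollectI conjI ballI P_coord)
    fix g and w :: "'k vec" assume g: "g \<in> G" and w: "w \<in> carrier_vec m"
    have "poly_fun P (\<rho> (ginv g) *\<^sub>v w) = f (\<lambda>i. \<Sum>j\<in>I. R (ginv g) i j * toF w j)"
      unfolding P_eq by (rule polynomial_fun_cong_on[OF f(1)]) (rule act[OF w])
    then show "poly_fun P (\<rho> (ginv g) *\<^sub>v w) = poly_fun P w"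
      using f(2) G_inv[OF g] by (simp add: invariant_on_def P_eq)
  qed
  have "f (toF (0\<^sub>v m)) = f (\<lambda>_. 0)"
    by (rule polynomial_fun_cong_on[OF f(1)]) (simp add: toF_def b'_less)
  then have "mpoly_const_term P = 0"
    using poly_fun_0[OF P_coord] f(3) by (simp add: P_eq)
  moreover have "f (toF (toV v)) = f v"
    by (rule polynomial_fun_cong_on[OF f(1)]) (rule toF_toV)
  then have "poly_fun P (toV v) \<noteq> 0" using f(4) by (simp only: P_eq not_False_eq_True)
  ultimately have v: "toV v \<in> carrier_vec m - nullcone n G m \<rho>"
    using P_inv toV_carrier by (auto simp: nullcone_def plus_part_def)

  obtain d' where d': "d' \<le> d" "sigma_set n G m \<rho> (invariants_le n G m \<rho> d')"
    using sigma_set_if_sigma_le[OF sigma_le module] by blast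
  then obtain h where h: "h \<in> plus_part (invariants_le n G m \<rho> d')" "poly_fun h (toV v) \<noteq> 0"
    using v unfolding sigma_set_def by blast
  then have h_coord: "h \<in> coord_ring m" and h_deg: "mpoly_degree_le h d'"
    and h_inv: "\<And>g w. g \<in> G \<Longrightarrow> w \<in> carrier_vec m \<Longrightarrow> poly_fun h (\<rho> (ginv g) *\<^sub>v w) = poly_fun h w"
    and h_const: "mpoly_const_term h = 0"
    by (auto simp: plus_part_def invariants_le_def invariants_def)
  \<comment> \<open>Conversely the separating invariant \<open>h\<close> is read as a function on
    families, to which \<open>vanish\<close> applies.\<close>
  define F where "F w = mpoly_eval (\<lambda>x. w (b x)) h" for w :: "'i \<Rightarrow> 'k"
  note h_poly = polynomial_fun_vec[OF h_coord h_deg]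
  have F_eq: "F w = poly_fun h (toV w)" for w
    unfolding F_def poly_fun_def
    by (rule polynomial_fun_cong_on[OF h_poly]) (simp add: toV_def)
  have "polynomial_fun I d' F"
    unfolding F_def by (rule polynomial_fun_comp[OF h_poly]) (rule polynomial_fun_var, simp add: bI)
  then have "polynomial_fun I d F" using d'(1) by (rule polynomial_fun_mono)
  moreover have "invariant_on I R F"
    unfolding invariant_on_def
  proof (intro ballI allI)
    fix g w assume g: "g \<in> G"
    have "toV (\<lambda>i. \<Sum>j\<in>I. R g i j * w j) = \<rho> g *\<^sub>v toV w"
    proof (rule eq_vecI)
      fix x assume "x < dim_vec (\<rho> g *\<^sub>v toV w)"
      then have x: "x < m" by (simp add: \<rho>_def)
      have "(\<rho> g *\<^sub>v toV w) $ x = (\<Sum>y<m. R g (b x) (b y) * w (b y))"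
        unfolding mult_mat_vec_index_sum[OF \<rho>_carrier toV_carrier x]
        using x by (intro sum.cong) (auto simp: \<rho>_def toV_def)
      also have "\<dots> = (\<Sum>j\<in>I. R g (b x) j * w j)" by (rule sum_b)
      finally show "toV (\<lambda>i. \<Sum>j\<in>I. R g i j * w j) $ x = (\<rho> g *\<^sub>v toV w) $ x"
        using x by (simp add: toV_def)
    qed (simp add: toV_def \<rho>_def)
    then show "F (\<lambda>i. \<Sum>j\<in>I. R g i j * w j) = F w"
      using h_inv[OF G_inv[OF g] toV_carrier, of w] by (simp add: F_eq G_inv_inv g)
  qed
  moreover have "F (\<lambda>_. 0) = 0" by (simp add: F_def mpoly_eval_0 h_const)
  ultimately have "F v = 0" by (rule vanish)
  then show False using h(2) by (simp add: F_eq)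
qed

end

section \<open>Linear algebra\<close>

lemma det_nonzero_obtain_inverse:
  assumes "(P :: 'k::field mat) \<in> carrier_mat r r" "det P \<noteq> 0"
  obtains P' where "P' \<in> carrier_mat r r" "P * P' = 1\<^sub>m r" "P' * P = 1\<^sub>m r"
  using det_non_zero_imp_unit[OF assms, of "()"] by (auto simp: Units_def ring_mat_def)

lemma mult_mat_index_sum:
  assumes "A \<in> carrier_mat r s" "B \<in> carrier_mat s t" "i < r" "j < t"
  shows "(A * B) $$ (i, j) = (\<Sum>k<s. A $$ (i, k) * B $$ (k, j))"
  using assms by (simp add: scalar_prod_def lessThan_atLeast0)

text \<open>Take an invertible matrix with as many columns in \<open>W\<close> as possible. The
  columns indexed by \<open>J\<close> then form a basis of \<open>W\<close>, which the equivalence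
  expresses in coordinates.\<close>

lemma adapted_basis:
  fixes W :: "'k::field vec set"
  assumes W: "W \<subseteq> carrier_vec r" "0\<^sub>v r \<in> W"
    and add: "\<And>u w. u \<in> W \<Longrightarrow> w \<in> W \<Longrightarrow> u + w \<in> W"
    and smult: "\<And>c w. w \<in> W \<Longrightarrow> c \<cdot>\<^sub>v w \<in> W"
  shows "\<exists>P P' J. P \<in> carrier_mat r r \<and> P' \<in> carrier_mat r r \<and> P * P' = 1\<^sub>m r \<and> P' * P = 1\<^sub>m r \<and>
    J \<subseteq> {..<r} \<and> (\<forall>c\<in>carrier_vec r. P *\<^sub>v c \<in> W \<longleftrightarrow> (\<forall>j<r. j \<notin> J \<longrightarrow> c $ j = 0))"
proof -
  define good where "good J \<longleftrightarrow> J \<subseteq> {..<r} \<and> (\<exists>P\<in>carrier_mat r r. det P \<noteq> 0 \<and> (\<forall>j\<in>J. col P j \<in> W))" for J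
  have "good {}" unfolding good_def by (auto intro!: bexI[of _ "1\<^sub>m r"])
  moreover have "card J < Suc r" if "good J" for J
    using card_mono[of "{..<r}" J] that by (auto simp: good_def)
  ultimately obtain J where J: "good J" and max: "\<And>J'. good J' \<Longrightarrow> card J' \<le> card J"
    using ex_has_greatest_nat[of good "{}" card "Suc r"] by auto
  obtain P where P: "P \<in> carrier_mat r r" "det P \<noteq> 0" and colP: "\<And>j. j \<in> J \<Longrightarrow> col P j \<in> W"
    and Jr: "J \<subseteq> {..<r}"
    using J unfolding good_def by blast
  obtain P' where P': "P' \<in> carrier_mat r r" "P * P' = 1\<^sub>m r" "P' * P = 1\<^sub>m r"
    using det_nonzero_obtain_inverse[OF P] .
  have "P *\<^sub>v c \<in> W \<longleftrightarrow> (\<forall>j<r. j \<notin> J \<longrightarrow> c $ j = 0)" if c: "c \<in> carrier_vec r" for c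
  proof
    assume w: "P *\<^sub>v c \<in> W"
    show "\<forall>j<r. j \<notin> J \<longrightarrow> c $ j = 0"
    proof (intro allI impI, rule ccontr)
      fix j assume j: "j < r" "j \<notin> J" "c $ j \<noteq> 0"
      \<comment> \<open>By Cramer's rule the determinant with column \<open>j\<close> replaced by
        \<open>P *\<^sub>v c\<close> is \<open>c $ j * det P\<close>, hence nonzero, and one more
        column would lie in \<open>W\<close>.\<close>
      define P1 where "P1 = replace_col P (P *\<^sub>v c) j"
      have "det P1 \<noteq> 0"
        using cramer_lemma_mat[OF P(1) c j(1)] j(3) P(2) by (simp add: P1_def)
      moreover have P1: "P1 \<in> carrier_mat r r" using P(1) by (simp add: P1_def replace_col_def)
      moreover have "col P1 i \<in> W" if "i \<in> insert j J" for i
      proof (cases "i = j")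
        case True
        have "col P1 j = P *\<^sub>v c"
          using j P(1) by (intro eq_vecI) (auto simp: P1_def replace_col_def)
        then show ?thesis using w True by simp
      next
        case False
        then have "i \<in> J" using that by simp
        then have "col P1 i = col P i"
          using Jr False P(1) by (intro eq_vecI) (auto simp: P1_def replace_col_def subset_iff)
        then show ?thesis using colP[OF \<open>i \<in> J\<close>] by simp
      qed
      ultimately have "good (insert j J)"
        unfolding good_def using j Jr by blast
      from max[OF this] show False using j finite_subset[OF Jr] by simp
    qed
  next
    assume c0: "\<forall>j<r. j \<notin> J \<longrightarrow> c $ j = 0"
    have *: "vec r (\<lambda>i. \<Sum>j\<in>J'. P $$ (i, j) * c $ j) \<in> W" if "finite J'" "J' \<subseteq> J" for J'
      using that
    proof (induction J' rule: finite_induct)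
      case empty
      then show ?case using W(2) by (simp add: zero_vec_def)
    next
      case (insert j J')
      then have "j < r" using Jr by auto
      have "vec r (\<lambda>i. \<Sum>j\<in>insert j J'. P $$ (i, j) * c $ j)
          = c $ j \<cdot>\<^sub>v col P j + vec r (\<lambda>i. \<Sum>j\<in>J'. P $$ (i, j) * c $ j)"
        using insert(1,2) P(1) \<open>j < r\<close> by (intro eq_vecI) auto
      moreover have "\<dots> \<in> W"
        using insert colP by (intro add smult) auto
      ultimately show ?case by simp
    qed
    have "P *\<^sub>v c = vec r (\<lambda>i. \<Sum>j\<in>J. P $$ (i, j) * c $ j)"
    proof (rule eq_vecI)
      fix i assume "i < dim_vec (vec r (\<lambda>i. \<Sum>j\<in>J. P $$ (i, j) * c $ j))"
      then have i: "i < r" by simp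
      have "(P *\<^sub>v c) $ i = (\<Sum>j<r. P $$ (i, j) * c $ j)"
        by (rule mult_mat_vec_index_sum[OF P(1) c i])
      also have "\<dots> = (\<Sum>j\<in>J. P $$ (i, j) * c $ j)"
        using Jr c0 by (intro sum.mono_neutral_right) auto
      finally show "(P *\<^sub>v c) $ i = vec r (\<lambda>i. \<Sum>j\<in>J. P $$ (i, j) * c $ j) $ i" using i by simp
    qed (use P in auto)
    then show "P *\<^sub>v c \<in> W" using *[OF finite_subset[OF Jr] order_refl] by simp
  qed
  with P(1) P' Jr show ?thesis by blast
qed

text \<open>In an adapted basis some index \<open>j\<close> lies outside \<open>J\<close>, as
  \<open>W\<close> is proper. Row \<open>j\<close> of the inverse matrix reads off the coordinate at
  \<open>j\<close>, which is 0 throughout \<open>W\<close>.\<close>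

lemma proper_subspace_annihilator:
  fixes W :: "'k::field vec set"
  assumes W: "W \<subseteq> carrier_vec r" "0\<^sub>v r \<in> W"
    and add: "\<And>u w. u \<in> W \<Longrightarrow> w \<in> W \<Longrightarrow> u + w \<in> W"
    and smult: "\<And>c w. w \<in> W \<Longrightarrow> c \<cdot>\<^sub>v w \<in> W"
    and proper: "W \<noteq> carrier_vec r"
  obtains \<phi> where "\<phi> \<in> carrier_vec r" "\<phi> \<noteq> 0\<^sub>v r" "\<And>w. w \<in> W \<Longrightarrow> \<phi> \<bullet> w = 0"
proof -
  have "\<exists>P P' J. P \<in> carrier_mat r r \<and> P' \<in> carrier_mat r r \<and> P * P' = 1\<^sub>m r \<and> P' * P = 1\<^sub>m r \<and>
    J \<subseteq> {..<r} \<and> (\<forall>c\<in>carrier_vec r. P *\<^sub>v c \<in> W \<longleftrightarrow> (\<forall>j<r. j \<notin> J \<longrightarrow> c $ j = 0))"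
    by (rule adapted_basis) (fact W add smult)+
  then obtain P P' J where P: "P \<in> carrier_mat r r" "P' \<in> carrier_mat r r" "P * P' = 1\<^sub>m r" "P' * P = 1\<^sub>m r"
    "J \<subseteq> {..<r}" and iff: "\<forall>c\<in>carrier_vec r. P *\<^sub>v c \<in> W \<longleftrightarrow> (\<forall>j<r. j \<notin> J \<longrightarrow> c $ j = 0)"
    by (elim exE conjE)
  note iff = iff[rule_format]
  have coords: "P *\<^sub>v (P' *\<^sub>v w) = w" "P' *\<^sub>v w \<in> carrier_vec r" if "w \<in> carrier_vec r" for w
    using that P(2,3) assoc_mult_mat_vec[OF P(1,2) that] by simp_all
  have "\<exists>j<r. j \<notin> J"
  proof (rule ccontr)
    assume *: "\<not> (\<exists>j<r. j \<notin> J)"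
    have "w \<in> W" if "w \<in> carrier_vec r" for w
      using iff[OF coords(2)[OF that]] * by (simp add: coords(1)[OF that])
    then show False using W(1) proper by blast
  qed
  then obtain j where j: "j < r" "j \<notin> J" by blast
  show ?thesis
  proof (rule that[of "row P' j"])
    show "row P' j \<in> carrier_vec r" using P(2) by auto
    show "row P' j \<bullet> w = 0" if "w \<in> W" for w
    proof -
      have w: "w \<in> carrier_vec r" using that W(1) by auto
      have "(P' *\<^sub>v w) $ j = 0" using iff[OF coords(2)[OF w]] that j by (simp add: coords(1)[OF w])
      then show ?thesis using j P(2) by simp
    qed
    show "row P' j \<noteq> 0\<^sub>v r"
    proof
      assume "row P' j = 0\<^sub>v r"
      then have "(P' * P) $$ (j, j) = 0" using P(1,2) j by (simp add: scalar_prod_def)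
      then show False using P(4) j by simp
    qed
  qed
qed

section \<open>Traces and linear spans of matrices\<close>

definition mat_trace :: "'k::comm_semiring_0 mat \<Rightarrow> 'k" where
  "mat_trace A = (\<Sum>i<dim_row A. A $$ (i, i))"

lemma mat_trace_mult:
  assumes "A \<in> carrier_mat r s" "B \<in> carrier_mat s r"
  shows "mat_trace (A * B) = (\<Sum>i<r. \<Sum>j<s. A $$ (i, j) * B $$ (j, i))"
  using assms by (simp add: mat_trace_def scalar_prod_def lessThan_atLeast0)

lemma mat_trace_comm:
  assumes "A \<in> carrier_mat r s" "B \<in> carrier_mat s r"
  shows "mat_trace (A * B) = mat_trace (B * A)"
  unfolding mat_trace_mult[OF assms] mat_trace_mult[OF assms(2,1)]
  by (subst sum.swap) (simp add: mult.commute)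

inductive_set mat_span :: "nat \<Rightarrow> 'k::field mat set \<Rightarrow> 'k mat set" for r S where
  zero: "0\<^sub>m r r \<in> mat_span r S"
| step: "A \<in> S \<Longrightarrow> B \<in> mat_span r S \<Longrightarrow> c \<cdot>\<^sub>m A + B \<in> mat_span r S"

context
  fixes r :: nat and S :: "'k::field mat set"
  assumes S: "S \<subseteq> carrier_mat r r"
begin

lemma mat_span_carrier: "A \<in> mat_span r S \<Longrightarrow> A \<in> carrier_mat r r"
  by (induction rule: mat_span.induct) (use S in auto)

lemma mat_span_base: assumes "A \<in> S" shows "A \<in> mat_span r S"
proof -
  have "1 \<cdot>\<^sub>m A + 0\<^sub>m r r = A" using assms S by (intro eq_matI) auto
  then show ?thesis using mat_span.step[OF assms mat_span.zero, where c = 1] by metis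
qed

lemma mat_span_add: "A \<in> mat_span r S \<Longrightarrow> B \<in> mat_span r S \<Longrightarrow> A + B \<in> mat_span r S"
proof (induction rule: mat_span.induct)
  case zero
  then show ?case using mat_span_carrier by simp
next
  case (step A C c)
  have "c \<cdot>\<^sub>m A + C + B = c \<cdot>\<^sub>m A + (C + B)"
    using S step mat_span_carrier by (intro assoc_add_mat) auto
  then show ?case using mat_span.step[OF step(1), where B = "C + B" and c = c] step by simp
qed

lemma mat_span_smult: "A \<in> mat_span r S \<Longrightarrow> c \<cdot>\<^sub>m A \<in> mat_span r S"
proof (induction rule: mat_span.induct)
  case zero
  have "c \<cdot>\<^sub>m 0\<^sub>m r r = 0\<^sub>m r r" by (intro eq_matI) auto
  then show ?case using mat_span.zero[of r S] by simp
next
  case (step A C d)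
  have "A \<in> carrier_mat r r" "C \<in> carrier_mat r r" using S step mat_span_carrier by auto
  then have "c \<cdot>\<^sub>m (d \<cdot>\<^sub>m A + C) = (c * d) \<cdot>\<^sub>m A + c \<cdot>\<^sub>m C"
    by (intro eq_matI) (auto simp: algebra_simps)
  then show ?case using mat_span.step[OF step(1,3), where c = "c * d"] by simp
qed

lemma mat_span_mult:
  assumes mult: "\<And>A B. A \<in> S \<Longrightarrow> B \<in> S \<Longrightarrow> A * B \<in> S"
    and "A \<in> mat_span r S" "B \<in> mat_span r S"
  shows "A * B \<in> mat_span r S"
proof -
  have base: "A * B \<in> mat_span r S" if "A \<in> S" "B \<in> mat_span r S" for A B
    using that(2)
  proof (induction rule: mat_span.induct)
    case zero
    then show ?case using that(1) S mat_span.zero[of r S] by auto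
  next
    case (step C D d)
    have ACD: "A \<in> carrier_mat r r" "C \<in> carrier_mat r r" "D \<in> carrier_mat r r"
      using S step that mat_span_carrier by auto
    then have "A * (d \<cdot>\<^sub>m C + D) = d \<cdot>\<^sub>m (A * C) + A * D"
      by (simp add: mult_add_distrib_mat[where n = r and nc = r] mult_smult_distrib[where n = r and nc = r])
    then show ?case using mat_span.step[OF mult[OF that(1) step(1)] step(3), where c = d] by simp
  qed
  show ?thesis
    using assms(2)
  proof (induction rule: mat_span.induct)
    case zero
    then show ?case using mat_span_carrier[OF assms(3)] mat_span.zero[of r S] by auto
  next
    case (step C D d)
    have BCD: "B \<in> carrier_mat r r" "C \<in> carrier_mat r r" "D \<in> carrier_mat r r"
      using S step assms(3) mat_span_carrier by auto
    then have "(d \<cdot>\<^sub>m C + D) * B = d \<cdot>\<^sub>m (C * B) + D * B"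
      by (simp add: add_mult_distrib_mat[where nr = r and n = r and nc = r] mult_smult_assoc_mat[where nr = r and n = r and nc = r])
    then show ?case using mat_span_add[OF mat_span_smult[OF base[OF step(1) assms(3)], where c = d] step(3)] by simp
  qed
qed

text \<open>The trace of \<open>X * B\<close> is linear in \<open>B\<close>; \<open>T\<close>
  collects the elements of \<open>S\<close> that occur in a linear combination equal to
  \<open>B\<close>.\<close>

lemma mat_span_trace_determined:
  assumes "B \<in> mat_span r S"
  shows "\<exists>T. finite T \<and> T \<subseteq> S \<and> (\<forall>X\<in>carrier_mat r r. \<forall>Y\<in>carrier_mat r r.
    (\<forall>A\<in>T. mat_trace (X * A) = mat_trace (Y * A)) \<longrightarrow> mat_trace (X * B) = mat_trace (Y * B))"
  using assms
proof (induction rule: mat_span.induct)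
  case zero
  show ?case by (intro exI[of _ "{}"]) (auto simp: mat_trace_def)
next
  case (step A B c)
  from step.IH obtain T where T: "finite T" "T \<subseteq> S" and T_det: "\<forall>X\<in>carrier_mat r r. \<forall>Y\<in>carrier_mat r r.
    (\<forall>A\<in>T. mat_trace (X * A) = mat_trace (Y * A)) \<longrightarrow> mat_trace (X * B) = mat_trace (Y * B)"
    by (elim exE conjE)
  have AB: "A \<in> carrier_mat r r" "B \<in> carrier_mat r r" using S step mat_span_carrier by auto
  have *: "mat_trace (X * (c \<cdot>\<^sub>m A + B)) = c * mat_trace (X * A) + mat_trace (X * B)"
    if "X \<in> carrier_mat r r" for X
    using that AB
    by (simp add: mat_trace_mult[where r = r and s = r] algebra_simps sum.distrib sum_distrib_left)
  show ?case
  proof (intro exI[of _ "insert A T"] conjI ballI impI)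
    fix X Y :: "'k mat" assume XY: "X \<in> carrier_mat r r" "Y \<in> carrier_mat r r"
      and eq: "\<forall>C\<in>insert A T. mat_trace (X * C) = mat_trace (Y * C)"
    have "mat_trace (X * B) = mat_trace (Y * B)" using T_det[rule_format, OF XY] eq by blast
    then show "mat_trace (X * (c \<cdot>\<^sub>m A + B)) = mat_trace (Y * (c \<cdot>\<^sub>m A + B))"
      using eq by (simp add: *[OF XY(1)] *[OF XY(2)])
  qed (use T step(1) in auto)
qed

end

section \<open>Burnside's theorem and finiteness from traces\<close>

lemma singular_mat_factor:
  fixes Z :: "'k::field mat"
  assumes Z: "Z \<in> carrier_mat (Suc m) (Suc m)" "det Z = 0"
  obtains U V where "U \<in> carrier_mat (Suc m) m" "V \<in> carrier_mat m (Suc m)" "Z = U * V"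
proof -
  let ?n = "Suc m"
  obtain w where w: "w \<in> carrier_vec ?n" "w \<noteq> 0\<^sub>v ?n" "Z *\<^sub>v w = 0\<^sub>v ?n"
    using det_0_iff_vec_prod_zero_field[OF Z(1)] Z(2) by auto
  obtain j where j: "j < ?n" "w $ j \<noteq> 0"
    using w(1,2) by (metis eq_vecI carrier_vecD index_zero_vec)
  \<comment> \<open>A kernel vector \<open>w\<close> with \<open>w $ j\<close> nonzero expresses
    column \<open>j\<close> of \<open>Z\<close> by the remaining ones. \<open>f\<close> enumerates
    the remaining indices, \<open>U\<close> holds these columns, and \<open>V\<close> the
    coefficients.\<close>
  define f where "f l = (if l < j then l else Suc l)" for l
  define U where "U = mat ?n m (\<lambda>(a, l). Z $$ (a, f l))"
  define V where "V = mat m ?n (\<lambda>(l, b). if b = j then - w $ f l / w $ j else if f l = b then 1 else 0)"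
  have f_inj: "inj_on f {..<m}" by (auto simp: inj_on_def f_def split: if_splits)
  have f_image: "f ` {..<m} = {..<?n} - {j}"
  proof (rule card_subset_eq)
    show "f ` {..<m} \<subseteq> {..<?n} - {j}" by (auto simp: f_def)
    show "card (f ` {..<m}) = card ({..<?n} - {j})" using j by (simp add: card_image f_inj)
  qed auto
  have sum_f: "(\<Sum>l<m. h (f l)) = (\<Sum>b\<in>{..<?n} - {j}. h b)" for h :: "nat \<Rightarrow> 'k"
    by (simp add: sum.reindex[OF f_inj] flip: f_image)
  have "Z = U * V"
  proof (rule eq_matI)
    fix a b assume "a < dim_row (U * V)" "b < dim_col (U * V)"
    then have ab: "a < ?n" "b < ?n" by (simp_all add: U_def V_def)
    have "(U * V) $$ (a, b) = (\<Sum>l<m. Z $$ (a, f l) * V $$ (l, b))"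
      using ab by (subst mult_mat_index_sum[of _ ?n m _ ?n]) (auto simp: U_def V_def)
    also have "\<dots> = (\<Sum>l<m. Z $$ (a, f l) * (if b = j then - w $ f l / w $ j else if f l = b then 1 else 0))"
      using ab by (intro sum.cong) (auto simp: V_def)
    also have "\<dots> = (\<Sum>l\<in>{..<?n} - {j}. Z $$ (a, l) * (if b = j then - w $ l / w $ j else if l = b then 1 else 0))"
      by (rule sum_f)
    also have "\<dots> = Z $$ (a, b)"
    proof (cases "b = j")
      case True
      have "0 = (\<Sum>l<?n. Z $$ (a, l) * w $ l)"
        using mult_mat_vec_index_sum[OF Z(1) w(1) ab(1)] w(3) ab(1) by simp
      also have "\<dots> = Z $$ (a, j) * w $ j + (\<Sum>l\<in>{..<?n} - {j}. Z $$ (a, l) * w $ l)"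
        using j by (subst sum.remove[of _ j]) auto
      finally have "(\<Sum>l\<in>{..<?n} - {j}. Z $$ (a, l) * w $ l) = - Z $$ (a, j) * w $ j"
        by (simp add: eq_neg_iff_add_eq_0 add.commute)
      then have "(\<Sum>l\<in>{..<?n} - {j}. Z $$ (a, l) * w $ l) * (- 1 / w $ j) = Z $$ (a, j)"
        using j by simp
      moreover have "(\<Sum>l\<in>{..<?n} - {j}. Z $$ (a, l) * w $ l) * (- 1 / w $ j)
          = (\<Sum>l\<in>{..<?n} - {j}. Z $$ (a, l) * (- w $ l / w $ j))"
        unfolding sum_distrib_right by (intro sum.cong) auto
      ultimately show ?thesis using True by simp
    next
      case False
      then show ?thesis using ab by (simp add: if_distrib[of "(*) _"] sum.delta cong: if_cong)
    qed
    finally show "Z $$ (a, b) = (U * V) $$ (a, b)" by simp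
  qed (use Z in \<open>auto simp: U_def V_def\<close>)
  moreover have "U \<in> carrier_mat ?n m" "V \<in> carrier_mat m ?n" by (simp_all add: U_def V_def)
  ultimately show ?thesis using that by blast
qed

text \<open>A nonzero element \<open>T\<close> of minimal rank satisfies \<open>T A T \<in> k T\<close> for all \<open>A\<close>, since \<open>T A\<close> has an
  eigenvalue on the image of \<open>T\<close>; hence \<open>T\<close> has rank one.\<close>

theorem burnside_mat_span:
  fixes S :: "'k::alg_closed_field mat set"
  assumes S: "S \<subseteq> carrier_mat r r" and mult: "\<And>A B. A \<in> S \<Longrightarrow> B \<in> S \<Longrightarrow> A * B \<in> S"
    and one: "1\<^sub>m r \<in> S"
    and transitive: "\<And>x y. x \<in> carrier_vec r \<Longrightarrow> x \<noteq> 0\<^sub>v r \<Longrightarrow> y \<in> carrier_vec r \<Longrightarrow>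
      \<exists>A\<in>mat_span r S. A *\<^sub>v x = y"
    and ij: "i < r" "j < r"
  shows "mat r r (\<lambda>(a, b). if a = i \<and> b = j then 1 else 0) \<in> mat_span r S"
proof -
  note span_carrier = mat_span_carrier[OF S]
  \<comment> \<open>Rank at most \<open>\<rho>\<close> is expressed as a factorization through
    dimension \<open>\<rho>\<close>, so that \<open>T\<close> below has minimal rank among the
    nonzero elements of the span.\<close>
  define factors where "factors \<rho> T \<longleftrightarrow> (\<exists>U\<in>carrier_mat r \<rho>. \<exists>V\<in>carrier_mat \<rho> r. T = U * V)"
    for \<rho> and T :: "'k mat"
  define good where "good \<rho> \<longleftrightarrow> (\<exists>T\<in>mat_span r S. T \<noteq> 0\<^sub>m r r \<and> factors \<rho> T)" for \<rho>
  have "1\<^sub>m r \<noteq> (0\<^sub>m r r :: 'k mat)"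
  proof
    assume "1\<^sub>m r = (0\<^sub>m r r :: 'k mat)"
    then have "(1\<^sub>m r :: 'k mat) $$ (i, i) = 0\<^sub>m r r $$ (i, i)" by simp
    then show False using ij by simp
  qed
  moreover have "factors r (1\<^sub>m r)"
    unfolding factors_def by (intro bexI[of _ "1\<^sub>m r"]) auto
  ultimately have "good r"
    unfolding good_def using mat_span_base[OF S one] by blast
  define \<rho> where "\<rho> = (LEAST \<rho>. good \<rho>)"
  have "good \<rho>" unfolding \<rho>_def using \<open>good r\<close> by (rule LeastI)
  then obtain T U V where T: "T \<in> mat_span r S" "T \<noteq> 0\<^sub>m r r" and UV: "U \<in> carrier_mat r \<rho>" "V \<in> carrier_mat \<rho> r" "T = U * V"
    unfolding good_def factors_def by blast
  have "\<rho> \<noteq> 0"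
  proof
    assume "\<rho> = 0"
    then have "T = 0\<^sub>m r r" using UV by (intro eq_matI) (auto simp: scalar_prod_def)
    with T(2) show False by simp
  qed
  then obtain m where m: "\<rho> = Suc m" using not0_implies_Suc by blast
  have T_carrier: "T \<in> carrier_mat r r" by (rule span_carrier[OF T(1)])
  have TAT: "\<exists>l. T * A * T = l \<cdot>\<^sub>m T" if A: "A \<in> mat_span r S" for A
  proof -
    note A_carrier = span_carrier[OF A]
    \<comment> \<open>\<open>Z\<close> describes \<open>T * A\<close> on the image of
      \<open>U\<close>, because \<open>T * A * U = U * Z\<close>. For an eigenvalue \<open>l\<close>
      of \<open>Z\<close> the singular matrix \<open>Z - l\<close> factors through dimension
      \<open>m\<close>, and with it \<open>D = U * (Z - l) * V\<close>; minimality forces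
      \<open>D = 0\<close>.\<close>
    define Z where "Z = V * A * U"
    have Z: "Z \<in> carrier_mat \<rho> \<rho>" using UV A_carrier by (simp add: Z_def)
    have "degree (char_poly Z) > 0" using degree_monic_char_poly[OF Z] m by simp
    then obtain l where "poly (char_poly Z) l = 0" using alg_closed_imp_poly_has_root by blast
    then have "eigenvalue Z l" using eigenvalue_root_char_poly[OF Z] by simp
    then have "det (char_matrix Z l) = 0" using eigenvalue_det[OF Z] by simp
    moreover have "char_matrix Z l \<in> carrier_mat (Suc m) (Suc m)" using Z m by simp
    ultimately obtain U1 V1 where 1: "U1 \<in> carrier_mat (Suc m) m" "V1 \<in> carrier_mat m (Suc m)"
      "char_matrix Z l = U1 * V1"
      using singular_mat_factor by metis
    define D where "D = T * A * T + (- l) \<cdot>\<^sub>m T"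
    have D: "D \<in> mat_span r S"
      unfolding D_def by (intro mat_span_add[OF S] mat_span_smult[OF S] mat_span_mult[OF S mult] A T)
    have "D = U * (Z + (- l) \<cdot>\<^sub>m 1\<^sub>m \<rho>) * V"
    proof -
      have "U * (Z + (- l) \<cdot>\<^sub>m 1\<^sub>m \<rho>) = U * Z + (- l) \<cdot>\<^sub>m U"
        using UV Z by (simp add: mult_add_distrib_mat[OF UV(1) Z] mult_smult_distrib[OF UV(1) one_carrier_mat])
      also have "\<dots> * V = U * Z * V + (- l) \<cdot>\<^sub>m T"
        using UV Z by (simp add: add_mult_distrib_mat[OF mult_carrier_mat[OF UV(1) Z] _ UV(2)] mult_smult_assoc_mat[OF UV(1,2)])
      also have "U * Z * V = T * A * T"
      proof -
        have "U * Z = U * V * A * U"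
          unfolding Z_def using assoc_mult_mat[OF UV(1) mult_carrier_mat[OF UV(2) A_carrier] UV(1)]
            assoc_mult_mat[OF UV(1,2) A_carrier] by (simp only:)
        then show ?thesis
          using assoc_mult_mat[OF mult_carrier_mat[OF mult_carrier_mat[OF UV(1,2)] A_carrier] UV(1,2)]
          by (simp only: UV(3))
      qed
      finally show ?thesis by (simp add: D_def)
    qed
    also have "Z + (- l) \<cdot>\<^sub>m 1\<^sub>m \<rho> = U1 * V1"
      using 1(3) Z by (simp add: char_matrix_def)
    also have "U * (U1 * V1) * V = (U * U1) * (V1 * V)"
      using assoc_mult_mat[OF UV(1)[unfolded m] 1(1,2)]
        assoc_mult_mat[OF mult_carrier_mat[OF UV(1)[unfolded m] 1(1)] 1(2) UV(2)[unfolded m]] by (simp only:)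
    finally have "factors m D"
      unfolding factors_def using UV 1 m by (intro bexI[of _ "U * U1"] bexI[of _ "V1 * V"]) auto
    moreover have "\<not> good m" using not_less_Least[of m good] m by (simp add: \<rho>_def)
    ultimately have "D = 0\<^sub>m r r" using D unfolding good_def by blast
    then have "T * A * T = l \<cdot>\<^sub>m T"
    proof -
      assume D0: "D = 0\<^sub>m r r"
      show ?thesis
      proof (rule eq_matI)
        fix a b assume ab: "a < dim_row (l \<cdot>\<^sub>m T)" "b < dim_col (l \<cdot>\<^sub>m T)"
        then have "D $$ (a, b) = 0" using D0 T_carrier by simp
        then show "(T * A * T) $$ (a, b) = (l \<cdot>\<^sub>m T) $$ (a, b)"
          using ab T_carrier A_carrier by (simp add: D_def)
      qed (use T_carrier in auto)
    qed
    then show ?thesis by blast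
  qed
  obtain a0 b0 where ab0: "a0 < r" "b0 < r" "T $$ (a0, b0) \<noteq> 0"
    using T(2) T_carrier by (metis eq_matI carrier_matD index_zero_mat)
  define x where "x = (unit_vec r b0 :: 'k vec)"
  define y where "y = T *\<^sub>v x"
  have x: "x \<in> carrier_vec r" by (simp add: x_def)
  have y: "y \<in> carrier_vec r" unfolding y_def by (rule mult_mat_vec_carrier[OF T_carrier x])
  have "y $ a0 = T $$ (a0, b0)"
    using ab0 T_carrier by (simp add: y_def x_def)
  then have y0: "y \<noteq> 0\<^sub>v r" using ab0 by auto
  \<comment> \<open>Some \<open>A\<close> in the span moves \<open>y\<close> to \<open>z\<close>,
    and then \<open>T *\<^sub>v z = (T * A * T) *\<^sub>v x\<close> is a multiple of
    \<open>T *\<^sub>v x = y\<close>. Hence the image of \<open>T\<close> is the line through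
    \<open>y\<close>.\<close>
  have Tz: "\<exists>l. T *\<^sub>v z = l \<cdot>\<^sub>v y" if z: "z \<in> carrier_vec r" for z
  proof -
    obtain A where A: "A \<in> mat_span r S" "A *\<^sub>v y = z" using transitive[OF y y0 z] by blast
    obtain l where l: "T * A * T = l \<cdot>\<^sub>m T" using TAT[OF A(1)] by blast
    have "T *\<^sub>v z = (T * A * T) *\<^sub>v x"
      using assoc_mult_mat_vec[OF T_carrier span_carrier[OF A(1)] y]
        assoc_mult_mat_vec[OF mult_carrier_mat[OF T_carrier span_carrier[OF A(1)]] T_carrier x]
      by (simp only: A(2) flip: y_def)
    also have "\<dots> = l \<cdot>\<^sub>v y" unfolding l
    proof (rule eq_vecI)
      fix a assume "a < dim_vec (l \<cdot>\<^sub>v y)"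
      then have a: "a < r" using y by simp
      have "((l \<cdot>\<^sub>m T) *\<^sub>v x) $ a = (\<Sum>b<r. (l \<cdot>\<^sub>m T) $$ (a, b) * x $ b)"
        using T_carrier x a by (intro mult_mat_vec_index_sum) auto
      also have "\<dots> = l * (\<Sum>b<r. T $$ (a, b) * x $ b)"
        unfolding sum_distrib_left using T_carrier a by (intro sum.cong) auto
      also have "\<dots> = (l \<cdot>\<^sub>v y) $ a"
        unfolding mult_mat_vec_index_sum[OF T_carrier x a, symmetric] y_def[symmetric]
        using a carrier_vecD[OF y] by simp
      finally show "((l \<cdot>\<^sub>m T) *\<^sub>v x) $ a = (l \<cdot>\<^sub>v y) $ a" .
    qed (use T_carrier y in auto)
    finally show ?thesis by blast
  qed
  have "\<exists>l. \<forall>a<r. T $$ (a, b) = l * y $ a" if "b < r" for b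
  proof -
    obtain l where "T *\<^sub>v unit_vec r b = l \<cdot>\<^sub>v y" using Tz[OF unit_vec_carrier] by blast
    then have "(T *\<^sub>v unit_vec r b) $ a = l * y $ a" if "a < r" for a using that y by simp
    then show ?thesis using that T_carrier by auto
  qed
  then obtain \<phi> where \<phi>: "\<And>a b. a < r \<Longrightarrow> b < r \<Longrightarrow> T $$ (a, b) = \<phi> b * y $ a" by metis
  \<comment> \<open>Now \<open>T\<close> is the column \<open>y\<close> times the row
    \<open>\<phi>\<close>. The rows \<open>\<phi> * B\<close> with \<open>B\<close> in the span fill
    the whole space: a nonzero vector \<open>x'\<close> annihilating them could be moved to the unit
    vector at \<open>b0\<close>, whereas \<open>\<phi> b0\<close> is nonzero.\<close>
  define row_of where "row_of B = vec r (\<lambda>b. \<Sum>k<r. \<phi> k * B $$ (k, b))" for B :: "'k mat"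
  define W where "W = row_of ` mat_span r S"
  have "W = carrier_vec r"
  proof (rule ccontr)
    assume proper: "W \<noteq> carrier_vec r"
    have W1: "W \<subseteq> carrier_vec r" by (auto simp: W_def row_of_def)
    have W2: "0\<^sub>v r \<in> W"
      unfolding W_def by (rule image_eqI[OF _ mat_span.zero]) (auto simp: row_of_def)
    have W3: "u + w \<in> W" if uw: "u \<in> W" "w \<in> W" for u w
    proof -
      obtain B C where BC: "B \<in> mat_span r S" "C \<in> mat_span r S" "u = row_of B" "w = row_of C"
        using uw unfolding W_def by blast
      have "u + w = row_of (B + C)"
        using BC span_carrier[OF BC(1)] span_carrier[OF BC(2)]
        by (intro eq_vecI) (auto simp: row_of_def algebra_simps sum.distrib)
      then show ?thesis using mat_span_add[OF S BC(1,2)] by (simp add: W_def)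
    qed
    have W4: "c \<cdot>\<^sub>v w \<in> W" if w: "w \<in> W" for c w
    proof -
      obtain B where B: "B \<in> mat_span r S" "w = row_of B" using w unfolding W_def by blast
      have "c \<cdot>\<^sub>v w = row_of (c \<cdot>\<^sub>m B)"
        using B span_carrier[OF B(1)]
        by (intro eq_vecI) (auto simp: row_of_def algebra_simps sum_distrib_left)
      then show ?thesis using mat_span_smult[OF S B(1)] by (simp add: W_def)
    qed
    have "\<exists>x'\<in>carrier_vec r. x' \<noteq> 0\<^sub>v r \<and> (\<forall>w\<in>W. x' \<bullet> w = 0)"
      by (rule proper_subspace_annihilator[of W r]) (use W1 W2 W3 W4 proper in auto)
    then obtain x' where x': "x' \<in> carrier_vec r" "x' \<noteq> 0\<^sub>v r" and ann: "\<And>w. w \<in> W \<Longrightarrow> x' \<bullet> w = 0"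
      by auto
    obtain B where B: "B \<in> mat_span r S" "B *\<^sub>v x' = unit_vec r b0"
      using transitive[OF x', of "unit_vec r b0"] by auto
    note B_carrier = span_carrier[OF B(1)]
    have "0 = x' \<bullet> row_of B" using ann B(1) by (simp add: W_def)
    also have "\<dots> = (\<Sum>b<r. \<Sum>k<r. x' $ b * (\<phi> k * B $$ (k, b)))"
      by (simp add: scalar_prod_def row_of_def lessThan_atLeast0 sum_distrib_left)
    also have "\<dots> = (\<Sum>k<r. \<Sum>b<r. x' $ b * (\<phi> k * B $$ (k, b)))"
      by (rule sum.swap)
    also have "\<dots> = (\<Sum>k<r. \<phi> k * (B *\<^sub>v x') $ k)"
      by (intro sum.cong) (auto simp: mult_mat_vec_index_sum[OF B_carrier x'(1)] sum_distrib_left mult_ac)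
    also have "\<dots> = (\<Sum>k<r. if k = b0 then \<phi> k else 0)"
      by (intro sum.cong) (auto simp: B(2) unit_vec_def)
    also have "\<dots> = \<phi> b0" using ab0 by simp
    finally show False using ab0 \<phi>[of a0 b0] by simp
  qed
  then obtain B where B: "B \<in> mat_span r S" "row_of B = unit_vec r j"
    unfolding W_def by (metis imageE unit_vec_carrier)
  obtain A where A: "A \<in> mat_span r S" "A *\<^sub>v y = unit_vec r i"
    using transitive[OF y y0, of "unit_vec r i"] by auto
  note AB_carrier = span_carrier[OF A(1)] span_carrier[OF B(1)]
  \<comment> \<open>\<open>A\<close> moves the column \<open>y\<close> to the unit vector at
    \<open>i\<close>, and \<open>B\<close> moves the row \<open>\<phi>\<close> to the unit vector at
    \<open>j\<close>.\<close>
  have "A * T * B = mat r r (\<lambda>(a, b). if a = i \<and> b = j then 1 else 0)"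
  proof (rule eq_matI)
    fix a b assume "a < dim_row (mat r r (\<lambda>(a, b). if a = i \<and> b = j then 1 else 0) :: 'k mat)"
      "b < dim_col (mat r r (\<lambda>(a, b). if a = i \<and> b = j then 1 else 0) :: 'k mat)"
    then have ab: "a < r" "b < r" by auto
    have AT: "(A * T) $$ (a, k) = unit_vec r i $ a * \<phi> k" if "k < r" for k
    proof -
      have "(A * T) $$ (a, k) = (\<Sum>l<r. A $$ (a, l) * y $ l) * \<phi> k"
        using ab that unfolding mult_mat_index_sum[OF AB_carrier(1) T_carrier ab(1) that] sum_distrib_right
        by (intro sum.cong) (auto simp: \<phi>)
      also have "(\<Sum>l<r. A $$ (a, l) * y $ l) = (A *\<^sub>v y) $ a"
        by (rule mult_mat_vec_index_sum[OF AB_carrier(1) y ab(1), symmetric])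
      finally show ?thesis by (simp add: A(2))
    qed
    have "(A * T * B) $$ (a, b) = (\<Sum>k<r. (A * T) $$ (a, k) * B $$ (k, b))"
      using AB_carrier T_carrier ab by (intro mult_mat_index_sum) auto
    also have "\<dots> = unit_vec r i $ a * (\<Sum>k<r. \<phi> k * B $$ (k, b))"
      unfolding sum_distrib_left by (intro sum.cong) (auto simp: AT)
    also have "(\<Sum>k<r. \<phi> k * B $$ (k, b)) = row_of B $ b" using ab by (simp add: row_of_def)
    finally show "(A * T * B) $$ (a, b) = mat r r (\<lambda>(a, b). if a = i \<and> b = j then 1 else 0) $$ (a, b)"
      using ab ij by (simp add: B(2) unit_vec_def)
  qed (use AB_carrier in auto)
  moreover have "A * T * B \<in> mat_span r S"
    by (intro mat_span_mult[OF S mult] A B T)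
  ultimately show ?thesis by simp
qed

text \<open>By Burnside's theorem the matrix units lie in the span of \<open>S\<close>, so an
  element of \<open>S\<close> is determined by the traces of its products with finitely many
  elements of \<open>S\<close>. These products lie in \<open>S\<close> again, so their traces take
  finitely many values.\<close>

lemma finite_if_finite_traces:
  fixes S :: "'k::alg_closed_field mat set"
  assumes S: "S \<subseteq> carrier_mat r r" and mult: "\<And>A B. A \<in> S \<Longrightarrow> B \<in> S \<Longrightarrow> A * B \<in> S"
    and one: "1\<^sub>m r \<in> S"
    and transitive: "\<And>x y. x \<in> carrier_vec r \<Longrightarrow> x \<noteq> 0\<^sub>v r \<Longrightarrow> y \<in> carrier_vec r \<Longrightarrow>
      \<exists>A\<in>mat_span r S. A *\<^sub>v x = y"
    and fin: "finite (mat_trace ` S)"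
  shows "finite S"
proof -
  define E where "E i j = mat r r (\<lambda>(a, b). if a = i \<and> b = j then 1 else (0::'k))" for i j
  have trace_E: "mat_trace (X * E i j) = X $$ (j, i)" if "X \<in> carrier_mat r r" "i < r" "j < r" for X i j
  proof -
    have "mat_trace (X * E i j) = (\<Sum>a<r. \<Sum>b<r. if a = j then (if b = i then X $$ (j, i) else 0) else 0)"
      unfolding E_def using that(1) by (subst mat_trace_mult[of _ r r]) (auto intro!: sum.cong)
    also have "\<dots> = (\<Sum>a<r. if a = j then X $$ (j, i) else 0)"
      using that(2) by (intro sum.cong) auto
    finally show ?thesis using that(3) by simp
  qed
  have "\<exists>T. finite T \<and> T \<subseteq> S \<and> (\<forall>X\<in>carrier_mat r r. \<forall>Y\<in>carrier_mat r r.
    (\<forall>A\<in>T. mat_trace (X * A) = mat_trace (Y * A)) \<longrightarrow> mat_trace (X * E i j) = mat_trace (Y * E i j))"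
    if "i < r" "j < r" for i j
    using burnside_mat_span[OF S mult one transitive that] unfolding E_def
    by (rule mat_span_trace_determined[OF S])
  then obtain T where T: "\<And>i j. i < r \<Longrightarrow> j < r \<Longrightarrow> finite (T i j) \<and> T i j \<subseteq> S"
    and T_det: "\<And>i j X Y. i < r \<Longrightarrow> j < r \<Longrightarrow> X \<in> carrier_mat r r \<Longrightarrow> Y \<in> carrier_mat r r \<Longrightarrow>
      (\<forall>A\<in>T i j. mat_trace (X * A) = mat_trace (Y * A)) \<Longrightarrow> mat_trace (X * E i j) = mat_trace (Y * E i j)"
    by metis
  define TT where "TT = (\<Union>i<r. \<Union>j<r. T i j)"
  define \<tau> where "\<tau> A = restrict (\<lambda>B. mat_trace (A * B)) TT" for A
  have TT: "finite TT" "TT \<subseteq> S" using T by (auto simp: TT_def)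
  have "\<tau> ` S \<subseteq> PiE TT (\<lambda>_. mat_trace ` S)"
    using TT mult by (auto simp: \<tau>_def)
  then have "finite (\<tau> ` S)"
    by (rule finite_subset) (use TT fin in \<open>auto intro: finite_PiE\<close>)
  moreover have "inj_on \<tau> S"
  proof (rule inj_onI)
    fix X Y assume XY: "X \<in> S" "Y \<in> S" and eq: "\<tau> X = \<tau> Y"
    have carrier: "X \<in> carrier_mat r r" "Y \<in> carrier_mat r r" using XY S by auto
    show "X = Y"
    proof (rule eq_matI)
      fix a b assume "a < dim_row Y" "b < dim_col Y"
      then have ab: "a < r" "b < r" using carrier by auto
      have "mat_trace (X * A) = mat_trace (Y * A)" if "A \<in> T b a" for A
      proof -
        have "A \<in> TT" using that ab by (auto simp: TT_def)
        then show ?thesis using fun_cong[OF eq, of A] by (simp add: \<tau>_def)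
      qed
      then show "X $$ (a, b) = Y $$ (a, b)"
        using T_det[OF ab(2,1) carrier] trace_E[OF carrier(1) ab(2,1)] trace_E[OF carrier(2) ab(2,1)] by simp
    qed (use carrier in auto)
  qed
  ultimately show ?thesis by (rule finite_imageD)
qed

section \<open>Triangular form and prime powers of Jordan matrices\<close>

lemma of_nat_choose_prime_power:
  assumes "prime CHAR('k::field)" "0 < i" "i < CHAR('k) ^ s"
  shows "of_nat (CHAR('k) ^ s choose i) = (0::'k)"
proof -
  define q where "q = CHAR('k) ^ s"
  \<comment> \<open>In positive characteristic \<open>(1 + X) ^ q = 1 + X ^ q\<close>; comparing
    this with the binomial expansion at coefficient \<open>i\<close> gives the claim.\<close>
  have "(1 + monom 1 1 :: 'k poly) ^ q = 1 ^ q + monom 1 1 ^ q"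
    by (rule freshmans_dream'[of q s]) (use assms in \<open>auto simp: q_def\<close>)
  moreover have "(1 + monom 1 1 :: 'k poly) ^ q = (\<Sum>j\<le>q. monom (of_nat (q choose j)) j)"
    by (subst add.commute, subst binomial_ring)
       (simp add: monom_power of_nat_monom mult_monom)
  ultimately have "coeff (\<Sum>j\<le>q. monom (of_nat (q choose j) :: 'k) j) i = coeff (1 + monom 1 q) i"
    by (simp add: monom_power)
  then show ?thesis
    using assms by (simp add: coeff_sum q_def)
qed

text \<open>Completing an eigenvector to a basis makes the first column of the conjugated matrix a
  multiple of the first unit vector; the lower right block is smaller and is triangularized by
  induction.\<close>

lemma triangularizable:
  fixes A :: "'k::alg_closed_field mat"
  assumes "A \<in> carrier_mat r r"
  shows "\<exists>B\<in>carrier_mat r r. upper_triangular B \<and> similar_mat A B"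
  using assms
proof (induction r arbitrary: A)
  case 0
  then show ?case by (intro bexI[of _ A]) (auto intro: similar_mat_refl)
next
  case (Suc m)
  let ?n = "Suc m"
  note A = Suc.prems
  have "degree (char_poly A) > 0" using degree_monic_char_poly[OF A] by simp
  then obtain l where "poly (char_poly A) l = 0" using alg_closed_imp_poly_has_root by blast
  then have "eigenvalue A l" using eigenvalue_root_char_poly[OF A] by simp
  then obtain v where v: "v \<in> carrier_vec ?n" "v \<noteq> 0\<^sub>v ?n" "A *\<^sub>v v = l \<cdot>\<^sub>v v"
    using A by (auto simp: eigenvalue_def eigenvector_def)
  interpret vec_space "TYPE('k)" ?n .
  define ws where "ws = basis_completion v"
  note ws = basis_completion[OF v(1,2), folded ws_def]
  define P where "P = mat_of_cols ?n ws"
  have P: "P \<in> carrier_mat ?n ?n" using ws(6) by (simp add: P_def mat_of_cols_carrier(1)[of ?n ws, unfolded ws(6)])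
  have "rank P = ?n"
    by (rule lin_indpt_full_rank[OF P]) (use ws in \<open>auto simp: P_def\<close>)
  then have "det P \<noteq> 0" using det_rank_iff[OF P] by simp
  then obtain P' where P': "P' \<in> carrier_mat ?n ?n" "P * P' = 1\<^sub>m ?n" "P' * P = 1\<^sub>m ?n"
    using det_nonzero_obtain_inverse[OF P] by blast
  have "ws ! 0 = v" using ws(6,7) by (metis hd_conv_nth length_greater_0_conv zero_less_Suc)
  then have col0: "col P 0 = v" using v(1) ws(6) by (simp add: P_def)
  define B where "B = P' * A * P"
  have B: "B \<in> carrier_mat ?n ?n" using A P P' by (simp add: B_def)
  have "A = P * B * P'"
  proof -
    have "P * B * P' = P * (P' * A * P) * P'" by (simp add: B_def)
    also have "\<dots> = (P * P') * A * (P * P')"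
      using A P P'(1) by (simp add: assoc_mult_mat[where ?n\<^sub>1.0 = ?n and ?n\<^sub>2.0 = ?n and ?n\<^sub>3.0 = ?n and ?n\<^sub>4.0 = ?n])
    finally show ?thesis using A P' by simp
  qed
  then have AB: "similar_mat A B"
    unfolding similar_mat_def using similar_mat_witI[OF P'(2,3) _ A B P P'(1)] by blast
  have "col B 0 = P' *\<^sub>v (A *\<^sub>v col P 0)"
    using A P P'(1) v(1) unfolding B_def
    by (subst col_mult2[of _ ?n ?n _ ?n]) (auto simp: col0 intro!: assoc_mult_mat_vec[of _ ?n ?n _ ?n])
  also have "\<dots> = l \<cdot>\<^sub>v (P' *\<^sub>v col P 0)"
    using v P'(1) by (simp add: col0 mult_mat_vec[of _ ?n ?n])
  also have "P' *\<^sub>v col P 0 = col (P' * P) 0"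
    using P P'(1) by (subst col_mult2[of _ ?n ?n _ ?n]) auto
  finally have colB: "col B 0 = l \<cdot>\<^sub>v unit_vec ?n 0" by (simp add: P'(3))
  have B0: "B $$ (Suc i, 0) = 0" if "i < m" for i
  proof -
    have "B $$ (Suc i, 0) = col B 0 $ Suc i" using that B by simp
    then show ?thesis using that by (simp add: colB)
  qed
  obtain B1 B2 B3 B4 where split: "split_block B 1 1 = (B1, B2, B3, B4)" by (metis prod_cases4)
  have dim: "dim_row B = 1 + m" "dim_col B = 1 + m" using B by auto
  note Bs = split_block[OF split dim]
  have "B3 = 0\<^sub>m m 1"
    using split B0 B by (intro eq_matI) (auto simp: split_block_def Let_def)
  then have B_block: "B = four_block_mat B1 B2 (0\<^sub>m m 1) B4" using Bs(5) by simp
  obtain D where D: "D \<in> carrier_mat m m" "upper_triangular D" "similar_mat B4 D"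
    using Suc.IH[OF Bs(4)] by blast
  obtain B0 where B0: "B0 \<in> carrier_mat 1 m" "similar_mat B (four_block_mat B1 B0 (0\<^sub>m m 1) D)"
    using similar_mat_four_block_0_ex[OF similar_mat_refl[OF Bs(1)] D(3) Bs(2,1,4)] B_block by metis
  show ?case
  proof (rule bexI, rule conjI)
    show "upper_triangular (four_block_mat B1 B0 (0\<^sub>m m 1) D)"
      by (rule upper_triangular_four_block[OF Bs(1) D(1) _ D(2)]) (use Bs(1) in auto)
    show "similar_mat A (four_block_mat B1 B0 (0\<^sub>m m 1) D)"
      by (rule similar_mat_trans[OF AB B0(2)])
    show "four_block_mat B1 B0 (0\<^sub>m m 1) D \<in> carrier_mat ?n ?n"
      using Bs(1) D(1) by auto
  qed
qed

text \<open>Above the diagonal, the power of a Jordan block carries the coefficient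
  \<open>CHAR('k) ^ s choose (j - i)\<close>. As \<open>j - i\<close> is positive and less than the
  block size, it vanishes in the field.\<close>

lemma jordan_matrix_prime_power:
  assumes "prime CHAR('k::field)" "\<And>x. x \<in> set xs \<Longrightarrow> fst x \<le> CHAR('k) ^ s"
    and "i < sum_list (map fst xs)" "j < sum_list (map fst xs)"
  shows "(jordan_matrix xs ^\<^sub>m (CHAR('k) ^ s)) $$ (i, j)
    = (if i = j then (jordan_matrix xs $$ (i, i) :: 'k) ^ (CHAR('k) ^ s) else 0)"
  using assms(2-)
proof (induction xs arbitrary: i j)
  case (Cons x xs)
  obtain n a where x: "x = (n, a)" by fastforce
  let ?q = "CHAR('k) ^ s" and ?m = "sum_list (map fst xs)"
  have pow: "jordan_matrix (x # xs) ^\<^sub>m ?q = four_block_mat (jordan_block n a ^\<^sub>m ?q) (0\<^sub>m n ?m) (0\<^sub>m ?m n)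
      (jordan_matrix xs ^\<^sub>m ?q)"
    unfolding x jordan_matrix_Cons by (rule pow_four_block_mat) auto
  have block: "(jordan_block n a ^\<^sub>m ?q) $$ (i, j) = (if i = j then a ^ ?q else 0)" if "i < n" "j < n" for i j
  proof -
    have "of_nat (?q choose (j - i)) = (0::'k)" if "i < j"
      using Cons.prems(1)[of x] that \<open>j < n\<close> by (intro of_nat_choose_prime_power assms(1)) (auto simp: x)
    then show ?thesis using that by (auto simp: jordan_block_pow)
  qed
  have carrier: "jordan_matrix xs ^\<^sub>m ?q \<in> carrier_mat ?m ?m" "jordan_block n a ^\<^sub>m ?q \<in> carrier_mat n n"
    by (auto intro!: pow_carrier_mat)
  have IH: "(jordan_matrix xs ^\<^sub>m ?q) $$ (i, j) = (if i = j then (jordan_matrix xs $$ (i, i)) ^ ?q else 0)"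
    if "i < ?m" "j < ?m" for i j
    by (rule Cons.IH) (use that Cons.prems(1) in auto)
  show ?case
    using Cons.prems(2,3) carrier prime_gt_0_nat[OF assms(1)] unfolding pow unfolding x jordan_matrix_Cons
    by (auto simp: block IH)
qed simp

text \<open>In characteristic \<open>p\<close> a Jordan block to the power \<open>p ^ s\<close> is scalar once \<open>p ^ s\<close> exceeds its size.\<close>

lemma prime_power_diagonalizable:
  fixes A :: "'k::alg_closed_field mat"
  assumes "prime CHAR('k)" "A \<in> carrier_mat r r" "r \<le> CHAR('k) ^ s"
  shows "\<exists>P P' l. P \<in> carrier_mat r r \<and> P' \<in> carrier_mat r r \<and> P' * P = 1\<^sub>m r \<and>
    mat_trace A = (\<Sum>i<r. l i) \<and>
    A ^\<^sub>m (CHAR('k) ^ s) * P = P * mat r r (\<lambda>(i, j). if i = j then l i ^ (CHAR('k) ^ s) else 0) \<and>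
    P' * A ^\<^sub>m (CHAR('k) ^ s) = mat r r (\<lambda>(i, j). if i = j then l i ^ (CHAR('k) ^ s) else 0) * P'"
proof -
  let ?q = "CHAR('k) ^ s"
  obtain B where B: "B \<in> carrier_mat r r" "upper_triangular B" "similar_mat A B"
    using triangularizable[OF assms(2)] by blast
  obtain xs where xs: "similar_mat B (jordan_matrix xs)"
    using triangular_to_jnf_vector[OF B(1,2)] unfolding jordan_nf_def by blast
  define J where "J = jordan_matrix xs"
  have "similar_mat A J" unfolding J_def by (rule similar_mat_trans[OF B(3) xs])
  then obtain P P' where wit: "similar_mat_wit A J P P'" unfolding similar_mat_def by blast
  note w = similar_mat_witD2[OF assms(2) wit]
  have r: "sum_list (map fst xs) = r"
    using w(5) jordan_matrix_carrier[of xs] unfolding J_def by (metis carrier_matD(1))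
  \<comment> \<open>The columns of \<open>P\<close> and the rows of \<open>P'\<close> are right and
    left eigenvectors of the power, with the diagonal of \<open>D\<close> as eigenvalues; these are
    powers of the entries \<open>J $$ (i, i)\<close>, which sum to the trace of
    \<open>A\<close>.\<close>
  define D where "D = mat r r (\<lambda>(i, j). if i = j then (J $$ (i, i)) ^ ?q else 0)"
  have "fst x \<le> ?q" if "x \<in> set xs" for x
    using member_le_sum_list[of "fst x" "map fst xs"] that assms(3) r by auto
  then have D: "J ^\<^sub>m ?q = D"
    using jordan_matrix_prime_power[OF assms(1), of xs s] r w(5)
    by (intro eq_matI) (auto simp: D_def J_def)
  have D_carrier: "D \<in> carrier_mat r r" by (simp add: D_def)
  have Aq: "A ^\<^sub>m ?q = P * D * P'" using similar_mat_wit_pow_id[OF wit, of ?q] by (simp add: D)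
  have "A ^\<^sub>m ?q * P = P * D * (P' * P)"
    unfolding Aq using w D_carrier by (intro assoc_mult_mat[of _ r r _ r]) auto
  then have "A ^\<^sub>m ?q * P = P * D"
    using w(2) right_mult_one_mat[OF mult_carrier_mat[OF w(6) D_carrier]] by simp
  moreover have "P' * A ^\<^sub>m ?q = D * P'"
  proof -
    have "P' * (P * D * P') = P' * (P * (D * P'))"
      using w D_carrier by (simp add: assoc_mult_mat[of P r r D r P' r])
    also have "\<dots> = P' * P * (D * P')"
      by (rule assoc_mult_mat[symmetric, of _ r r _ r]) (use w D_carrier in auto)
    also have "\<dots> = D * P'"
      using w(2) left_mult_one_mat[OF mult_carrier_mat[OF D_carrier w(7)]] by simp
    finally show ?thesis by (simp add: Aq)
  qed
  moreover have "mat_trace A = (\<Sum>i<r. J $$ (i, i))"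
  proof -
    have "mat_trace A = mat_trace (P' * (P * J))"
      unfolding w(3) by (rule mat_trace_comm[of _ r r]) (use w in auto)
    also have "P' * (P * J) = P' * P * J"
      by (rule assoc_mult_mat[symmetric, of _ r r _ r]) (use w in auto)
    also have "\<dots> = J" using w by simp
    finally show ?thesis using w(5) by (simp add: mat_trace_def)
  qed
  ultimately show ?thesis
    using w(2,6,7) by (intro exI[of _ P] exI[of _ P'] exI[of _ "\<lambda>i. J $$ (i, i)"]) (simp add: D_def)
qed

section \<open>Modules with eigenvalues of large order\<close>

lemma sum_bool_times:
  "(\<Sum>x\<in>UNIV \<times> A. h x) = (\<Sum>i\<in>A. h (False, i)) + (\<Sum>i\<in>A. h (True, i))"
proof -
  have "(\<Sum>x\<in>UNIV \<times> A. h x) = (\<Sum>b\<in>UNIV. \<Sum>i\<in>A. h (b, i))"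
    by (simp add: sum.cartesian_product)
  then show ?thesis by (simp add: UNIV_bool)
qed

definition rep_mat :: "nat \<Rightarrow> ('k mat \<Rightarrow> nat \<Rightarrow> nat \<Rightarrow> 'k) \<Rightarrow> 'k mat \<Rightarrow> 'k mat" where
  "rep_mat r R g = mat r r (\<lambda>(i, j). R g i j)"

lemma rep_mat_carrier: "rep_mat r R g \<in> carrier_mat r r"
  by (simp add: rep_mat_def)

context linear_group
begin

lemma rep_onD:
  assumes "rep_on I R"
  shows "finite I" "\<And>i j. i \<in> I \<Longrightarrow> j \<in> I \<Longrightarrow> regular (\<lambda>g. R g i j)"
    "\<And>i j. i \<in> I \<Longrightarrow> j \<in> I \<Longrightarrow> R (1\<^sub>m n) i j = (if i = j then 1 else 0)"
    "\<And>g h i j. g \<in> G \<Longrightarrow> h \<in> G \<Longrightarrow> i \<in> I \<Longrightarrow> j \<in> I \<Longrightarrow> R (g * h) i j = (\<Sum>k\<in>I. R g i k * R h k j)"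
  using assms unfolding rep_on_def by auto

lemma rep_mat_one: "rep_on {..<r} R \<Longrightarrow> rep_mat r R (1\<^sub>m n) = 1\<^sub>m r"
  by (intro eq_matI) (auto simp: rep_mat_def rep_onD)

lemma rep_mat_mult:
  assumes "rep_on {..<r} R" "g \<in> G" "h \<in> G"
  shows "rep_mat r R (g * h) = rep_mat r R g * rep_mat r R h"
proof (rule eq_matI)
  fix i j assume "i < dim_row (rep_mat r R g * rep_mat r R h)" "j < dim_col (rep_mat r R g * rep_mat r R h)"
  then have ij: "i < r" "j < r" by (simp_all add: rep_mat_def)
  have "(rep_mat r R g * rep_mat r R h) $$ (i, j) = (\<Sum>k<r. R g i k * R h k j)"
    unfolding mult_mat_index_sum[OF rep_mat_carrier rep_mat_carrier ij]
    using ij by (intro sum.cong) (auto simp: rep_mat_def)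
  then show "rep_mat r R (g * h) $$ (i, j) = (rep_mat r R g * rep_mat r R h) $$ (i, j)"
    using ij rep_onD(4)[OF assms, of i j] by (simp add: rep_mat_def)
qed (simp_all add: rep_mat_def)

lemma G_pow: "g \<in> G \<Longrightarrow> g ^\<^sub>m k \<in> G"
  by (induction k) (auto intro: G_mult simp: G_one carrier_matD[OF G_carrier])

lemma rep_mat_pow:
  assumes "rep_on {..<r} R" "g \<in> G"
  shows "rep_mat r R (g ^\<^sub>m k) = rep_mat r R g ^\<^sub>m k"
proof (induction k)
  case 0
  then show ?case using assms G_carrier[OF assms(2)] by (simp add: rep_mat_one rep_mat_carrier carrier_matD[OF rep_mat_carrier])
next
  case (Suc k)
  then show ?case using rep_mat_mult[OF assms(1) G_pow[OF assms(2)] assms(2)] by simp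
qed

text \<open>On the pair of eigenvectors, \<open>g0\<close> acts on the dual part by
  \<open>inverse l\<close> and on the Frobenius twist by \<open>l ^ q\<close>. An invariant of
  degree at most \<open>d\<close> is constant along the resulting orbit, but a nonconstant monomial
  of degree at most \<open>d < q\<close> cannot have weight 0; \<open>order\<close> provides enough
  orbit points to compare polynomials.\<close>

lemma less_sigma_of_eigenvalue:
  fixes R :: "'k mat \<Rightarrow> nat \<Rightarrow> nat \<Rightarrow> 'k"
  assumes char: "prime CHAR('k)"
    and R: "rep_on {..<r} R" and g0: "g0 \<in> G"
    and right: "\<And>i. i < r \<Longrightarrow> (\<Sum>j<r. R g0 i j * e j) = l * e i"
    and left: "\<And>j. j < r \<Longrightarrow> (\<Sum>i<r. \<phi> i * R g0 i j) = l * \<phi> j"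
    and pair: "(\<Sum>i<r. \<phi> i * e i) = 1"
    and q: "q = CHAR('k) ^ s" "d < q"
    and order: "inj_on (\<lambda>k. l ^ k) {..d * (q + 1)}"
  shows "enat d < sigma n G"
proof -
  define I where "I = (UNIV :: bool set) \<times> {..<r}"
  \<comment> \<open>The tag \<open>False\<close> marks the dual, with the transposed inverse of
    \<open>R g\<close>, and the tag \<open>True\<close> the Frobenius twist, with the entries of
    \<open>R g\<close> raised to the power \<open>q\<close>.\<close>
  define RR where "RR g x y = (if fst x \<noteq> fst y then 0 else if fst x then R g (snd x) (snd y) ^ q
      else R (ginv g) (snd y) (snd x))" for g and x y :: "bool \<times> nat"
  note RD = rep_onD[OF R, simplified]
  have q_pos: "q > 0" using q(2) by simp
  have sum_I: "(\<Sum>x\<in>I. h x) = (\<Sum>i<r. h (False, i)) + (\<Sum>i<r. h (True, i))" for h :: "bool \<times> nat \<Rightarrow> 'k"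
    unfolding I_def by (rule sum_bool_times)
  have frob: "(\<Sum>i<r. h i) ^ q = (\<Sum>i<r. h i ^ q)" for h :: "nat \<Rightarrow> 'k"
    by (rule freshmans_dream_sum'[OF char q(1)])
  have "rep_on I RR"
    unfolding rep_on_def
  proof (intro conjI ballI)
    show "finite I" by (simp add: I_def)
    fix x y assume "x \<in> I" "y \<in> I"
    then obtain b c i j where xy: "x = (b, i)" "y = (c, j)" and ij: "i < r" "j < r" by (auto simp: I_def)
    show "regular (\<lambda>g. RR g x y)"
      using ij unfolding RR_def xy
      by (cases b; cases c) (auto intro: regular_const regular_power regular_inv RD(2))
    show "RR (1\<^sub>m n) x y = (if x = y then 1 else 0)"
      using ij q_pos by (auto simp: RR_def xy RD G_inv_one)
    fix g h assume gh: "g \<in> G" "h \<in> G"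
    show "RR (g * h) x y = (\<Sum>k\<in>I. RR g x k * RR h k y)"
      using ij gh
      by (auto simp: sum_I RR_def xy RD(4) G_inv_mult G_inv frob power_mult_distrib mult.commute)
  qed
  define f where "f v = (\<Sum>i<r. v (False, i) ^ q * v (True, i))" for v :: "bool \<times> nat \<Rightarrow> 'k"
  define v0 where "v0 x = (if fst x then e (snd x) ^ q else \<phi> (snd x))" for x :: "bool \<times> nat"
  define act where "act g v x = (\<Sum>y\<in>I. RR g x y * v y)" for g and v :: "bool \<times> nat \<Rightarrow> 'k" and x
  have act_True: "act g v (True, i) = (\<Sum>j<r. R g i j ^ q * v (True, j))" for g v i
    by (simp add: act_def sum_I RR_def)
  have act_False: "act g v (False, i) = (\<Sum>j<r. R (ginv g) j i * v (False, j))" for g v i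
    by (simp add: act_def sum_I RR_def)
  have inv_mult: "(\<Sum>i<r. R (ginv g) j i * R g i k) = (if j = k then 1 else 0)"
    if "g \<in> G" "j < r" "k < r" for g j k
    using RD(4)[OF G_inv[OF that(1)] that] RD(3)[OF that(2,3)] by (simp add: G_inv_left that(1))
  have mult_inv: "(\<Sum>i<r. R g j i * R (ginv g) i k) = (if j = k then 1 else 0)"
    if "g \<in> G" "j < r" "k < r" for g j k
    using RD(4)[OF that(1) G_inv[OF that(1)] that(2,3)] RD(3)[OF that(2,3)] by (simp add: G_inv_right that(1))
  have f_poly: "polynomial_fun I (1 * q + 1) f"
    unfolding f_def I_def
    by (intro polynomial_fun_sum polynomial_fun_mult polynomial_fun_power polynomial_fun_var) auto
  have f_inv: "f (act g v) = f v" if g: "g \<in> G" for g v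
  proof -
    have "f (act g v) = (\<Sum>i<r. (\<Sum>j<r. R (ginv g) j i ^ q * v (False, j) ^ q) * (\<Sum>k<r. R g i k ^ q * v (True, k)))"
      unfolding f_def act_True act_False frob power_mult_distrib ..
    also have "\<dots> = (\<Sum>i<r. \<Sum>j<r. \<Sum>k<r. v (False, j) ^ q * v (True, k) * (R (ginv g) j i * R g i k) ^ q)"
      unfolding sum_product by (intro sum.cong refl) (simp add: power_mult_distrib mult_ac)
    also have "\<dots> = (\<Sum>j<r. \<Sum>i<r. \<Sum>k<r. v (False, j) ^ q * v (True, k) * (R (ginv g) j i * R g i k) ^ q)"
      by (rule sum.swap)
    also have "\<dots> = (\<Sum>j<r. \<Sum>k<r. \<Sum>i<r. v (False, j) ^ q * v (True, k) * (R (ginv g) j i * R g i k) ^ q)"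
      by (intro sum.cong refl sum.swap)
    also have "\<dots> = (\<Sum>j<r. \<Sum>k<r. v (False, j) ^ q * v (True, k) * (\<Sum>i<r. R (ginv g) j i * R g i k) ^ q)"
      by (simp add: frob sum_distrib_left)
    also have "\<dots> = (\<Sum>j<r. \<Sum>k<r. if k = j then v (False, j) ^ q * v (True, k) else 0)"
      using q_pos by (intro sum.cong refl) (auto simp: inv_mult[OF g])
    finally show ?thesis by (simp add: f_def)
  qed
  have f_v0: "f v0 \<noteq> 0"
    using frob[of "\<lambda>i. \<phi> i * e i"] pair by (simp add: f_def v0_def power_mult_distrib)
  \<comment> \<open>Multiplying the left eigenvector equation by the inverse of \<open>R g0\<close>
    exhibits \<open>\<phi>\<close> as \<open>l\<close> times a vector. This excludes
    \<open>l = 0\<close>, since \<open>\<phi>\<close> pairs to 1 with \<open>e\<close>.\<close>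
  have phi: "\<phi> k = l * (\<Sum>i<r. R (ginv g0) i k * \<phi> i)" if k: "k < r" for k
  proof -
    have "\<phi> k = (\<Sum>j<r. \<phi> j * (if j = k then 1 else 0))"
      using k by (simp add: if_distrib cong: if_cong)
    also have "\<dots> = (\<Sum>j<r. \<phi> j * (\<Sum>i<r. R g0 j i * R (ginv g0) i k))"
      using k by (intro sum.cong refl) (simp add: mult_inv[OF g0])
    also have "\<dots> = (\<Sum>j<r. \<Sum>i<r. \<phi> j * R g0 j i * R (ginv g0) i k)"
      by (simp add: sum_distrib_left mult.assoc)
    also have "\<dots> = (\<Sum>i<r. \<Sum>j<r. \<phi> j * R g0 j i * R (ginv g0) i k)" by (rule sum.swap)
    also have "\<dots> = (\<Sum>i<r. (\<Sum>j<r. \<phi> j * R g0 j i) * R (ginv g0) i k)"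
      by (simp add: sum_distrib_right)
    also have "\<dots> = l * (\<Sum>i<r. R (ginv g0) i k * \<phi> i)" using left by (simp add: sum_distrib_left mult_ac)
    finally show ?thesis .
  qed
  have l0: "l \<noteq> 0"
  proof
    assume "l = 0"
    then have "(\<Sum>i<r. \<phi> i * e i) = 0" using phi by (intro sum.neutral) auto
    then show False using pair by simp
  qed
  have left_inv: "(\<Sum>i<r. R (ginv g0) i k * \<phi> i) = inverse l * \<phi> k" if k: "k < r" for k
    by (subst phi[OF k]) (simp add: l0)
  \<comment> \<open>A curve through \<open>v0\<close>, at parameter 1; applying \<open>g0\<close>
    takes parameter \<open>l ^ k\<close> to \<open>l ^ Suc k\<close>.\<close>
  define vz where "vz z x = (if fst x then z ^ q * v0 x else inverse z * v0 x)" for z and x :: "bool \<times> nat"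
  have vanish: "F v0 = 0"
    if F: "polynomial_fun I d F" and F_inv: "invariant_on I RR F" and F0: "F (\<lambda>_. 0) = 0" for F
  proof -
    have orbit: "F (vz (l ^ k)) = F v0" for k
    proof (induction k)
      case 0
      have "vz (l ^ 0) = v0" by (auto simp: vz_def)
      then show ?case by simp
    next
      case (Suc k)
      have "F (vz (l ^ Suc k)) = F (act g0 (vz (l ^ k)))"
      proof (rule polynomial_fun_cong_on[OF F])
        fix x assume "x \<in> I"
        then obtain b i where x: "x = (b, i)" and i: "i < r" by (auto simp: I_def)
        show "vz (l ^ Suc k) x = act g0 (vz (l ^ k)) x"
        proof (cases b)
          case True
          have "act g0 (vz (l ^ k)) x = (l ^ k) ^ q * (\<Sum>j<r. R g0 i j * e j) ^ q"
            unfolding x frob sum_distrib_left using True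
            by (simp add: act_True vz_def v0_def power_mult_distrib mult_ac)
          also have "\<dots> = vz (l ^ Suc k) x"
            unfolding right[OF i] using True by (simp add: x vz_def v0_def power_mult_distrib mult_ac)
          finally show ?thesis by simp
        next
          case False
          have "act g0 (vz (l ^ k)) x = inverse (l ^ k) * (\<Sum>j<r. R (ginv g0) j i * \<phi> j)"
            unfolding x sum_distrib_left using False
            by (simp add: act_False vz_def v0_def mult_ac)
          also have "\<dots> = vz (l ^ Suc k) x"
            unfolding left_inv[OF i] using False by (simp add: x vz_def v0_def mult_ac)
          finally show ?thesis by simp
        qed
      qed
      also have "\<dots> = F (vz (l ^ k))"
        using F_inv g0 unfolding invariant_on_def act_def by blast
      finally show ?case using Suc by simp
    qed
    obtain K c where K: "finite K" "\<And>m. m \<in> K \<Longrightarrow> monom_deg m \<le> d"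
      "\<And>v. F v = (\<Sum>m\<in>K. c m * monom_fun v m)"
      using polynomial_funE[OF F] by metis
    \<comment> \<open>\<open>a\<close> and \<open>b\<close> are the degrees of a monomial in the
      dual and in the twisted variables; on the curve it scales by \<open>z ^ (q * b m)\<close> over
      \<open>z ^ a m\<close>.\<close>
    define a where "a m = (\<Sum>x\<in>Poly_Mapping.keys m. if fst x then 0 else Poly_Mapping.lookup m x)"
      for m :: "bool \<times> nat \<Rightarrow>\<^sub>0 nat"
    define b where "b m = (\<Sum>x\<in>Poly_Mapping.keys m. if fst x then Poly_Mapping.lookup m x else 0)"
      for m :: "bool \<times> nat \<Rightarrow>\<^sub>0 nat"
    have ab: "a m + b m = monom_deg m" for m
      unfolding a_def b_def monom_deg_def sum.distrib[symmetric] by (intro sum.cong) auto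
    have monom_vz: "monom_fun (vz z) m = z ^ (q * b m) * inverse z ^ a m * monom_fun v0 m" for z m
    proof -
      have "monom_fun (vz z) m = (\<Prod>x\<in>Poly_Mapping.keys m.
          (z ^ q) ^ (if fst x then Poly_Mapping.lookup m x else 0) *
          inverse z ^ (if fst x then 0 else Poly_Mapping.lookup m x) * v0 x ^ Poly_Mapping.lookup m x)"
        unfolding monom_fun_def by (intro prod.cong) (auto simp: vz_def power_mult_distrib)
      then show ?thesis
        by (simp add: prod.distrib power_sum[symmetric] a_def b_def monom_fun_def power_mult)
    qed
    \<comment> \<open>The factor \<open>z ^ d\<close> clears the negative powers of
      \<open>z\<close>; since \<open>a m \<le> d\<close>, the subtraction in the exponent is never
      truncated.\<close>
    define Q where "Q = (\<Sum>m\<in>K. monom (c m * monom_fun v0 m) (d + q * b m - a m))"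
    have a_le: "a m \<le> d" "b m \<le> d" if "m \<in> K" for m using ab[of m] K(2)[OF that] by auto
    have poly_Q: "poly Q z = z ^ d * F (vz z)" if "z \<noteq> 0" for z
    proof -
      have "z ^ (d + q * b m - a m) = z ^ d * (z ^ (q * b m) * inverse z ^ a m)" if "m \<in> K" for m
      proof -
        have "z ^ (d + q * b m - a m) * z ^ a m = z ^ (d + q * b m)"
          using a_le[OF that] by (simp flip: power_add)
        then show ?thesis using \<open>z \<noteq> 0\<close> by (simp add: field_simps power_add)
      qed
      then show ?thesis
        by (simp add: Q_def poly_sum poly_monom K(3) monom_vz sum_distrib_left mult_ac)
    qed
    \<comment> \<open>Both sides have degree at most \<open>d * (q + 1)\<close> and agree at one
      more point than that, namely at the distinct powers of \<open>l\<close>.\<close>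
    have "Q = monom (F v0) d"
    proof (rule poly_eqI_degree[where A = "(\<lambda>k. l ^ k) ` {..d * (q + 1)}"])
      fix z assume "z \<in> (\<lambda>k. l ^ k) ` {..d * (q + 1)}"
      then obtain k where "z = l ^ k" by blast
      then show "poly Q z = poly (monom (F v0) d) z"
        using l0 poly_Q[of z] orbit[of k] by (simp add: poly_monom)
    next
      have card: "card ((\<lambda>k. l ^ k) ` {..d * (q + 1)}) = Suc (d * (q + 1))"
        using card_image[OF order] by simp
      have "degree Q \<le> d * (q + 1)"
        unfolding Q_def
      proof (rule degree_sum_le[OF K(1)])
        fix m assume "m \<in> K"
        have "q * b m \<le> q * d" using a_le[OF \<open>m \<in> K\<close>] by simp
        then have "d + q * b m - a m \<le> d * (q + 1)" by (simp only: distrib_left mult.commute[of q d] mult_1_right)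
        then show "degree (monom (c m * monom_fun v0 m) (d + q * b m - a m)) \<le> d * (q + 1)"
          by (rule order_trans[OF degree_monom_le])
      qed
      then show "degree Q < card ((\<lambda>k. l ^ k) ` {..d * (q + 1)})" unfolding card by simp
      have "degree (monom (F v0) d) \<le> d * (q + 1)"
        by (rule order_trans[OF degree_monom_le]) simp
      then show "degree (monom (F v0) d) < card ((\<lambda>k. l ^ k) ` {..d * (q + 1)})"
        unfolding card by simp
    qed
    then have "F v0 = coeff Q d" by simp
    also have "\<dots> = (\<Sum>m\<in>K. if m = 0 then c m else 0)"
      unfolding Q_def coeff_sum
    proof (intro sum.cong refl)
      fix m assume m: "m \<in> K"
      \<comment> \<open>Only the constant monomial has weight 0:
        \<open>q * b m = a m \<le> d < q\<close> forces \<open>b m = 0\<close> and then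
        \<open>a m = 0\<close>.\<close>
      have "d + q * b m - a m = d \<longleftrightarrow> m = 0"
      proof
        assume "d + q * b m - a m = d"
        then have "q * b m = a m" using a_le[OF m] by simp
        then have "b m = 0" using a_le(1)[OF m] q(2) by (cases "b m") auto
        then have "monom_deg m = 0" using ab[of m] \<open>q * b m = a m\<close> by simp
        then have "\<forall>x\<in>Poly_Mapping.keys m. Poly_Mapping.lookup m x = 0" by (simp add: monom_deg_def)
        then have "Poly_Mapping.lookup m x = 0" for x by (meson in_keys_iff)
        then show "m = 0" by (intro poly_mapping_eqI) simp
      qed (simp add: a_def b_def)
      then show "coeff (monom (c m * monom_fun v0 m) (d + q * b m - a m)) d
          = (if m = 0 then c m else 0)"
        by (simp add: monom_fun_def)
    qed
    also have "\<dots> = F (\<lambda>_. 0)"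
      unfolding K(3)
    proof (intro sum.cong refl)
      fix m assume "m \<in> K"
      show "(if m = 0 then c m else 0) = c m * monom_fun (\<lambda>_. 0) m"
        using mpoly_eval_0[of "Poly_Mapping.single m (1::'k)"]
        by (auto simp: mpoly_eval_single mpoly_const_term_def lookup_single when_def)
    qed
    finally show ?thesis using F0 by simp
  qed
  show ?thesis
  proof (rule less_sigma[OF \<open>rep_on I RR\<close> f_poly _ _ f_v0])
    show "invariant_on I RR f" using f_inv unfolding invariant_on_def act_def by blast
    show "f (\<lambda>_. 0) = 0" using q_pos by (simp add: f_def)
  qed (rule vanish)
qed

end

text \<open>If no \<open>Q\<close>-th power of an eigenvalue had enough distinct powers, all
  eigenvalues would be 0 or roots of a single polynomial, so that only finitely many traces and, by
  irreducibility, only finitely many matrices would occur.\<close>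

lemma less_sigma_of_irreducible:
  fixes G :: "'k::alg_closed_field mat set"
  assumes "linear_group n G" and char: "prime CHAR('k)"
    and R: "linear_group.rep_on n G {..<r} R" and inf: "infinite (rep_mat r R ` G)"
    and transitive: "\<And>x y. x \<in> carrier_vec r \<Longrightarrow> x \<noteq> 0\<^sub>v r \<Longrightarrow> y \<in> carrier_vec r \<Longrightarrow>
      \<exists>A\<in>mat_span r (rep_mat r R ` G). A *\<^sub>v x = y"
  shows "enat d < sigma n G"
proof -
  interpret linear_group n G by fact
  define q where "q = CHAR('k) ^ d"
  define Q where "Q = CHAR('k) ^ r"
  have "d < q" unfolding q_def using prime_gt_1_nat[OF char] by (intro power_gt_expt) simp
  have "r \<le> Q" unfolding Q_def using prime_gt_1_nat[OF char] by (intro less_imp_le power_gt_expt) simp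
  let ?S = "rep_mat r R ` G" and ?D = "d * (q + 1)"
  define diag where "diag g P P' l \<longleftrightarrow> P \<in> carrier_mat r r \<and> P' \<in> carrier_mat r r \<and> P' * P = 1\<^sub>m r \<and>
    mat_trace (rep_mat r R g) = (\<Sum>i<r. l i) \<and>
    rep_mat r R g ^\<^sub>m Q * P = P * mat r r (\<lambda>(i, j). if i = j then l i ^ Q else 0) \<and>
    P' * rep_mat r R g ^\<^sub>m Q = mat r r (\<lambda>(i, j). if i = j then l i ^ Q else 0) * P'" for g P P' l
  have "\<exists>P P' l. diag g P P' l" for g
    unfolding diag_def Q_def using \<open>r \<le> Q\<close>
    by (intro prime_power_diagonalizable[OF char rep_mat_carrier]) (simp add: Q_def)
  then obtain P P' l where "\<And>g. diag g (P g) (P' g) (l g)" by metis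
  then have P: "\<And>g. P g \<in> carrier_mat r r" "\<And>g. P' g \<in> carrier_mat r r" "\<And>g. P' g * P g = 1\<^sub>m r"
    and trace: "\<And>g. mat_trace (rep_mat r R g) = (\<Sum>i<r. l g i)"
    and AP: "\<And>g. rep_mat r R g ^\<^sub>m Q * P g = P g * mat r r (\<lambda>(i, j). if i = j then l g i ^ Q else 0)"
    and P'A: "\<And>g. P' g * rep_mat r R g ^\<^sub>m Q = mat r r (\<lambda>(i, j). if i = j then l g i ^ Q else 0) * P' g"
    unfolding diag_def by blast+
  have "\<exists>g\<in>G. \<exists>i<r. inj_on (\<lambda>k. (l g i ^ Q) ^ k) {..?D}"
  proof (rule ccontr)
    assume none: "\<not> ?thesis"
    \<comment> \<open>A coincidence \<open>L ^ a = L ^ b\<close> with \<open>a < b \<le> ?D\<close>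
      and \<open>L\<close> nonzero gives \<open>L ^ (b - a) = 1\<close>, and \<open>b - a\<close>
      divides \<open>fact ?D\<close>; hence every nonzero eigenvalue is a root of this
      polynomial.\<close>
    define Z where "Z = insert 0 {z::'k. poly (monom 1 (Q * fact ?D) - 1) z = 0}"
    have "monom 1 (Q * fact ?D) - 1 \<noteq> (0 :: 'k poly)"
    proof
      assume "monom 1 (Q * fact ?D) - 1 = (0 :: 'k poly)"
      then have "coeff (monom 1 (Q * fact ?D) - 1 :: 'k poly) 0 = 0" by simp
      moreover have "Q * fact ?D > 0" using prime_gt_0_nat[OF char] by (simp add: Q_def)
      ultimately show False by simp
    qed
    then have "finite Z" unfolding Z_def using poly_roots_finite by blast
    have l_Z: "l g i \<in> Z" if gi: "g \<in> G" "i < r" for g i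
    proof (cases "l g i = 0")
      case True
      then show ?thesis by (simp add: Z_def)
    next
      case False
      define L where "L = l g i ^ Q"
      have "L \<noteq> 0" using False by (simp add: L_def)
      have "\<not> inj_on (\<lambda>k. L ^ k) {..?D}" using none gi by (auto simp: L_def)
      then obtain a' b' where "a' \<le> ?D" "b' \<le> ?D" "L ^ a' = L ^ b'" "a' \<noteq> b'" by (auto simp: inj_on_def)
      then obtain a b where ab: "a < b" "b \<le> ?D" "L ^ a = L ^ b" by (metis linorder_neqE_nat)
      have "L ^ a * L ^ (b - a) = L ^ b" using ab(1) by (simp flip: power_add)
      then have "L ^ a * L ^ (b - a) = L ^ a * 1" using ab(3) by simp
      then have "L ^ (b - a) = 1" using \<open>L \<noteq> 0\<close> by (simp only: mult_cancel_left power_eq_0_iff) auto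
      moreover have "b - a dvd fact ?D" using ab by (intro dvd_fact) auto
      then obtain c where "fact ?D = (b - a) * c" by blast
      ultimately have "L ^ fact ?D = 1" by (simp add: power_mult)
      then show ?thesis by (simp add: Z_def L_def poly_monom power_mult)
    qed
    have "mat_trace ` ?S \<subseteq> (\<lambda>h. \<Sum>i<r. h i) ` (PiE {..<r} (\<lambda>_. Z))"
    proof
      fix t assume "t \<in> mat_trace ` ?S"
      then obtain g where g: "g \<in> G" "t = (\<Sum>i<r. l g i)" by (auto simp: trace)
      show "t \<in> (\<lambda>h. \<Sum>i<r. h i) ` (PiE {..<r} (\<lambda>_. Z))"
        by (rule image_eqI[of _ _ "restrict (l g) {..<r}"]) (use g l_Z in auto)
    qed
    then have "finite (mat_trace ` ?S)"
      by (rule finite_subset) (intro finite_imageI finite_PiE, use \<open>finite Z\<close> in auto)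
    then have "finite ?S"
    proof (rule finite_if_finite_traces[rotated -1])
      show "?S \<subseteq> carrier_mat r r" by (auto simp: rep_mat_carrier)
      show "A * B \<in> ?S" if "A \<in> ?S" "B \<in> ?S" for A B
        using that by (auto simp flip: rep_mat_mult[OF R] intro: G_mult)
      show "1\<^sub>m r \<in> ?S" using G_one rep_mat_one[OF R] by (metis image_eqI)
    qed (rule transitive)
    with inf show False by simp
  qed
  then obtain g i where g: "g \<in> G" and i: "i < r" and inj: "inj_on (\<lambda>k. (l g i ^ Q) ^ k) {..?D}" by blast
  \<comment> \<open>The power \<open>Q\<close> makes \<open>g0\<close> act diagonalizably; column
    \<open>i\<close> of \<open>P g\<close> and row \<open>i\<close> of \<open>P' g\<close> are the
    required eigenvectors, paired to 1 because \<open>P' g\<close> is inverse to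
    \<open>P g\<close>.\<close>
  define g0 where "g0 = g ^\<^sub>m Q"
  have g0: "g0 \<in> G" unfolding g0_def by (rule G_pow[OF g])
  have Rg0: "R g0 a b = (rep_mat r R g ^\<^sub>m Q) $$ (a, b)" if "a < r" "b < r" for a b
    using that by (simp add: g0_def flip: rep_mat_pow[OF R g]) (simp add: rep_mat_def)
  have pow_carrier: "rep_mat r R g ^\<^sub>m Q \<in> carrier_mat r r" by (intro pow_carrier_mat rep_mat_carrier)
  let ?M = "mat r r (\<lambda>(i, j). if i = j then l g i ^ Q else 0)"
  have M: "?M \<in> carrier_mat r r" by simp
  show ?thesis
  proof (rule less_sigma_of_eigenvalue[OF char R g0 _ _ _ q_def \<open>d < q\<close> inj])
    fix a assume a: "a < r"
    have "(\<Sum>b<r. R g0 a b * P g $$ (b, i)) = (rep_mat r R g ^\<^sub>m Q * P g) $$ (a, i)"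
      unfolding mult_mat_index_sum[OF pow_carrier P(1) a i] by (intro sum.cong) (auto simp: Rg0 a)
    also have "\<dots> = (\<Sum>b<r. P g $$ (a, b) * ?M $$ (b, i))"
      unfolding AP by (rule mult_mat_index_sum[OF P(1) M a i])
    also have "\<dots> = (\<Sum>b<r. if b = i then l g i ^ Q * P g $$ (a, i) else 0)"
      using i by (intro sum.cong) auto
    finally show "(\<Sum>b<r. R g0 a b * P g $$ (b, i)) = l g i ^ Q * P g $$ (a, i)" using i by simp
    have "(\<Sum>b<r. P' g $$ (i, b) * R g0 b a) = (P' g * rep_mat r R g ^\<^sub>m Q) $$ (i, a)"
      unfolding mult_mat_index_sum[OF P(2) pow_carrier i a] by (intro sum.cong) (auto simp: Rg0 a)
    also have "\<dots> = (\<Sum>b<r. ?M $$ (i, b) * P' g $$ (b, a))"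
      unfolding P'A by (rule mult_mat_index_sum[OF M P(2) i a])
    also have "\<dots> = (\<Sum>b<r. if b = i then l g i ^ Q * P' g $$ (i, a) else 0)"
      using i by (intro sum.cong) auto
    finally show "(\<Sum>b<r. P' g $$ (i, b) * R g0 b a) = l g i ^ Q * P' g $$ (i, a)" using i by simp
  next
    have "(\<Sum>b<r. P' g $$ (i, b) * P g $$ (b, i)) = (P' g * P g) $$ (i, i)"
      by (rule mult_mat_index_sum[OF P(2,1) i i, symmetric])
    then show "(\<Sum>b<r. P' g $$ (i, b) * P g $$ (b, i)) = 1" using i by (simp add: P(3))
  qed
qed

section \<open>Invariants of large additive groups in characteristic \<open>p\<close>\<close>

lemma prime_inverse_mod:
  assumes "prime (p::nat)" "0 < m" "m < p"
  obtains c t where "c * m = p * t + 1"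
proof -
  have "coprime m p" using assms by (metis coprime_commute nat_dvd_not_less prime_imp_coprime)
  then have "gcd m p = 1" by simp
  moreover obtain x y where "m * x = p * y + gcd m p" using bezout_nat[of m p] assms(2) by auto
  ultimately show ?thesis using that[of x y] by (simp add: mult.commute)
qed

text \<open>Every orbit has 1 or \<open>CHAR('k)\<close> elements. As \<open>\<phi>\<close> is
  constant on orbits, an orbit of the second kind contributes a multiple of the characteristic; the
  induction removes one such orbit at a time.\<close>

lemma sum_fixed_points:
  fixes \<phi> :: "'b \<Rightarrow> 'k::field"
  assumes char: "prime CHAR('k)" and X: "finite X" and \<pi>: "\<And>x. x \<in> X \<Longrightarrow> \<pi> x \<in> X"
    and period: "\<And>x. x \<in> X \<Longrightarrow> (\<pi> ^^ CHAR('k)) x = x"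
    and inv: "\<And>x. x \<in> X \<Longrightarrow> \<phi> (\<pi> x) = \<phi> x"
  shows "sum \<phi> X = sum \<phi> {x \<in> X. \<pi> x = x}"
  using X \<pi> period inv
proof (induction "card X" arbitrary: X rule: less_induct)
  case less
  let ?p = "CHAR('k)"
  show ?case
  proof (cases "\<exists>x\<in>X. \<pi> x \<noteq> x")
    case False
    then show ?thesis by (intro sum.cong) auto
  next
    case True
    then obtain x where x: "x \<in> X" "\<pi> x \<noteq> x" by blast
    have iter: "(\<pi> ^^ i) x \<in> X" for i by (induction i) (auto simp: x less.prems(2))
    have mult: "(\<pi> ^^ (?p * t)) y = y" if "y \<in> X" for t y
      using that by (induction t) (auto simp: funpow_add less.prems(3))
    \<comment> \<open>With \<open>c * m = ?p * t + 1\<close>, iterating \<open>c * m\<close> times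
      fixes \<open>y\<close> but also amounts to a single application of
      \<open>\<pi>\<close>.\<close>
    have fix_imp: "\<pi> y = y" if y: "y \<in> X" "(\<pi> ^^ m) y = y" "0 < m" "m < ?p" for y m
    proof -
      obtain c t where ct: "c * m = ?p * t + 1" using prime_inverse_mod[OF char y(3,4)] .
      have "(\<pi> ^^ (c * m)) y = y" by (induction c) (auto simp: funpow_add y(2))
      moreover have "(\<pi> ^^ (c * m)) y = \<pi> ((\<pi> ^^ (?p * t)) y)" unfolding ct by simp
      ultimately show ?thesis using mult[OF y(1)] by simp
    qed
    have shift: "(\<pi> ^^ i) x = (\<pi> ^^ j) x \<Longrightarrow> i < j \<Longrightarrow> j < ?p \<Longrightarrow> \<pi> x = x" for i j
    proof -
      assume eq: "(\<pi> ^^ i) x = (\<pi> ^^ j) x" and ij: "i < j" "j < ?p"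
      have "(\<pi> ^^ (?p - i)) ((\<pi> ^^ i) x) = x"
        using ij period less.prems(3)[OF x(1)] by (simp flip: funpow_add[THEN fun_cong, unfolded o_apply])
      moreover have "(\<pi> ^^ (?p - i)) ((\<pi> ^^ j) x) = (\<pi> ^^ (j - i)) ((\<pi> ^^ ?p) x)"
      proof -
        have "?p - i + j = (j - i) + ?p" using ij by simp
        then show ?thesis by (metis funpow_add o_apply)
      qed
      ultimately have "(\<pi> ^^ (j - i)) x = x" using eq less.prems(3)[OF x(1)] by simp
      then show "\<pi> x = x" using fix_imp[OF x(1), of "j - i"] ij by simp
    qed
    define Orb where "Orb = (\<lambda>i. (\<pi> ^^ i) x) ` {..<?p}"
    have p0: "0 < ?p" using prime_gt_0_nat[OF char] .
    have inj: "inj_on (\<lambda>i. (\<pi> ^^ i) x) {..<?p}"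
      using shift x(2) by (auto simp: inj_on_def) (metis linorder_neqE_nat)
    have Orb_X: "Orb \<subseteq> X" using iter by (auto simp: Orb_def)
    have x_Orb: "x \<in> Orb" unfolding Orb_def using p0 by (intro image_eqI[of _ _ 0]) auto
    \<comment> \<open>The implication from \<open>\<pi> y\<close> to \<open>y\<close> keeps the
      complement of the orbit stable under \<open>\<pi>\<close>, as the induction requires.\<close>
    have Orb_closed: "\<pi> y \<in> Orb \<longleftrightarrow> y \<in> Orb" if y: "y \<in> X" for y
    proof
      assume "y \<in> Orb"
      then obtain i where i: "i < ?p" "y = (\<pi> ^^ i) x" by (auto simp: Orb_def)
      show "\<pi> y \<in> Orb"
      proof (cases "Suc i = ?p")
        case True
        then have "\<pi> y = x" using i less.prems(3)[OF x(1)] by (metis funpow.simps(2) o_apply)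
        then show ?thesis using x_Orb by simp
      next
        case False
        then show ?thesis using i by (auto simp: Orb_def intro!: image_eqI[of _ _ "Suc i"])
      qed
    next
      assume "\<pi> y \<in> Orb"
      then obtain i where i: "\<pi> y = (\<pi> ^^ i) x" by (auto simp: Orb_def)
      have "y = (\<pi> ^^ (?p - 1)) (\<pi> y)"
        using less.prems(3)[OF y] p0 by (metis Suc_diff_1 funpow_swap1 funpow_Suc_right o_apply)
      also have "\<dots> = (\<pi> ^^ (?p - 1 + i)) x" by (simp add: i funpow_add)
      also have "\<dots> = (\<pi> ^^ ((?p - 1 + i) mod ?p)) x"
      proof -
        have "?p - 1 + i = (?p - 1 + i) mod ?p + ?p * ((?p - 1 + i) div ?p)" by simp
        then show ?thesis by (metis funpow_add o_apply mult[OF x(1)])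
      qed
      finally show "y \<in> Orb" using p0 by (auto simp: Orb_def)
    qed
    have not_fixed: "\<pi> y \<noteq> y" if "y \<in> Orb" for y
    proof
      assume "\<pi> y = y"
      obtain i where i: "i < ?p" "y = (\<pi> ^^ i) x" using \<open>y \<in> Orb\<close> by (auto simp: Orb_def)
      have "x = (\<pi> ^^ (?p - i)) y"
      proof -
        have "?p = ?p - i + i" using i by simp
        then show ?thesis using less.prems(3)[OF x(1)] i(2) by (metis funpow_add o_apply)
      qed
      also have "(\<pi> ^^ k) y = y" for k by (induction k) (auto simp: \<open>\<pi> y = y\<close>)
      finally show False using \<open>\<pi> y = y\<close> x(2) by simp
    qed
    have \<phi>_iter: "\<phi> ((\<pi> ^^ i) x) = \<phi> x" for i by (induction i) (auto simp: less.prems(4) iter)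
    have "sum \<phi> Orb = of_nat ?p * \<phi> x"
      unfolding Orb_def by (subst sum.reindex[OF inj]) (simp add: \<phi>_iter)
    then have Orb_0: "sum \<phi> Orb = 0" by simp
    have "card (X - Orb) < card X"
      using x(1) x_Orb less.prems(1) by (intro psubset_card_mono) auto
    then have "sum \<phi> (X - Orb) = sum \<phi> {y \<in> X - Orb. \<pi> y = y}"
      by (rule less.hyps) (use less.prems Orb_closed in auto)
    also have "{y \<in> X - Orb. \<pi> y = y} = {y \<in> X. \<pi> y = y}" using not_fixed by blast
    finally show ?thesis
      using sum.subset_diff[OF Orb_X less.prems(1), of \<phi>] Orb_0 by simp
  qed
qed

section \<open>Finite additive groups and alternating sums over their subsets\<close>

definition additive_subgroup :: "'k::field set \<Rightarrow> bool" where
  "additive_subgroup H \<longleftrightarrow> 0 \<in> H \<and> (\<forall>a\<in>H. \<forall>b\<in>H. a + b \<in> H)"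

text \<open>Closure under negation is automatic in positive characteristic.\<close>

lemma additive_subgroup_of_nat_mult:
  assumes "additive_subgroup H" "h \<in> H"
  shows "of_nat k * h \<in> H"
  using assms by (induction k) (auto simp: additive_subgroup_def algebra_simps)

lemma additive_subgroup_uminus:
  assumes char: "prime CHAR('k::field)" and "additive_subgroup H" "(h::'k) \<in> H"
  shows "- h \<in> H"
proof -
  have "of_nat (CHAR('k) - 1) * h = - h"
    using prime_gt_0_nat[OF char] by (simp add: of_nat_diff)
  then show ?thesis using additive_subgroup_of_nat_mult[OF assms(2,3)] by metis
qed

lemma additive_subgroup_diff:
  assumes "prime CHAR('k::field)" "additive_subgroup H" "(a::'k) \<in> H" "b \<in> H"
  shows "a - b \<in> H"
  using assms(2,3) additive_subgroup_uminus[OF assms(1,2,4)] unfolding additive_subgroup_def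
  by (metis diff_conv_add_uminus)

text \<open>Translation by an element of \<open>H\<close> acts on the subsets of \<open>H\<close>
  with period \<open>CHAR('k)\<close>. Applying the fixed point principle to one element after
  another leaves only the subsets stable under all of \<open>H\<close>, which are the empty set and
  \<open>H\<close>.\<close>

lemma sum_Pow_translation:
  fixes \<phi> :: "'k::field set \<Rightarrow> 'k"
  assumes char: "prime CHAR('k)" and H: "additive_subgroup H" "finite H"
    and inv: "\<And>h S. h \<in> H \<Longrightarrow> S \<subseteq> H \<Longrightarrow> \<phi> ((+) h ` S) = \<phi> S"
  shows "sum \<phi> (Pow H) = \<phi> {} + \<phi> H"
proof -
  have trans_H: "(+) h ` S \<subseteq> H" if "h \<in> H" "S \<subseteq> H" for h S
    using H that by (auto simp: additive_subgroup_def)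
  have "sum \<phi> (Pow H) = sum \<phi> {S \<in> Pow H. \<forall>t\<in>T. (+) t ` S = S}" if "finite T" "T \<subseteq> H" for T
    using that
  proof (induction T rule: finite_induct)
    case (insert t T)
    let ?X = "{S \<in> Pow H. \<forall>t\<in>T. (+) t ` S = S}"
    have iter: "((`) ((+) t) ^^ k) S = (+) (of_nat k * t) ` S" for k S
      by (induction k) (auto simp: image_image algebra_simps)
    have "sum \<phi> ?X = sum \<phi> {S \<in> ?X. (+) t ` S = S}"
    proof (rule sum_fixed_points[OF char])
      show "finite ?X" using H(2) by simp
      fix S assume S: "S \<in> ?X"
      show "((`) ((+) t) ^^ CHAR('k)) S = S" by (simp add: iter)
      show "\<phi> ((+) t ` S) = \<phi> S" using inv insert.prems S by auto
      have "(+) u ` (+) t ` S = (+) t ` (+) u ` S" for u by (simp add: image_image algebra_simps)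
      then show "(+) t ` S \<in> ?X" using S trans_H[of t S] insert.prems by auto
    qed
    also have "{S \<in> ?X. (+) t ` S = S} = {S \<in> Pow H. \<forall>t\<in>insert t T. (+) t ` S = S}" by auto
    finally show ?case using insert by simp
  qed (simp add: Pow_def)
  from this[OF H(2) order_refl]
  have "sum \<phi> (Pow H) = sum \<phi> {S \<in> Pow H. \<forall>t\<in>H. (+) t ` S = S}" .
  also have "{S \<in> Pow H. \<forall>t\<in>H. (+) t ` S = S} = {{}, H}"
  proof (intro equalityI subsetI)
    fix S assume "S \<in> {S \<in> Pow H. \<forall>t\<in>H. (+) t ` S = S}"
    then have S: "S \<subseteq> H" "\<And>t. t \<in> H \<Longrightarrow> (+) t ` S = S" by auto
    show "S \<in> {{}, H}"
    proof (cases "S = {}")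
      case False
      then obtain s where s: "s \<in> S" by blast
      have "h \<in> S" if "h \<in> H" for h
      proof -
        have "h - s \<in> H" using that s S(1) by (intro additive_subgroup_diff[OF char H(1)]) auto
        from S(2)[OF this] have "h - s + s \<in> S" using s by blast
        then show ?thesis by simp
      qed
      then show ?thesis using S(1) by blast
    qed simp
  next
    fix S assume "S \<in> {{}, H}"
    moreover have "(+) t ` H = H" if t: "t \<in> H" for t
    proof (rule card_subset_eq[OF H(2)])
      show "(+) t ` H \<subseteq> H" by (rule trans_H[OF t order_refl])
      show "card ((+) t ` H) = card H" by (rule card_image) simp
    qed
    ultimately show "S \<in> {S \<in> Pow H. \<forall>t\<in>H. (+) t ` S = S}" by auto
  qed
  also have "sum \<phi> {{}, H} = \<phi> {} + \<phi> H" using H(1) by (subst sum.insert) (auto simp: additive_subgroup_def)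
  finally show ?thesis .
qed

text \<open>Pairing \<open>S\<close> with \<open>insert t S\<close> turns the alternating sum into a
  finite difference, which lowers the number of factors.\<close>

lemma alternating_sum_prod:
  fixes a :: "'j \<Rightarrow> 't \<Rightarrow> 'k::comm_ring_1"
  assumes "finite T" "finite J" "card J < card T"
  shows "(\<Sum>S\<in>Pow T. (-1) ^ card S * (\<Prod>j\<in>J. \<Sum>t\<in>S. a j t)) = 0"
  using assms
proof (induction T arbitrary: J rule: finite_induct)
  case (insert t T)
  define A where "A S j = (\<Sum>u\<in>S. a j u)" for S j
  have fin: "finite S" "t \<notin> S" if "S \<in> Pow T" for S
    using that insert finite_subset by auto
  have "(\<Sum>S\<in>Pow (insert t T). (-1) ^ card S * (\<Prod>j\<in>J. A S j))
      = (\<Sum>S\<in>Pow T. (-1) ^ card S * (\<Prod>j\<in>J. A S j))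
        + (\<Sum>S\<in>insert t ` Pow T. (-1) ^ card S * (\<Prod>j\<in>J. A S j))"
    unfolding Pow_insert using insert by (intro sum.union_disjoint) auto
  also have "(\<Sum>S\<in>insert t ` Pow T. (-1) ^ card S * (\<Prod>j\<in>J. A S j))
      = (\<Sum>S\<in>Pow T. - ((-1) ^ card S * (\<Prod>j\<in>J. A S j + a j t)))"
  proof (subst sum.reindex)
    show "inj_on (insert t) (Pow T)" using insert(2) by (auto simp: inj_on_def)
    show "sum ((\<lambda>S. (-1) ^ card S * (\<Prod>j\<in>J. A S j)) \<circ> insert t) (Pow T)
        = (\<Sum>S\<in>Pow T. - ((-1) ^ card S * (\<Prod>j\<in>J. A S j + a j t)))"
      using fin by (intro sum.cong) (auto simp: A_def add.commute)
  qed
  also have "\<dots> = - (\<Sum>S\<in>Pow T. (-1) ^ card S * (\<Prod>j\<in>J. A S j))"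
  proof -
    have "(\<Sum>S\<in>Pow T. (-1) ^ card S * (\<Prod>j\<in>J. A S j + a j t))
        = (\<Sum>S\<in>Pow T. \<Sum>K\<in>Pow J. (\<Prod>j\<in>J - K. a j t) * ((-1) ^ card S * (\<Prod>j\<in>K. A S j)))"
      by (intro sum.cong refl) (simp add: prod_add[OF insert.prems(1)] sum_distrib_left mult_ac)
    also have "\<dots> = (\<Sum>K\<in>Pow J. (\<Prod>j\<in>J - K. a j t) * (\<Sum>S\<in>Pow T. (-1) ^ card S * (\<Prod>j\<in>K. A S j)))"
      by (subst sum.swap) (simp add: sum_distrib_left)
    \<comment> \<open>A proper subset \<open>K\<close> of \<open>J\<close> has fewer elements than
      \<open>T\<close>, so its term vanishes by the induction hypothesis; the remaining term for
      \<open>J\<close> cancels the sum over the subsets without \<open>t\<close>.\<close>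
    also have "\<dots> = (\<Sum>K\<in>{J}. (\<Prod>j\<in>J - K. a j t) * (\<Sum>S\<in>Pow T. (-1) ^ card S * (\<Prod>j\<in>K. A S j)))"
    proof (rule sum.mono_neutral_right)
      show "\<forall>K\<in>Pow J - {J}. (\<Prod>j\<in>J - K. a j t) * (\<Sum>S\<in>Pow T. (-1) ^ card S * (\<Prod>j\<in>K. A S j)) = 0"
      proof
        fix K assume "K \<in> Pow J - {J}"
        then have K: "K \<subset> J" by auto
        have "card K < card T"
          using psubset_card_mono[OF insert.prems(1) K] insert by simp
        then have "(\<Sum>S\<in>Pow T. (-1) ^ card S * (\<Prod>j\<in>K. A S j)) = 0"
          unfolding A_def using K finite_subset[OF _ insert.prems(1)] by (intro insert.IH) auto
        then show "(\<Prod>j\<in>J - K. a j t) * (\<Sum>S\<in>Pow T. (-1) ^ card S * (\<Prod>j\<in>K. A S j)) = 0" by simp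
      qed
    qed (use insert.prems(1) in auto)
    finally show ?thesis by (simp add: sum_negf)
  qed
  finally show ?case by (simp add: A_def)
qed simp

text \<open>A monomial is a product of coordinate functions, one for each occurrence of a variable;
  the number of these factors is its degree, less than \<open>card T\<close>.\<close>

lemma alternating_sum_polynomial_fun:
  assumes "polynomial_fun I d F" "finite T" "d < card T"
  shows "(\<Sum>S\<in>Pow T. (-1) ^ card S * F (\<lambda>i. \<Sum>t\<in>S. w t i)) = 0"
proof -
  obtain K c where K: "\<And>m. m \<in> K \<Longrightarrow> monom_deg m \<le> d" "\<And>v. F v = (\<Sum>m\<in>K. c m * monom_fun v m)"
    using polynomial_funE[OF assms(1)] by metis
  have *: "(\<Sum>S\<in>Pow T. (-1) ^ card S * monom_fun (\<lambda>i. \<Sum>t\<in>S. w t i) m) = 0" if "m \<in> K" for m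
  proof -
    define J where "J = (SIGMA x:Poly_Mapping.keys m. {..<Poly_Mapping.lookup m x})"
    have "monom_fun v m = (\<Prod>j\<in>J. v (fst j))" for v :: "'a \<Rightarrow> 'b"
    proof -
      have "(\<Prod>j\<in>J. v (fst j)) = (\<Prod>(x, k)\<in>J. v x)" by (simp add: case_prod_unfold)
      also have "\<dots> = (\<Prod>x\<in>Poly_Mapping.keys m. \<Prod>k<Poly_Mapping.lookup m x. v x)"
        unfolding J_def by (rule prod.Sigma[symmetric]) auto
      finally show ?thesis by (simp add: monom_fun_def)
    qed
    moreover have "finite J" "card J = monom_deg m" by (auto simp: J_def monom_deg_def)
    ultimately show ?thesis
      using alternating_sum_prod[OF assms(2), of J "\<lambda>j t. w t (fst j)"] K(1)[OF that] assms(3) by simp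
  qed
  have "(\<Sum>S\<in>Pow T. (-1) ^ card S * F (\<lambda>i. \<Sum>t\<in>S. w t i))
      = (\<Sum>m\<in>K. c m * (\<Sum>S\<in>Pow T. (-1) ^ card S * monom_fun (\<lambda>i. \<Sum>t\<in>S. w t i) m))"
    unfolding K(2) sum_distrib_left by (subst sum.swap) (simp add: mult_ac)
  then show ?thesis by (simp add: *)
qed

text \<open>The alternating sum over all subsets of \<open>H\<close> vanishes by degree reasons, while only the two
  translation invariant subsets contribute to it modulo \<open>p\<close>.\<close>

lemma invariant_vanishes_on_trace:
  fixes F :: "('i \<Rightarrow> 'k::field) \<Rightarrow> 'k" and H :: "'k set"
  assumes char: "prime CHAR('k)" and H: "additive_subgroup H" "finite H"
    and F: "polynomial_fun I d F" "d < card H" "F (\<lambda>_. 0) = 0"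
    and inv: "\<And>h S. h \<in> H \<Longrightarrow> S \<subseteq> H \<Longrightarrow> F (\<lambda>i. \<Sum>t\<in>S. w (h + t) i) = F (\<lambda>i. \<Sum>t\<in>S. w t i)"
  shows "F (\<lambda>i. \<Sum>t\<in>H. w t i) = 0"
proof -
  define \<phi> where "\<phi> S = (-1) ^ card S * F (\<lambda>i. \<Sum>t\<in>S. w t i)" for S
  have "\<phi> ((+) h ` S) = \<phi> S" if "h \<in> H" "S \<subseteq> H" for h S
    using inv[OF that] by (simp add: \<phi>_def card_image sum.reindex)
  then have "sum \<phi> (Pow H) = \<phi> {} + \<phi> H" by (rule sum_Pow_translation[OF char H])
  moreover have "sum \<phi> (Pow H) = 0"
    unfolding \<phi>_def by (rule alternating_sum_polynomial_fun[OF F(1) H(2) F(2)])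
  ultimately show ?thesis using F(3) by (simp add: \<phi>_def)
qed

text \<open>Starting from \<open>{0}\<close>, adjoin an element \<open>b\<close> of \<open>B\<close>
  outside \<open>H\<close>, which exists since \<open>B\<close> is infinite. The multiples
  \<open>k * b\<close> with \<open>k < CHAR('k)\<close> lie in distinct cosets of \<open>H\<close>,
  so the order is multiplied by the characteristic.\<close>

lemma finite_additive_subgroup_exists:
  assumes char: "prime CHAR('k::field)" and B: "additive_subgroup (B::'k set)" "infinite B"
  shows "\<exists>H\<subseteq>B. additive_subgroup H \<and> finite H \<and> card H = CHAR('k) ^ s"
proof (induction s)
  case 0
  then show ?case using B(1) by (intro exI[of _ "{0}"]) (auto simp: additive_subgroup_def)
next
  case (Suc s)
  let ?p = "CHAR('k)"
  obtain H where H: "H \<subseteq> B" "additive_subgroup H" "finite H" "card H = ?p ^ s" using Suc by blast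
  obtain b where b: "b \<in> B" "b \<notin> H" using B(2) H(1,3) by (metis finite_subset subsetI)
  define f where "f x = of_nat (fst x) * b + snd x" for x :: "nat \<times> 'k"
  define H' where "H' = f ` ({..<?p} \<times> H)"
  have p0: "?p > 0" using prime_gt_0_nat[OF char] .
  have memI: "of_nat k * b + h \<in> H'" if "h \<in> H" for k h
  proof -
    have "of_nat k = (of_nat (?p * (k div ?p) + k mod ?p) :: 'k)" by simp
    also have "\<dots> = of_nat (k mod ?p)" by (simp only: of_nat_add of_nat_mult of_nat_CHAR mult_zero_left add_0)
    finally show ?thesis
      using that p0 unfolding H'_def by (intro image_eqI[of _ _ "(k mod ?p, h)"]) (auto simp: f_def)
  qed
  have "additive_subgroup H'"
    unfolding additive_subgroup_def
  proof (intro conjI ballI)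
    show "0 \<in> H'" using memI[of 0 0] H(2) by (simp add: additive_subgroup_def)
    fix x y assume "x \<in> H'" "y \<in> H'"
    from \<open>x \<in> H'\<close> obtain i h where i: "h \<in> H" "x = of_nat i * b + h"
      unfolding H'_def f_def by fastforce
    from \<open>y \<in> H'\<close> obtain j h' where j: "h' \<in> H" "y = of_nat j * b + h'"
      unfolding H'_def f_def by fastforce
    have "x + y = of_nat (i + j) * b + (h + h')" by (simp add: i j algebra_simps)
    moreover have "h + h' \<in> H" using i(1) j(1) H(2) by (simp add: additive_subgroup_def)
    ultimately show "x + y \<in> H'" by (simp only: memI)
  qed
  moreover have "H' \<subseteq> B"
    using additive_subgroup_of_nat_mult[OF B(1) b(1)] H(1) B(1)
    by (auto simp: H'_def f_def additive_subgroup_def)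
  moreover have "finite H'" using H(3) by (simp add: H'_def)
  moreover have "inj_on f ({..<?p} \<times> H)"
  proof -
    \<comment> \<open>A coincidence puts \<open>(j - i) * b\<close> into \<open>H\<close>;
      multiplying by an inverse of \<open>j - i\<close> modulo the characteristic puts
      \<open>b\<close> itself into \<open>H\<close>.\<close>
    have False if ij: "i < j" "j < ?p" and hh: "h \<in> H" "h' \<in> H" and eq: "of_nat i * b + h = of_nat j * b + h'"
      for i j h h'
    proof -
      have "of_nat (j - i) * b = h - h'"
        using ij eq by (simp add: of_nat_diff algebra_simps)
      then have "of_nat (j - i) * b \<in> H" using hh by (simp add: additive_subgroup_diff[OF char H(2)])
      moreover have "0 < j - i" "j - i < ?p" using ij by auto
      then obtain c t where ct: "c * (j - i) = ?p * t + 1" using prime_inverse_mod[OF char] by metis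
      ultimately have "of_nat c * (of_nat (j - i) * b) \<in> H"
        using additive_subgroup_of_nat_mult[OF H(2)] by blast
      moreover have "of_nat c * (of_nat (j - i) * b) = of_nat (c * (j - i)) * b"
        by (simp only: of_nat_mult mult.assoc)
      moreover have "of_nat (c * (j - i)) = (1 :: 'k)"
        unfolding ct by (simp only: of_nat_add of_nat_mult of_nat_CHAR mult_zero_left of_nat_1 add_0)
      ultimately show False using b(2) by simp
    qed
    then show ?thesis
      by (auto simp: inj_on_def f_def) (metis add_left_cancel linorder_neqE_nat)+
  qed
  then have "card H' = ?p ^ Suc s" by (simp add: H'_def card_image card_cartesian_product H(4))
  ultimately show ?case by blast
qed

text \<open>The matrix of the translation \<open>f(x) \<mapsto> f(x + t)\<close> on polynomials of degree less than \<open>q\<close>.\<close>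

definition transl :: "nat \<Rightarrow> 'k::field \<Rightarrow> 'k mat" where
  "transl q t = mat q q (\<lambda>(i, j). of_nat (j choose i) * t ^ (j - i))"

lemma transl_carrier: "transl q t \<in> carrier_mat q q"
  by (simp add: transl_def)

text \<open>In coordinates this is the binomial theorem, after rewriting
  \<open>(k choose j) * (j choose i)\<close> as
  \<open>(k choose i) * ((k - i) choose (j - i))\<close>.\<close>

lemma transl_add: "transl q s * transl q t = transl q (s + t)"
proof (rule eq_matI)
  fix i k assume "i < dim_row (transl q (s + t))" "k < dim_col (transl q (s + t))"
  then have ik: "i < q" "k < q" by (simp_all add: transl_def)
  have "(transl q s * transl q t) $$ (i, k)
      = (\<Sum>j<q. (of_nat (j choose i) * s ^ (j - i)) * (of_nat (k choose j) * t ^ (k - j)))"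
    unfolding mult_mat_index_sum[OF transl_carrier transl_carrier ik]
    using ik by (intro sum.cong) (auto simp: transl_def)
  also have "\<dots> = of_nat (k choose i) * (s + t) ^ (k - i)"
  proof (cases "i \<le> k")
    case False
    then have "(of_nat (j choose i) * s ^ (j - i)) * (of_nat (k choose j) * t ^ (k - j)) = 0" for j
      by (cases "j < i") (auto simp: binomial_eq_0)
    then show ?thesis using False by (simp add: binomial_eq_0)
  next
    case True
    have "(\<Sum>j<q. (of_nat (j choose i) * s ^ (j - i)) * (of_nat (k choose j) * t ^ (k - j)))
        = (\<Sum>j\<in>{i..k}. (of_nat (j choose i) * s ^ (j - i)) * (of_nat (k choose j) * t ^ (k - j)))"
      using ik by (intro sum.mono_neutral_right) (auto simp: binomial_eq_0)
    also have "\<dots> = (\<Sum>l\<in>{0..k - i}. (of_nat ((l + i) choose i) * s ^ l) * (of_nat (k choose (l + i)) * t ^ (k - i - l)))"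
      using True by (intro sum.reindex_bij_witness[of _ "\<lambda>l. l + i" "\<lambda>j. j - i"]) auto
    also have "\<dots> = (\<Sum>l\<in>{0..k - i}. of_nat (k choose i) * (of_nat ((k - i) choose l) * s ^ l * t ^ (k - i - l)))"
    proof (intro sum.cong refl)
      fix l assume "l \<in> {0..k - i}"
      then have "(k choose (l + i)) * ((l + i) choose i) = (k choose i) * ((k - i) choose l)"
        using choose_mult[of i "l + i" k] True by simp
      then have "of_nat (k choose (l + i)) * of_nat ((l + i) choose i)
          = (of_nat (k choose i) * of_nat ((k - i) choose l) :: 'a)"
        by (metis of_nat_mult)
      then show "(of_nat ((l + i) choose i) * s ^ l) * (of_nat (k choose (l + i)) * t ^ (k - i - l))
          = of_nat (k choose i) * (of_nat ((k - i) choose l) * s ^ l * t ^ (k - i - l))"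
        by (simp add: mult_ac)
    qed
    finally show ?thesis by (simp add: sum_distrib_left binomial_ring atMost_atLeast0)
  qed
  finally show "(transl q s * transl q t) $$ (i, k) = transl q (s + t) $$ (i, k)"
    using ik by (simp add: transl_def)
qed (simp_all add: transl_def)

lemma transl_add_index:
  assumes "i < q" "k < q"
  shows "(\<Sum>j<q. transl q s $$ (i, j) * transl q t $$ (j, k)) = transl q (s + t) $$ (i, k)"
  using mult_mat_index_sum[OF transl_carrier transl_carrier assms, of s t] by (simp add: transl_add)

lemma transl_0: "transl q 0 = 1\<^sub>m q"
proof (rule eq_matI)
  fix i j assume "i < dim_row (1\<^sub>m q :: 'a mat)" "j < dim_col (1\<^sub>m q :: 'a mat)"
  then show "transl q 0 $$ (i, j) = (1\<^sub>m q :: 'a mat) $$ (i, j)"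
    by (cases i j rule: linorder_cases) (auto simp: transl_def binomial_eq_0)
qed (simp_all add: transl_def)

text \<open>Pascal's rule and the vanishing of \<open>q choose Suc i\<close> flip the sign at each
  step. These coefficients are therefore invertible, on which the dual basis below relies.\<close>

lemma of_nat_prime_power_minus_1_choose:
  assumes "prime CHAR('k::field)" "q = CHAR('k) ^ s" "i < q"
  shows "of_nat ((q - 1) choose i) = ((-1) ^ i :: 'k)"
  using assms(3)
proof (induction i)
  case (Suc i)
  have "q = Suc (q - 1)" using Suc.prems by simp
  then have "q choose Suc i = ((q - 1) choose i) + ((q - 1) choose Suc i)"
    by (metis binomial_Suc_Suc)
  moreover have "of_nat (q choose Suc i) = (0::'k)"
    unfolding assms(2) by (rule of_nat_choose_prime_power[OF assms(1)]) (use Suc.prems assms(2) in auto)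
  ultimately have "of_nat ((q - 1) choose Suc i) = - (of_nat ((q - 1) choose i) :: 'k)"
    by (simp add: eq_neg_iff_add_eq_0 add.commute)
  then show ?case using Suc by simp
qed simp

text \<open>The translates of \<open>x ^ (q - 1)\<close> by a group of order \<open>q\<close> form a basis; \<open>\<beta>\<close> is this basis and
  \<open>\<gamma>\<close> its dual basis, so that the identity is a sum of conjugates of a single rank one matrix.\<close>

lemma identity_is_trace:
  fixes H :: "'k::field set"
  assumes char: "prime CHAR('k)" and H: "additive_subgroup H" "finite H" "card H = q" "q = CHAR('k) ^ s"
  shows "\<exists>\<beta> \<gamma> :: 'k \<Rightarrow> nat \<Rightarrow> 'k.
    (\<forall>h t. \<forall>i<q. (\<Sum>j<q. transl q h $$ (i, j) * \<beta> t j) = \<beta> (h + t) i) \<and>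
    (\<forall>h t. \<forall>j<q. (\<Sum>i<q. \<gamma> t i * transl q (- h) $$ (i, j)) = \<gamma> (h + t) j) \<and>
    (\<forall>i<q. \<forall>j<q. (\<Sum>t\<in>H. \<beta> t i * \<gamma> t j) = (if i = j then 1 else 0))"
proof -
  have q: "q > 0" using H(4) prime_gt_0_nat[OF char] by simp
  \<comment> \<open>The interpolation polynomial on \<open>H\<close> with value 1 at 0 and value 0
    elsewhere; its degree is at most \<open>q - 1\<close>.\<close>
  define L where "L = (\<Prod>h\<in>H - {0}. [:1, - inverse h:])"
  have "degree L \<le> (\<Sum>h\<in>H - {0}. 1)"
    unfolding L_def by (rule order_trans[OF degree_prod_sum_le]) (use H(2) in \<open>auto intro!: sum_mono\<close>)
  then have deg_L: "degree L \<le> q - 1"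
    using H by (simp add: additive_subgroup_def card_Diff_singleton)
  have poly_L: "poly L h = (if h = 0 then 1 else 0)" if "h \<in> H" for h
    using that H(2) by (auto simp: L_def poly_prod intro!: bexI[of _ h])
  \<comment> \<open>The linear functional on polynomials of degree less than \<open>q\<close> whose
    value at \<open>(x + h) ^ (q - 1)\<close> is \<open>poly L h\<close>. In terms of coefficients
    \<open>\<beta> t\<close> is the polynomial \<open>(x + t) ^ (q - 1)\<close>, and
    \<open>\<gamma> t\<close> is \<open>\<psi>\<close> preceded by the translation by
    \<open>- t\<close>.\<close>
  define \<psi> where "\<psi> i = coeff L (q - 1 - i) * inverse (of_nat ((q - 1) choose i))" for i
  define \<beta> where "\<beta> t i = transl q t $$ (i, q - 1)" for t :: 'k and i
  define \<gamma> where "\<gamma> t j = (\<Sum>k<q. \<psi> k * transl q (- t) $$ (k, j))" for t :: 'k and j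
  have 1: "(\<Sum>j<q. transl q h $$ (i, j) * \<beta> t j) = \<beta> (h + t) i" if "i < q" for h t i
    unfolding \<beta>_def by (rule transl_add_index) (use that q in auto)
  have \<gamma>_mult: "(\<Sum>i<q. \<gamma> t i * transl q u $$ (i, j)) = (\<Sum>k<q. \<psi> k * transl q (u - t) $$ (k, j))" if j: "j < q" for t u j
  proof -
    have "(\<Sum>i<q. \<gamma> t i * transl q u $$ (i, j)) = (\<Sum>i<q. \<Sum>k<q. \<psi> k * transl q (- t) $$ (k, i) * transl q u $$ (i, j))"
      by (simp add: \<gamma>_def sum_distrib_right)
    also have "\<dots> = (\<Sum>k<q. \<Sum>i<q. \<psi> k * transl q (- t) $$ (k, i) * transl q u $$ (i, j))" by (rule sum.swap)
    also have "\<dots> = (\<Sum>k<q. \<psi> k * (\<Sum>i<q. transl q (- t) $$ (k, i) * transl q u $$ (i, j)))"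
      by (simp add: sum_distrib_left mult.assoc)
    also have "\<dots> = (\<Sum>k<q. \<psi> k * transl q (- t + u) $$ (k, j))"
      using j by (intro sum.cong refl) (simp add: transl_add_index)
    finally show ?thesis by simp
  qed
  have 2: "(\<Sum>i<q. \<gamma> t i * transl q (- h) $$ (i, j)) = \<gamma> (h + t) j" if "j < q" for h t j
    using \<gamma>_mult[OF that, of t "- h"] by (simp add: \<gamma>_def[of "h + t"])
  have \<psi>_transl: "(\<Sum>k<q. \<psi> k * transl q h $$ (k, q - 1)) = poly L h" for h
  proof -
    have "(\<Sum>k<q. \<psi> k * transl q h $$ (k, q - 1)) = (\<Sum>k<q. coeff L (q - 1 - k) * h ^ (q - 1 - k))"
    proof (intro sum.cong refl)
      fix k assume "k \<in> {..<q}"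
      then have "of_nat ((q - 1) choose k) = ((-1) ^ k :: 'k)"
        using of_nat_prime_power_minus_1_choose[OF char H(4)] by simp
      then have "of_nat ((q - 1) choose k) \<noteq> (0 :: 'k)" by simp
      then show "\<psi> k * transl q h $$ (k, q - 1) = coeff L (q - 1 - k) * h ^ (q - 1 - k)"
        using \<open>k \<in> {..<q}\<close> q by (simp add: \<psi>_def transl_def)
    qed
    also have "\<dots> = (\<Sum>k<q. coeff L k * h ^ k)"
      by (rule sum.reindex_bij_witness[of _ "\<lambda>k. q - 1 - k" "\<lambda>k. q - 1 - k"]) auto
    also have "\<dots> = (\<Sum>k\<le>q - 1. coeff L k * h ^ k)"
      using q by (intro sum.cong) auto
    also have "\<dots> = poly L h"
      unfolding poly_altdef using deg_L by (intro sum.mono_neutral_right) (auto simp: coeff_eq_0)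
    finally show ?thesis .
  qed
  obtain e where e: "bij_betw e {..<q} H"
    using ex_bij_betw_nat_finite[OF H(2)] by (auto simp: H(3) lessThan_atLeast0)
  define C where "C = mat q q (\<lambda>(a, j). \<gamma> (e a) j)"
  define B where "B = mat q q (\<lambda>(i, a). \<beta> (e a) i)"
  have BC: "B \<in> carrier_mat q q" "C \<in> carrier_mat q q" by (simp_all add: B_def C_def)
  \<comment> \<open>The functional \<open>\<gamma> s\<close> takes the value
    \<open>poly L (t - s)\<close> at \<open>\<beta> t\<close>, so the two families are dual over
    \<open>H\<close>. Passing from \<open>C * B\<close> to \<open>B * C\<close> turns duality into
    the required sum over \<open>H\<close>.\<close>
  have "C * B = 1\<^sub>m q"
  proof (rule eq_matI)
    fix a b assume "a < dim_row (1\<^sub>m q :: 'k mat)" "b < dim_col (1\<^sub>m q :: 'k mat)"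
    then have ab: "a < q" "b < q" by auto
    have eH: "e a \<in> H" "e b \<in> H" using e ab by (auto dest: bij_betwE)
    have "(C * B) $$ (a, b) = (\<Sum>i<q. \<gamma> (e a) i * transl q (e b) $$ (i, q - 1))"
      unfolding mult_mat_index_sum[OF BC(2,1) ab]
      using ab by (intro sum.cong) (auto simp: B_def C_def \<beta>_def)
    also have "\<dots> = poly L (e b - e a)" unfolding \<psi>_transl[symmetric] using q by (intro \<gamma>_mult) simp
    also have "\<dots> = (if e b - e a = 0 then 1 else 0)"
      by (rule poly_L) (rule additive_subgroup_diff[OF char H(1) eH(2,1)])
    also have "\<dots> = (if a = b then 1 else 0)"
      using e ab by (auto simp: bij_betw_def inj_on_def)
    finally show "(C * B) $$ (a, b) = 1\<^sub>m q $$ (a, b)" using ab by simp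
  qed (use BC in auto)
  then have "B * C = 1\<^sub>m q" by (rule mat_mult_left_right_inverse[OF BC(2,1)])
  then have 3: "(\<Sum>t\<in>H. \<beta> t i * \<gamma> t j) = (if i = j then 1 else 0)" if ij: "i < q" "j < q" for i j
  proof -
    have "(\<Sum>t\<in>H. \<beta> t i * \<gamma> t j) = (\<Sum>a<q. \<beta> (e a) i * \<gamma> (e a) j)"
      by (rule sum.reindex_bij_betw[OF e, symmetric])
    also have "\<dots> = (B * C) $$ (i, j)"
      unfolding mult_mat_index_sum[OF BC ij] using ij by (intro sum.cong) (auto simp: B_def C_def)
    finally show ?thesis using ij by (simp add: \<open>B * C = 1\<^sub>m q\<close>)
  qed
  show ?thesis by (intro exI[of _ \<beta>] exI[of _ \<gamma>] conjI allI impI 1 2 3)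
qed

lemma det_transl: "det (transl q t) * det (transl q (- t)) = 1"
  using det_mult[OF transl_carrier[of q t] transl_carrier[of q "- t"]] by (simp add: transl_add transl_0)

section \<open>Modules induced from a subgroup with an additive character\<close>

context linear_group
begin

text \<open>The module is induced from the subgroup \<open>M\<close>; it consists of families of \<open>q \<times> q\<close> matrices
  indexed by coset representatives, and \<open>M\<close> conjugates the matrix of its own coset by translations.\<close>

lemma less_sigma_of_additive_character:
  fixes \<chi> :: "'k mat \<Rightarrow> 'k"
  assumes char: "prime CHAR('k)"
    and M: "M \<subseteq> G" "1\<^sub>m n \<in> M" "\<And>g h. g \<in> M \<Longrightarrow> h \<in> M \<Longrightarrow> g * h \<in> M" "\<And>g. g \<in> M \<Longrightarrow> ginv g \<in> M"
    and M_reg: "regular (\<lambda>g. if g \<in> M then 1 else 0)"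
    and \<kappa>: "finite (\<kappa> ` G)" "\<And>g h. g \<in> G \<Longrightarrow> h \<in> G \<Longrightarrow> \<kappa> g = \<kappa> h \<Longrightarrow> ginv g * h \<in> M"
    and \<chi>: "regular \<chi>" "\<And>g h. g \<in> M \<Longrightarrow> h \<in> M \<Longrightarrow> \<chi> (g * h) = \<chi> g + \<chi> h" "infinite (\<chi> ` M)"
  shows "enat d < sigma n G"
proof -
  have MG: "g \<in> G" if "g \<in> M" for g using that M(1) by blast
  define coset_eq where "coset_eq g h \<longleftrightarrow> ginv g * h \<in> M" for g h
  have coset_refl: "coset_eq g g" if "g \<in> G" for g using that M(2) by (simp add: coset_eq_def G_inv_left)
  have coset_sym: "coset_eq h g" if gh: "g \<in> G" "h \<in> G" "coset_eq g h" for g h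
  proof -
    have "ginv (ginv g * h) = ginv h * g" using gh by (simp add: G_inv_mult G_inv G_inv_inv)
    then show ?thesis using M(4)[of "ginv g * h"] gh by (simp add: coset_eq_def)
  qed
  have coset_trans: "coset_eq g k" if ghk: "g \<in> G" "h \<in> G" "k \<in> G" "coset_eq g h" "coset_eq h k" for g h k
  proof -
    have "ginv g * h * (ginv h * k) = ginv g * k"
      using ghk by (simp add: G_assoc G_inv G_mult G_cancel)
    then show ?thesis using M(3) ghk unfolding coset_eq_def by metis
  qed
  \<comment> \<open>Representatives of the cosets \<open>g M\<close>; equivalent elements give the
    same predicate under \<open>SOME\<close> and so the same representative.\<close>
  define rp where "rp g = (SOME h. h \<in> G \<and> coset_eq g h)" for g
  have rp: "rp g \<in> G" "coset_eq g (rp g)" if "g \<in> G" for g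
    using someI[of "\<lambda>h. h \<in> G \<and> coset_eq g h" g] coset_refl[OF that] that by (auto simp: rp_def)
  have rp_eq: "rp g = rp h" if "g \<in> G" "h \<in> G" "coset_eq g h" for g h
  proof -
    have "(\<lambda>k. k \<in> G \<and> coset_eq g k) = (\<lambda>k. k \<in> G \<and> coset_eq h k)"
      using that coset_sym coset_trans by blast
    then show ?thesis by (simp add: rp_def)
  qed
  define T where "T = rp ` G"
  have T_G: "k \<in> G" if "k \<in> T" for k using that rp by (auto simp: T_def)
  have rp_T: "rp k = k" if "k \<in> T" for k
    using that rp rp_eq by (auto simp: T_def) (metis rp(1,2) rp_eq)
  have rp_in_T: "rp g \<in> T" if "g \<in> G" for g using that by (simp add: T_def)
  have "finite T"
  proof (rule finite_surj[OF \<kappa>(1)])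
    show "T \<subseteq> (\<lambda>c. rp (SOME g. g \<in> G \<and> \<kappa> g = c)) ` \<kappa> ` G"
    proof
      fix k assume "k \<in> T"
      then obtain g where g: "g \<in> G" "k = rp g" by (auto simp: T_def)
      define g' where "g' = (SOME g'. g' \<in> G \<and> \<kappa> g' = \<kappa> g)"
      have "g' \<in> G" "\<kappa> g' = \<kappa> g" using someI[of "\<lambda>g'. g' \<in> G \<and> \<kappa> g' = \<kappa> g" g] g by (auto simp: g'_def)
      then have "rp g' = rp g" using g(1) by (intro rp_eq) (auto simp: coset_eq_def \<kappa>(2))
      then show "k \<in> (\<lambda>c. rp (SOME g. g \<in> G \<and> \<kappa> g = c)) ` \<kappa> ` G"
        using g by (intro image_eqI[of _ _ "\<kappa> g"]) (auto simp: g'_def)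
    qed
  qed
  \<comment> \<open>The coset of \<open>ginv g * k\<close> has the representative
    \<open>nx g k\<close>, so \<open>ginv k * g * nx g k\<close> lies in \<open>M\<close>. Applying
    \<open>\<chi>\<close> to it yields an additive cocycle \<open>c\<close>, from which the induced
    module is built.\<close>
  define nx where "nx g k = rp (ginv g * k)" for g k
  define c where "c g k = \<chi> (ginv k * g * nx g k)" for g k
  have nx_T: "nx g k \<in> T" if "g \<in> G" "k \<in> T" for g k
    using that T_G by (auto simp: nx_def intro!: rp_in_T G_mult G_inv)
  have st_M: "ginv k * g * nx g k \<in> M" if gk: "g \<in> G" "k \<in> T" for g k
  proof -
    note k = T_G[OF gk(2)]
    have "ginv (ginv g * k) = ginv k * g" using gk k by (simp add: G_inv_mult G_inv G_inv_inv)
    then show ?thesis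
      using rp(2)[of "ginv g * k"] gk k by (simp add: coset_eq_def nx_def G_mult G_inv)
  qed
  have nx_iff: "nx g k = k' \<longleftrightarrow> ginv k * g * k' \<in> M" if gk: "g \<in> G" "k \<in> T" "k' \<in> T" for g k k'
  proof
    assume "nx g k = k'"
    then show "ginv k * g * k' \<in> M" using st_M[OF gk(1,2)] by simp
  next
    note k = T_G[OF gk(2)] T_G[OF gk(3)]
    assume "ginv k * g * k' \<in> M"
    moreover have "ginv (ginv g * k) = ginv k * g" using gk k by (simp add: G_inv_mult G_inv G_inv_inv)
    ultimately have "coset_eq (ginv g * k) k'" by (simp add: coset_eq_def)
    then have "rp (ginv g * k) = rp k'" using gk k by (intro rp_eq G_mult G_inv)
    then show "nx g k = k'" using rp_T[OF gk(3)] by (simp add: nx_def)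
  qed
  have nx_mult: "nx (g * h) k = nx h (nx g k)" and c_mult: "c (g * h) k = c g k + c h (nx g k)"
    if gh: "g \<in> G" "h \<in> G" "k \<in> T" for g h k
  proof -
    let ?a = "nx g k" and ?b = "nx h (nx g k)"
    have T: "?a \<in> T" "?b \<in> T" using gh nx_T by auto
    note k = T_G[OF gh(3)] T_G[OF T(1)] T_G[OF T(2)]
    note M_ab = st_M[OF gh(1,3)] st_M[OF gh(2) T(1)]
    have eq: "ginv k * g * ?a * (ginv ?a * h * ?b) = ginv k * (g * h) * ?b"
      using gh k by (simp add: G_assoc G_inv G_mult G_cancel)
    then have "ginv k * (g * h) * ?b \<in> M" using M(3)[OF M_ab] by simp
    then show nx: "nx (g * h) k = ?b" using nx_iff[OF G_mult[OF gh(1,2)] gh(3) T(2)] by simp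
    show "c (g * h) k = c g k + c h ?a" using \<chi>(2)[OF M_ab] eq by (simp add: c_def nx)
  qed
  have "\<chi> (1\<^sub>m n) + \<chi> (1\<^sub>m n) = \<chi> (1\<^sub>m n) + 0"
    using \<chi>(2)[OF M(2,2)] by (simp only: G_mult_one[OF G_one] add_0_right)
  then have \<chi>_one: "\<chi> (1\<^sub>m n) = 0" by (simp only: add_left_cancel)
  have nx_one: "nx (1\<^sub>m n) k = k" if "k \<in> T" for k
    using that T_G[OF that] by (simp add: nx_def G_inv_one G_mult_one rp_T)
  have c_one: "c (1\<^sub>m n) k = 0" if "k \<in> T" for k
    using that T_G[OF that] by (simp add: c_def nx_one G_mult_one G_inv G_inv_left \<chi>_one)

  have "additive_subgroup (\<chi> ` M)"
    unfolding additive_subgroup_def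
  proof (intro conjI ballI)
    show "0 \<in> \<chi> ` M" using \<chi>_one M(2) by (metis image_eqI)
    fix a b assume "a \<in> \<chi> ` M" "b \<in> \<chi> ` M"
    then obtain g h where "g \<in> M" "h \<in> M" "a = \<chi> g" "b = \<chi> h" by blast
    then show "a + b \<in> \<chi> ` M" using M(3) \<chi>(2) by (metis image_eqI)
  qed
  then obtain H where H: "H \<subseteq> \<chi> ` M" "additive_subgroup H" "finite H" "card H = CHAR('k) ^ d"
    using finite_additive_subgroup_exists[OF char _ \<chi>(3), of d] by blast
  define q where "q = CHAR('k) ^ d"
  have "d < q" unfolding q_def using prime_gt_1_nat[OF char] by (intro power_gt_expt) simp
  obtain \<beta> \<gamma> :: "'k \<Rightarrow> nat \<Rightarrow> 'k" where
    "\<forall>h t. \<forall>i<q. (\<Sum>j<q. transl q h $$ (i, j) * \<beta> t j) = \<beta> (h + t) i"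
    "\<forall>h t. \<forall>j<q. (\<Sum>i<q. \<gamma> t i * transl q (- h) $$ (i, j)) = \<gamma> (h + t) j"
    "\<forall>i<q. \<forall>j<q. (\<Sum>t\<in>H. \<beta> t i * \<gamma> t j) = (if i = j then 1 else 0)"
    using identity_is_trace[OF char H(2,3) H(4)[folded q_def] q_def] by (elim exE conjE)
  note \<beta> = this(1)[rule_format] and \<gamma> = this(2)[rule_format] and \<beta>\<gamma> = this(3)[rule_format]

  define I where "I = T \<times> ({..<q} \<times> {..<q})"
  \<comment> \<open>Component \<open>k\<close> of the transformed family is component
    \<open>nx g k\<close> of the old one, conjugated by the translation by
    \<open>c g k\<close>.\<close>
  define R where "R g x y = (case x of (k, i, j) \<Rightarrow> case y of (k', i', j') \<Rightarrow>
      if k' = nx g k then transl q (c g k) $$ (i, i') * transl q (- c g k) $$ (j', j) else 0)"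
    for g and x y :: "'k mat \<times> nat \<times> nat"
  have R_eq: "R g (k, i, j) (k', i', j') =
      (if k' = nx g k then transl q (c g k) $$ (i, i') * transl q (- c g k) $$ (j', j) else 0)" for g k i j k' i' j'
    by (simp add: R_def)
  have sum_R: "(\<Sum>y\<in>I. R g (k, i, j) y * v y)
      = (\<Sum>i'<q. \<Sum>j'<q. transl q (c g k) $$ (i, i') * transl q (- c g k) $$ (j', j) * v (nx g k, i', j'))"
    if gk: "g \<in> G" "k \<in> T" for g k i j v
  proof -
    have "(\<Sum>y\<in>I. R g (k, i, j) y * v y) = (\<Sum>k'\<in>T. \<Sum>z\<in>{..<q} \<times> {..<q}. R g (k, i, j) (k', z) * v (k', z))"
      unfolding I_def by (simp add: sum.cartesian_product)
    also have "\<dots> = (\<Sum>k'\<in>T. if k' = nx g k then \<Sum>z\<in>{..<q} \<times> {..<q}. R g (k, i, j) (k', z) * v (k', z) else 0)"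
      by (intro sum.cong refl) (auto simp: R_eq intro!: sum.neutral)
    also have "\<dots> = (\<Sum>z\<in>{..<q} \<times> {..<q}. R g (k, i, j) (nx g k, z) * v (nx g k, z))"
      using \<open>finite T\<close> nx_T[OF gk] by simp
    also have "\<dots> = (\<Sum>i'<q. \<Sum>j'<q. R g (k, i, j) (nx g k, i', j') * v (nx g k, i', j'))"
      by (simp add: sum.cartesian_product)
    finally show ?thesis by (simp add: R_eq)
  qed
  have rep: "rep_on I R"
    unfolding rep_on_def
  proof (intro conjI ballI)
    show "finite I" using \<open>finite T\<close> by (simp add: I_def)
    fix x y assume "x \<in> I" "y \<in> I"
    then obtain k i j k' i' j' where xy: "x = (k, i, j)" "y = (k', i', j')"
      and T: "k \<in> T" "k' \<in> T" and less: "i < q" "j < q" "i' < q" "j' < q"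
      by (auto simp: I_def)
    show "regular (\<lambda>g. R g x y)"
    proof -
      \<comment> \<open>The condition \<open>k' = nx g k\<close> amounts to
        \<open>?s g \<in> M\<close>, so the entry is the indicator of \<open>M\<close> times a
        polynomial in \<open>\<chi>\<close>, both evaluated at the two-sided translate
        \<open>?s g\<close>.\<close>
      let ?s = "\<lambda>g. ginv k * g * k'"
      have tr: "regular (\<lambda>g. \<phi> (?s g))" if "regular \<phi>" for \<phi>
        by (rule regular_translate[OF that G_inv[OF T_G[OF T(1)]] T_G[OF T(2)]])
      have "regular (\<lambda>g. (if ?s g \<in> M then 1 else 0) * (of_nat (i' choose i) * \<chi> (?s g) ^ (i' - i) *
          (of_nat (j choose j') * ((-1) * \<chi> (?s g)) ^ (j - j'))))"
        by (intro regular_mult regular_power regular_const tr[OF M_reg] tr[OF \<chi>(1)])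
      then show ?thesis
      proof (rule regular_cong)
        fix g assume g: "g \<in> G"
        show "R g x y = (if ?s g \<in> M then 1 else 0) * (of_nat (i' choose i) * \<chi> (?s g) ^ (i' - i) *
          (of_nat (j choose j') * ((-1) * \<chi> (?s g)) ^ (j - j')))"
        proof (cases "?s g \<in> M")
          case True
          then have "nx g k = k'" using nx_iff[OF g T] by simp
          then show ?thesis using True less by (simp add: xy R_eq c_def transl_def)
        next
          case False
          then have "nx g k \<noteq> k'" using nx_iff[OF g T] by simp
          then show ?thesis using False by (auto simp: xy R_eq)
        qed
      qed
    qed
    show "R (1\<^sub>m n) x y = (if x = y then 1 else 0)"
      using T less by (auto simp: xy R_eq nx_one c_one transl_0)
    fix g h assume gh: "g \<in> G" "h \<in> G"
    show "R (g * h) x y = (\<Sum>z\<in>I. R g x z * R h z y)"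
    proof -
      let ?a = "c g k" and ?b = "c h (nx g k)"
      have minus_add: "- ?b + - ?a = - (?a + ?b)" by simp
      have "(\<Sum>z\<in>I. R g x z * R h z y) = (\<Sum>i1<q. \<Sum>j1<q. transl q ?a $$ (i, i1) * transl q (- ?a) $$ (j1, j) * R h (nx g k, i1, j1) y)"
        unfolding xy(1) by (rule sum_R[OF gh(1) T(1)])
      also have "\<dots> = (if k' = nx h (nx g k) then
          (\<Sum>i1<q. \<Sum>j1<q. (transl q ?a $$ (i, i1) * transl q ?b $$ (i1, i')) * (transl q (- ?b) $$ (j', j1) * transl q (- ?a) $$ (j1, j))) else 0)"
        by (simp add: xy R_eq mult_ac)
      also have "\<dots> = (if k' = nx h (nx g k) then transl q (?a + ?b) $$ (i, i') * transl q (- (?a + ?b)) $$ (j', j) else 0)"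
        using less by (simp only: sum_product[symmetric] transl_add_index minus_add)
      finally show ?thesis
        by (simp only: xy R_eq nx_mult[OF gh T(1)] c_mult[OF gh T(1)])
    qed
  qed

  define X where "X v k = mat q q (\<lambda>(i, j). v (k, i, j))" for v :: "'k mat \<times> nat \<times> nat \<Rightarrow> 'k" and k
  \<comment> \<open>Conjugation preserves determinants and the group permutes the cosets, so the sum
    over all cosets is invariant.\<close>
  define f where "f v = (\<Sum>k\<in>T. det (X v k))" for v
  have X_carrier: "X v k \<in> carrier_mat q q" for v k by (simp add: X_def)
  have f_poly: "polynomial_fun I q f"
    unfolding f_def X_def by (intro polynomial_fun_sum polynomial_fun_det) (simp add: I_def)
  have X_act: "X (\<lambda>x. \<Sum>y\<in>I. R g x y * v y) k = transl q (c g k) * X v (nx g k) * transl q (- c g k)"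
    if gk: "g \<in> G" "k \<in> T" for g k v
  proof (rule eq_matI)
    let ?a = "c g k" and ?Y = "X v (nx g k)"
    fix i j assume "i < dim_row (transl q ?a * ?Y * transl q (- ?a))" "j < dim_col (transl q ?a * ?Y * transl q (- ?a))"
    then have ij: "i < q" "j < q" by (simp_all add: transl_def)
    have "(transl q ?a * ?Y * transl q (- ?a)) $$ (i, j) = (\<Sum>j'<q. (transl q ?a * ?Y) $$ (i, j') * transl q (- ?a) $$ (j', j))"
      by (rule mult_mat_index_sum[OF mult_carrier_mat[OF transl_carrier X_carrier] transl_carrier ij])
    also have "\<dots> = (\<Sum>j'<q. (\<Sum>i'<q. transl q ?a $$ (i, i') * v (nx g k, i', j')) * transl q (- ?a) $$ (j', j))"
    proof (intro sum.cong refl arg_cong2[where f = "(*)"])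
      fix j' assume "j' \<in> {..<q}"
      then have "j' < q" by simp
      show "(transl q ?a * ?Y) $$ (i, j') = (\<Sum>i'<q. transl q ?a $$ (i, i') * v (nx g k, i', j'))"
        unfolding mult_mat_index_sum[OF transl_carrier X_carrier ij(1) \<open>j' < q\<close>]
        using \<open>j' < q\<close> by (intro sum.cong) (auto simp: X_def)
    qed
    also have "\<dots> = (\<Sum>i'<q. \<Sum>j'<q. transl q ?a $$ (i, i') * transl q (- ?a) $$ (j', j) * v (nx g k, i', j'))"
      unfolding sum_distrib_right by (subst sum.swap) (simp add: mult_ac)
    finally show "X (\<lambda>x. \<Sum>y\<in>I. R g x y * v y) k $$ (i, j) = (transl q ?a * ?Y * transl q (- ?a)) $$ (i, j)"
      using ij by (simp add: X_def sum_R[OF gk])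
  qed (simp_all add: X_def transl_def)
  have f_inv: "invariant_on I R f"
    unfolding invariant_on_def
  proof (intro ballI allI)
    fix g v assume g: "g \<in> G"
    have "det (X (\<lambda>x. \<Sum>y\<in>I. R g x y * v y) k) = det (X v (nx g k))" if k: "k \<in> T" for k
    proof -
      have "det (transl q (c g k) * X v (nx g k) * transl q (- c g k))
          = det (transl q (c g k)) * det (X v (nx g k)) * det (transl q (- c g k))"
        by (simp only: det_mult[OF mult_carrier_mat[OF transl_carrier X_carrier] transl_carrier]
            det_mult[OF transl_carrier X_carrier])
      also have "\<dots> = det (X v (nx g k)) * (det (transl q (c g k)) * det (transl q (- c g k)))"
        by (simp only: mult_ac)
      finally show ?thesis by (simp only: X_act[OF g k] det_transl mult_1_right)
    qed
    then have "f (\<lambda>x. \<Sum>y\<in>I. R g x y * v y) = (\<Sum>k\<in>T. det (X v (nx g k)))"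
      unfolding f_def by (intro sum.cong) auto
    also have "\<dots> = f v"
      unfolding f_def
    proof (rule sum.reindex_bij_betw)
      have inj: "inj_on (nx g) T"
      proof (rule inj_on_inverseI)
        fix k assume k: "k \<in> T"
        show "nx (ginv g) (nx g k) = k"
          using nx_mult[OF g G_inv[OF g] k] nx_one[OF k] by (simp add: G_inv_right g)
      qed
      moreover have "nx g ` T \<subseteq> T" using nx_T[OF g] by blast
      ultimately show "bij_betw (nx g) T T"
        using \<open>finite T\<close> by (simp add: bij_betw_def endo_inj_surj)
    qed
    finally show "f (\<lambda>x. \<Sum>y\<in>I. R g x y * v y) = f v" .
  qed
  have q0: "q > 0" using \<open>d < q\<close> by simp
  have det_zero: "det (0\<^sub>m q q :: 'k mat) = 0" using q0 by (simp add: det_zero)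
  have f_0: "f (\<lambda>_. 0) = 0"
  proof -
    have "X (\<lambda>_. 0) k = 0\<^sub>m q q" for k by (intro eq_matI) (auto simp: X_def)
    then show ?thesis by (simp add: f_def det_zero)
  qed
  define k1 where "k1 = rp (1\<^sub>m n)"
  have k1: "k1 \<in> T" "k1 \<in> M"
    using rp_in_T[OF G_one] rp(2)[OF G_one] rp(1)[OF G_one]
    by (simp_all add: k1_def coset_eq_def G_inv_one G_mult_one)
  have k1_iff: "k \<in> M \<longleftrightarrow> k = k1" if k: "k \<in> T" for k
  proof
    assume "k \<in> M"
    then have "coset_eq (1\<^sub>m n) k" using T_G[OF k] by (simp add: coset_eq_def G_inv_one G_mult_one)
    then have "rp (1\<^sub>m n) = rp k" using T_G[OF k] G_one by (intro rp_eq)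
    then show "k = k1" using rp_T[OF k] by (simp add: k1_def)
  qed (use k1 in simp)
  \<comment> \<open>Both \<open>w t\<close> and \<open>v0\<close> are supported on the coset
    \<open>M\<close>, represented by \<open>k1\<close>. There \<open>w t\<close> is the column
    \<open>\<beta> t\<close> times the row \<open>\<gamma> t\<close>, and \<open>v0\<close> is the
    identity, the sum of the \<open>w t\<close> over \<open>H\<close>.\<close>
  define w where "w t x = (case x of (k, i, j) \<Rightarrow> if k = k1 then \<beta> t i * \<gamma> t j else 0)"
    for t and x :: "'k mat \<times> nat \<times> nat"
  define v0 where "v0 x = (case x of (k, i, j) \<Rightarrow> if k = k1 \<and> i = j then 1 else (0::'k))"
    for x :: "'k mat \<times> nat \<times> nat"
  have f_v0: "f v0 \<noteq> 0"
  proof -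
    have "X v0 k = (if k = k1 then 1\<^sub>m q else 0\<^sub>m q q)" for k
      by (intro eq_matI) (auto simp: X_def v0_def)
    then have "f v0 = (\<Sum>k\<in>T. if k = k1 then 1 else 0)"
      unfolding f_def by (intro sum.cong) (auto simp: det_zero)
    then show ?thesis using k1 \<open>finite T\<close> by simp
  qed
  have nx_M: "nx m k = k1 \<longleftrightarrow> k = k1" if m: "m \<in> M" and k: "k \<in> T" for m k
  proof -
    have mG: "m \<in> G" "ginv k \<in> G" "k \<in> G" "k1 \<in> G" using MG[OF m] T_G[OF k] G_inv T_G[OF k1(1)] by auto
    have "ginv k * m * k1 \<in> M \<longleftrightarrow> k \<in> M"
    proof
      assume "k \<in> M"
      then show "ginv k * m * k1 \<in> M" by (intro M(3) M(4) m k1(2))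
    next
      assume a: "ginv k * m * k1 \<in> M"
      have "m * k1 * ginv (ginv k * m * k1) = k"
        using mG by (simp add: G_inv_mult G_mult G_inv G_inv_inv G_assoc G_cancel)
      then show "k \<in> M" using M(3)[OF M(3)[OF m k1(2)] M(4)[OF a]] by simp
    qed
    then show ?thesis using nx_iff[OF mG(1) k k1(1)] k1_iff[OF k] by simp
  qed
  have c_M: "c m k1 = \<chi> m" if m: "m \<in> M" for m
  proof -
    have "\<chi> (ginv k1) + \<chi> k1 = 0"
      using \<chi>(2)[OF M(4)[OF k1(2)] k1(2)] \<chi>_one MG[OF k1(2)] by (simp add: G_inv_left)
    moreover have "c m k1 = \<chi> (ginv k1 * m * k1)" using nx_M[OF m k1(1)] by (simp add: c_def)
    moreover have "\<chi> (ginv k1 * m * k1) = \<chi> m + (\<chi> (ginv k1) + \<chi> k1)"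
      by (simp only: \<chi>(2)[OF M(3)[OF M(4)[OF k1(2)] m] k1(2)] \<chi>(2)[OF M(4)[OF k1(2)] m] ac_simps)
    ultimately show ?thesis by simp
  qed
  show ?thesis
  proof (rule less_sigma[OF rep f_poly f_inv f_0 f_v0])
    fix F assume F: "polynomial_fun I d F" and F_inv: "invariant_on I R F" and F0: "F (\<lambda>_. 0) = 0"
    have "F v0 = F (\<lambda>x. \<Sum>t\<in>H. w t x)"
    proof (rule polynomial_fun_cong_on[OF F])
      fix x assume "x \<in> I"
      then obtain k i j where "x = (k, i, j)" "i < q" "j < q" by (auto simp: I_def)
      then show "v0 x = (\<Sum>t\<in>H. w t x)" by (cases "k = k1") (simp_all add: v0_def w_def \<beta>\<gamma>)
    qed
    also have "\<dots> = 0"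
    proof (rule invariant_vanishes_on_trace[OF char H(2,3) F _ F0])
      show "d < card H" using \<open>d < q\<close> H(4) by (simp add: q_def)
      fix h S assume h: "h \<in> H" and S: "S \<subseteq> H"
      \<comment> \<open>Every \<open>h\<close> in \<open>H\<close> is a value of
        \<open>\<chi>\<close> on \<open>M\<close>, and an element \<open>m\<close> with this value
        sends \<open>w t\<close> to \<open>w (h + t)\<close>.\<close>
      obtain m where m: "m \<in> M" "\<chi> m = h" using h H(1) by blast
      let ?v = "\<lambda>x. \<Sum>t\<in>S. w t x"
      have "F (\<lambda>x. \<Sum>t\<in>S. w (h + t) x) = F (\<lambda>x. \<Sum>y\<in>I. R m x y * ?v y)"
      proof (rule polynomial_fun_cong_on[OF F])
        fix x assume "x \<in> I"
        then obtain k i j where x: "x = (k, i, j)" and k: "k \<in> T" and ij: "i < q" "j < q" by (auto simp: I_def)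
        show "(\<Sum>t\<in>S. w (h + t) x) = (\<Sum>y\<in>I. R m x y * ?v y)"
        proof (cases "k = k1")
          case False
          then have "nx m k \<noteq> k1" using nx_M[OF m(1) k] by simp
          then show ?thesis using False unfolding x sum_R[OF MG[OF m(1)] k] by (simp add: w_def)
        next
          case True
          have nx: "nx m k = k1" using nx_M[OF m(1) k] True by simp
          have ck: "c m k = h" using c_M[OF m(1)] m(2) True by simp
          have "(\<Sum>y\<in>I. R m x y * ?v y)
              = (\<Sum>i'<q. \<Sum>j'<q. transl q h $$ (i, i') * transl q (- h) $$ (j', j) * (\<Sum>t\<in>S. \<beta> t i' * \<gamma> t j'))"
            unfolding x sum_R[OF MG[OF m(1)] k] nx ck by (simp add: w_def)
          also have "\<dots> = (\<Sum>i'<q. \<Sum>j'<q. \<Sum>t\<in>S. (transl q h $$ (i, i') * \<beta> t i') * (\<gamma> t j' * transl q (- h) $$ (j', j)))"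
            by (simp add: sum_distrib_left mult_ac)
          also have "\<dots> = (\<Sum>i'<q. \<Sum>t\<in>S. \<Sum>j'<q. (transl q h $$ (i, i') * \<beta> t i') * (\<gamma> t j' * transl q (- h) $$ (j', j)))"
            by (intro sum.cong refl sum.swap)
          also have "\<dots> = (\<Sum>t\<in>S. \<Sum>i'<q. \<Sum>j'<q. (transl q h $$ (i, i') * \<beta> t i') * (\<gamma> t j' * transl q (- h) $$ (j', j)))"
            by (rule sum.swap)
          also have "\<dots> = (\<Sum>t\<in>S. \<beta> (h + t) i * \<gamma> (h + t) j)"
            by (simp only: sum_product[symmetric] \<beta>[OF ij(1)] \<gamma>[OF ij(2)])
          finally show ?thesis using True by (simp add: x w_def)
        qed
      qed
      also have "\<dots> = F ?v" using F_inv MG[OF m(1)] by (auto simp: invariant_on_def)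
      finally show "F (\<lambda>x. \<Sum>t\<in>S. w (h + t) x) = F (\<lambda>x. \<Sum>t\<in>S. w t x)" .
    qed
    finally show "F v0 = 0" .
  qed
qed

end

section \<open>Infinite groups\<close>

lemma finite_rep_mat_image:
  assumes "\<And>i j. i < r \<Longrightarrow> j < r \<Longrightarrow> finite ((\<lambda>g. R g i j) ` A)"
  shows "finite (rep_mat r R ` A)"
proof -
  let ?F = "PiE ({..<r} \<times> {..<r}) (\<lambda>(i, j). (\<lambda>g. R g i j) ` A)"
  have "rep_mat r R ` A \<subseteq> mat r r ` ?F"
  proof
    fix X assume "X \<in> rep_mat r R ` A"
    then obtain g where g: "g \<in> A" "X = rep_mat r R g" by blast
    have "X = mat r r (restrict (\<lambda>(i, j). R g i j) ({..<r} \<times> {..<r}))"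
      unfolding g rep_mat_def by (intro eq_matI) auto
    moreover have "restrict (\<lambda>(i, j). R g i j) ({..<r} \<times> {..<r}) \<in> ?F" using g by auto
    ultimately show "X \<in> mat r r ` ?F" by blast
  qed
  moreover have "finite ?F" using assms by (intro finite_PiE) auto
  ultimately show ?thesis by (meson finite_imageI finite_subset)
qed

context linear_group
begin

lemma rep_on_reindex:
  fixes m :: nat
  assumes R: "rep_on J R" and b: "bij_betw b {..<m} J"
  shows "rep_on {..<m} (\<lambda>g x y. R g (b x) (b y))"
proof -
  have bJ: "b x \<in> J" if "x < m" for x using b that by (auto dest: bij_betwE)
  have b_eq: "b x = b y \<longleftrightarrow> x = y" if "x < m" "y < m" for x y
    using b that by (auto simp: bij_betw_def inj_on_def)
  have "(\<Sum>k<m. R g (b x) (b k) * R h (b k) (b y)) = (\<Sum>k\<in>J. R g (b x) k * R h k (b y))" for g h x y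
    by (rule sum.reindex_bij_betw[OF b])
  then show ?thesis
    unfolding rep_on_def using rep_onD[OF R] bJ b_eq by simp
qed

text \<open>The elements that act trivially on both diagonal blocks form a subgroup \<open>M\<close>
  of finite index. On \<open>M\<close> the matrices are unipotent, so each entry in
  \<open>J \<times> J'\<close> is an additive character; one of them has infinite image, since
  otherwise \<open>G\<close> would act through a finite group.\<close>

lemma less_sigma_of_block_triangular:
  assumes char: "prime CHAR('k)" and R: "rep_on {..<r} R" and inf: "infinite (rep_mat r R ` G)"
    and J: "J \<subseteq> {..<r}" "J' = {..<r} - J"
    and block: "\<And>g a b. g \<in> G \<Longrightarrow> a \<in> J' \<Longrightarrow> b \<in> J \<Longrightarrow> R g a b = 0"
    and fin: "\<And>a b. (a, b) \<in> J \<times> J \<union> J' \<times> J' \<Longrightarrow> finite ((\<lambda>g. R g a b) ` G)"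
  shows "enat d < sigma n G"
proof -
  define D where "D = J \<times> J \<union> J' \<times> J'"
  have finJ: "finite J" "finite J'" using J finite_subset by auto
  have r: "{..<r} = J \<union> J'" "J \<inter> J' = {}" using J by auto
  note RD = rep_onD[OF R]
  have less: "a < r" if "a \<in> J \<or> a \<in> J'" for a using that J by auto
  have split: "(\<Sum>k<r. h k) = (\<Sum>k\<in>J. h k) + (\<Sum>k\<in>J'. h k)" for h :: "nat \<Rightarrow> 'k"
    unfolding r(1) by (rule sum.union_disjoint[OF finJ r(2)])
  have mult_J: "R (g * h) a b = (\<Sum>k\<in>J. R g a k * R h k b)" if "g \<in> G" "h \<in> G" "a \<in> J" "b \<in> J" for g h a b
    using that less RD(4)[OF that(1,2), of a b] by (simp add: split block)
  have mult_J': "R (g * h) a b = (\<Sum>k\<in>J'. R g a k * R h k b)" if "g \<in> G" "h \<in> G" "a \<in> J'" "b \<in> J'" for g h a b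
    using that less RD(4)[OF that(1,2), of a b] by (simp add: split block)
  have one: "R (1\<^sub>m n) a b = (if a = b then 1 else 0)" if "(a, b) \<in> D" for a b
    using that less by (auto simp: D_def RD(3))
  define M where "M = {g \<in> G. \<forall>(a, b)\<in>D. R g a b = (if a = b then 1 else 0)}"
  have M_D: "g \<in> G" "(a, b) \<in> D \<Longrightarrow> R g a b = (if a = b then 1 else 0)" if "g \<in> M" for g a b
    using that by (auto simp: M_def)
  have D_mult: "R (g * h) a b = R (g' * h') a b"
    if "g \<in> G" "h \<in> G" "g' \<in> G" "h' \<in> G" "(a, b) \<in> D"
      and "\<And>a b. (a, b) \<in> D \<Longrightarrow> R g a b = R g' a b" "\<And>a b. (a, b) \<in> D \<Longrightarrow> R h a b = R h' a b"
    for g h g' h' a b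
    using that(5)
  proof (unfold D_def, elim UnE)
    assume "(a, b) \<in> J \<times> J"
    then show ?thesis using that(1-4,6,7) by (auto simp: mult_J D_def intro!: sum.cong)
  next
    assume "(a, b) \<in> J' \<times> J'"
    then show ?thesis using that(1-4,6,7) by (auto simp: mult_J' D_def intro!: sum.cong)
  qed
  have M_eq_one: "R g a b = R (1\<^sub>m n) a b" if "g \<in> M" "(a, b) \<in> D" for g a b
    using M_D(2)[OF that] one[OF that(2)] by simp
  have in_M: "g \<in> M" if "g \<in> G" "\<And>a b. (a, b) \<in> D \<Longrightarrow> R g a b = R (1\<^sub>m n) a b" for g
    using that one by (auto simp: M_def)
  have inv_M: "ginv g * h \<in> M" if gh: "g \<in> G" "h \<in> G" "\<And>a b. (a, b) \<in> D \<Longrightarrow> R g a b = R h a b" for g h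
  proof (rule in_M)
    show "ginv g * h \<in> G" using gh by (intro G_mult G_inv)
    fix a b assume "(a, b) \<in> D"
    then have "R (ginv g * h) a b = R (ginv g * g) a b"
      using gh by (intro D_mult G_inv) auto
    then show "R (ginv g * h) a b = R (1\<^sub>m n) a b" using gh by (simp add: G_inv_left)
  qed
  \<comment> \<open>There are finitely many possible pairs of diagonal blocks, and elements with the
    same blocks differ by an element of \<open>M\<close>.\<close>
  define \<kappa> where "\<kappa> g = restrict (\<lambda>(a, b). R g a b) D" for g
  have \<kappa>_fin: "finite (\<kappa> ` G)"
  proof (rule finite_subset)
    show "\<kappa> ` G \<subseteq> PiE D (\<lambda>(a, b). (\<lambda>g. R g a b) ` G)" by (auto simp: \<kappa>_def)
    show "finite (PiE D (\<lambda>(a, b). (\<lambda>g. R g a b) ` G))"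
      using finJ fin by (intro finite_PiE) (auto simp: D_def)
  qed
  have \<kappa>_M: "ginv g * h \<in> M" if gh: "g \<in> G" "h \<in> G" "\<kappa> g = \<kappa> h" for g h
  proof (rule inv_M[OF gh(1,2)])
    fix a b assume "(a, b) \<in> D"
    then show "R g a b = R h a b" using fun_cong[OF gh(3), of "(a, b)"] by (simp add: \<kappa>_def)
  qed
  have "\<exists>a\<in>J. \<exists>b\<in>J'. infinite ((\<lambda>g. R g a b) ` M)"
  proof (rule ccontr)
    assume "\<not> ?thesis"
    then have fin_JJ': "finite ((\<lambda>g. R g a b) ` M)" if "a \<in> J" "b \<in> J'" for a b using that by blast
    have "finite ((\<lambda>g. R g a b) ` M)" if ab: "a < r" "b < r" for a b
    proof -
      consider "(a, b) \<in> D" | "a \<in> J" "b \<in> J'" | "a \<in> J'" "b \<in> J"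
        using ab r(1) by (auto simp: D_def)
      then show ?thesis
      proof cases
        case 1
        then have "finite ((\<lambda>g. R g a b) ` G)" unfolding D_def by (rule fin)
        moreover have "M \<subseteq> G" by (auto simp: M_def)
        ultimately show ?thesis by (meson finite_subset image_mono)
      next
        case 2
        then show ?thesis by (rule fin_JJ')
      next
        case 3
        then have "(\<lambda>g. R g a b) ` M \<subseteq> {0}" using block M_D(1) by auto
        then show ?thesis by (rule finite_subset) simp
      qed
    qed
    then have fin_M: "finite (rep_mat r R ` M)" by (rule finite_rep_mat_image)
    \<comment> \<open>One element is chosen for each value of \<open>\<kappa>\<close>, so that every
      \<open>g\<close> is \<open>t g\<close> times an element of \<open>M\<close> and the image of
      \<open>G\<close> is covered by products from two finite sets.\<close>
    define t where "t g = (SOME h. h \<in> G \<and> \<kappa> h = \<kappa> g)" for g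
    have t: "t g \<in> G" "\<kappa> (t g) = \<kappa> g" if "g \<in> G" for g
      using someI[of "\<lambda>h. h \<in> G \<and> \<kappa> h = \<kappa> g" g] that by (auto simp: t_def)
    have "t ` G \<subseteq> (\<lambda>c. SOME h. h \<in> G \<and> \<kappa> h = c) ` \<kappa> ` G" by (auto simp: t_def)
    then have "finite (t ` G)" using \<kappa>_fin by (meson finite_imageI finite_subset)
    then have "finite (rep_mat r R ` t ` G \<times> rep_mat r R ` M)" using fin_M by blast
    moreover have "rep_mat r R ` G \<subseteq> (\<lambda>(X, Y). X * Y) ` (rep_mat r R ` t ` G \<times> rep_mat r R ` M)"
    proof
      fix X assume "X \<in> rep_mat r R ` G"
      then obtain g where g: "g \<in> G" "X = rep_mat r R g" by blast
      have m: "ginv (t g) * g \<in> M" using t[OF g(1)] g(1) by (intro \<kappa>_M)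
      have "t g * (ginv (t g) * g) = g" using t[OF g(1)] g(1) by (simp add: G_cancel)
      then have "X = rep_mat r R (t g) * rep_mat r R (ginv (t g) * g)"
        using rep_mat_mult[OF R t(1)[OF g(1)] M_D(1)[OF m]] g(2) by simp
      then show "X \<in> (\<lambda>(X, Y). X * Y) ` (rep_mat r R ` t ` G \<times> rep_mat r R ` M)"
        using g(1) m by (intro image_eqI[of _ _ "(rep_mat r R (t g), rep_mat r R (ginv (t g) * g))"]) auto
    qed
    ultimately show False using inf by (meson finite_imageI finite_subset)
  qed
  then obtain a b where ab: "a \<in> J" "b \<in> J'" and \<chi>_inf: "infinite ((\<lambda>g. R g a b) ` M)" by blast
  show ?thesis
  proof (rule less_sigma_of_additive_character[OF char _ _ _ _ _ \<kappa>_fin \<kappa>_M _ _ \<chi>_inf])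
    show "M \<subseteq> G" by (auto simp: M_def)
    show "1\<^sub>m n \<in> M" by (rule in_M) (auto simp: G_one)
    show "g * h \<in> M" if gh: "g \<in> M" "h \<in> M" for g h
    proof (rule in_M)
      show "g * h \<in> G" using gh M_D(1) by (intro G_mult)
      fix a b assume "(a, b) \<in> D"
      then have "R (g * h) a b = R (1\<^sub>m n * 1\<^sub>m n) a b"
        using gh M_D(1) M_eq_one G_one by (intro D_mult) auto
      then show "R (g * h) a b = R (1\<^sub>m n) a b" by (simp add: G_mult_one G_one)
    qed
    show "ginv g \<in> M" if g: "g \<in> M" for g
      using inv_M[OF M_D(1)[OF g] G_one M_eq_one[OF g]] by (simp add: G_mult_one G_inv M_D(1)[OF g])
    \<comment> \<open>Membership in \<open>M\<close> prescribes the entries in \<open>D\<close>,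
      each of which takes finitely many values, so interpolation shows the indicator of
      \<open>M\<close> to be regular.\<close>
    have "regular (\<lambda>g. \<Prod>x\<in>D. if R g (fst x) (snd x) = (if fst x = snd x then 1 else 0) then 1 else 0)"
    proof (intro regular_prod regular_indicator)
      fix x assume "x \<in> D"
      then show "regular (\<lambda>g. R g (fst x) (snd x))" "finite ((\<lambda>g. R g (fst x) (snd x)) ` G)"
        using less fin by (auto simp: D_def intro!: RD(2))
    qed
    then show "regular (\<lambda>g. if g \<in> M then 1 else 0)"
    proof (rule regular_cong)
      fix g assume g: "g \<in> G"
      have finD: "finite D" using finJ by (simp add: D_def)
      show "(if g \<in> M then 1 else 0)
          = (\<Prod>x\<in>D. if R g (fst x) (snd x) = (if fst x = snd x then 1 else 0) then 1 else (0::'k))"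
      proof (cases "g \<in> M")
        case True
        then have "(\<Prod>x\<in>D. if R g (fst x) (snd x) = (if fst x = snd x then 1 else 0) then 1 else (0::'k)) = 1"
          using M_D(2)[OF True] by (intro prod.neutral) auto
        then show ?thesis using True by simp
      next
        case False
        then obtain a b where "(a, b) \<in> D" "R g a b \<noteq> (if a = b then 1 else 0)" using g by (auto simp: M_def)
        then have "\<exists>x\<in>D. (if R g (fst x) (snd x) = (if fst x = snd x then 1 else 0) then 1 else (0::'k)) = 0"
          by (intro bexI[of _ "(a, b)"]) auto
        then show ?thesis using False by (simp only: prod_zero[OF finD] if_False)
      qed
    qed
    show "regular (\<lambda>g. R g a b)" using ab less by (intro RD(2)) auto
    show "R (g * h) a b = R g a b + R h a b" if gh: "g \<in> M" "h \<in> M" for g h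
    proof -
      have "R (g * h) a b = (\<Sum>k\<in>J. R g a k * R h k b) + (\<Sum>k\<in>J'. R g a k * R h k b)"
        using RD(4)[OF M_D(1)[OF gh(1)] M_D(1)[OF gh(2)], of a b] ab less by (simp add: split)
      also have "(\<Sum>k\<in>J. R g a k * R h k b) = (\<Sum>k\<in>J. if k = a then R h k b else 0)"
        using M_D(2)[OF gh(1)] ab by (intro sum.cong) (auto simp: D_def)
      also have "(\<Sum>k\<in>J'. R g a k * R h k b) = (\<Sum>k\<in>J'. if k = b then R g a k else 0)"
        using M_D(2)[OF gh(2)] ab by (intro sum.cong) (auto simp: D_def)
      finally show ?thesis using ab finJ by simp
    qed
  qed
qed

end

text \<open>A representation of least dimension with infinite image exists because \<open>G\<close>
  acts on its defining space. If the span of the matrices moves each nonzero vector to every vector,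
  the eigenvalue argument applies. Otherwise the vectors reached from some \<open>x\<close> form a
  proper nonzero submodule, and by minimality \<open>G\<close> acts on it and on the quotient
  through finite groups.\<close>

lemma less_sigma_of_infinite:
  fixes G :: "'k::alg_closed_field mat set"
  assumes "linear_group n G" and char: "prime CHAR('k)" and inf: "infinite G"
  shows "enat d < sigma n G"
proof -
  interpret linear_group n G by fact
  define good where "good r \<longleftrightarrow> (\<exists>R. rep_on {..<r} R \<and> infinite (rep_mat r R ` G))" for r
  have "good n"
  proof -
    have "rep_on {..<n} (\<lambda>g i j. g $$ (i, j))"
      unfolding rep_on_def using mult_mat_index_sum[OF G_carrier G_carrier] by (auto intro: regular_entry)
    moreover have "rep_mat n (\<lambda>g i j. g $$ (i, j)) g = g" if "g \<in> G" for g
      using G_carrier[OF that] by (intro eq_matI) (auto simp: rep_mat_def)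
    then have "rep_mat n (\<lambda>g i j. g $$ (i, j)) ` G = G" by force
    ultimately show ?thesis unfolding good_def using inf by (intro exI[of _ "\<lambda>g i j. g $$ (i, j)"]) simp
  qed
  define r where "r = (LEAST r. good r)"
  have "good r" unfolding r_def using \<open>good n\<close> by (rule LeastI)
  then obtain R where R: "rep_on {..<r} R" and infR: "infinite (rep_mat r R ` G)" unfolding good_def by blast
  have minimal: "finite (rep_mat m R' ` G)" if "m < r" "rep_on {..<m} R'" for m R'
    using not_less_Least[of m good] that unfolding r_def good_def by blast
  let ?S = "rep_mat r R ` G"
  have S: "?S \<subseteq> carrier_mat r r" by (auto simp: rep_mat_carrier)
  have S_mult: "A * B \<in> ?S" if "A \<in> ?S" "B \<in> ?S" for A B
    using that by (auto simp flip: rep_mat_mult[OF R] intro: G_mult)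
  have S_one: "1\<^sub>m r \<in> ?S" using G_one rep_mat_one[OF R] by (metis image_eqI)
  note span_carrier = mat_span_carrier[OF S]
  show ?thesis
  proof (cases "\<forall>x y. x \<in> carrier_vec r \<longrightarrow> x \<noteq> 0\<^sub>v r \<longrightarrow> y \<in> carrier_vec r \<longrightarrow> (\<exists>A\<in>mat_span r ?S. A *\<^sub>v x = y)")
    case True
    then show ?thesis by (intro less_sigma_of_irreducible[OF assms(1) char R infR]) blast
  next
    case False
    then obtain x y where x: "x \<in> carrier_vec r" "x \<noteq> 0\<^sub>v r" and y: "y \<in> carrier_vec r"
      and not_reached: "\<And>A. A \<in> mat_span r ?S \<Longrightarrow> A *\<^sub>v x \<noteq> y" by blast
    define W where "W = (\<lambda>A. A *\<^sub>v x) ` mat_span r ?S"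
    have "\<exists>P P' J. P \<in> carrier_mat r r \<and> P' \<in> carrier_mat r r \<and> P * P' = 1\<^sub>m r \<and> P' * P = 1\<^sub>m r \<and>
      J \<subseteq> {..<r} \<and> (\<forall>c\<in>carrier_vec r. P *\<^sub>v c \<in> W \<longleftrightarrow> (\<forall>j<r. j \<notin> J \<longrightarrow> c $ j = 0))"
    proof (rule adapted_basis)
      show "W \<subseteq> carrier_vec r"
        unfolding W_def using mult_mat_vec_carrier[OF span_carrier x(1)] by blast
      have "0\<^sub>v r = 0\<^sub>m r r *\<^sub>v x" using x by (intro eq_vecI) auto
      then show "0\<^sub>v r \<in> W" unfolding W_def using mat_span.zero by blast
      show "u + w \<in> W" if uw: "u \<in> W" "w \<in> W" for u w
      proof -
        obtain A B where AB: "A \<in> mat_span r ?S" "B \<in> mat_span r ?S" "u = A *\<^sub>v x" "w = B *\<^sub>v x"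
          using uw unfolding W_def by blast
        have "u + w = (A + B) *\<^sub>v x"
          unfolding AB(3,4) by (rule add_mult_distrib_mat_vec[symmetric, OF span_carrier[OF AB(1)] span_carrier[OF AB(2)] x(1)])
        then show ?thesis unfolding W_def using mat_span_add[OF S AB(1,2)] by blast
      qed
      show "c \<cdot>\<^sub>v w \<in> W" if w: "w \<in> W" for c w
      proof -
        obtain A where A: "A \<in> mat_span r ?S" "w = A *\<^sub>v x" using w unfolding W_def by blast
        have "c \<cdot>\<^sub>v w = (c \<cdot>\<^sub>m A) *\<^sub>v x"
          unfolding A(2) using span_carrier[OF A(1)] x(1)
          by (intro eq_vecI) (auto simp: scalar_prod_def sum_distrib_left mult.assoc)
        then show ?thesis unfolding W_def using mat_span_smult[OF S A(1)] by blast
      qed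
    qed
    then obtain P P' J where P: "P \<in> carrier_mat r r" "P' \<in> carrier_mat r r" "P * P' = 1\<^sub>m r" "P' * P = 1\<^sub>m r"
      and J: "J \<subseteq> {..<r}" and iff: "\<forall>c\<in>carrier_vec r. P *\<^sub>v c \<in> W \<longleftrightarrow> (\<forall>j<r. j \<notin> J \<longrightarrow> c $ j = 0)"
      by (elim exE conjE)
    note iff = iff[rule_format]
    have coords: "P *\<^sub>v (P' *\<^sub>v w) = w" "P' *\<^sub>v w \<in> carrier_vec r" if "w \<in> carrier_vec r" for w
      using that P(2,3) assoc_mult_mat_vec[OF P(1,2) that] by simp_all
    have x_W: "x \<in> W"
      unfolding W_def using x(1) by (intro image_eqI[OF _ mat_span_base[OF S S_one]]) simp
    have J_ne: "J \<noteq> {}"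
    proof
      assume "J = {}"
      then have "P' *\<^sub>v x = 0\<^sub>v r"
        using iff[OF coords(2)[OF x(1)]] x_W coords(2)[OF x(1)] by (intro eq_vecI) (simp_all add: coords(1)[OF x(1)] carrier_matD[OF P(2)])
      then have "P *\<^sub>v (P' *\<^sub>v x) = 0\<^sub>v r" using P(1) by auto
      then show False using x by (simp add: coords)
    qed
    have J_ne': "J \<noteq> {..<r}"
    proof
      assume "J = {..<r}"
      then have "y \<in> W" using iff[OF coords(2)[OF y]] by (simp add: coords(1)[OF y])
      then show False unfolding W_def using not_reached by blast
    qed
    define J' where "J' = {..<r} - J"
    \<comment> \<open>The representation in a basis adapted to \<open>W\<close>: \<open>J\<close>
      indexes the submodule and \<open>J'\<close> the quotient.\<close>
    define Rm where "Rm g = P' * rep_mat r R g * P" for g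
    define R2 where "R2 g a b = Rm g $$ (a, b)" for g a b
    have Rm_carrier: "Rm g \<in> carrier_mat r r" for g
      unfolding Rm_def by (rule mult_carrier_mat[OF mult_carrier_mat[OF P(2) rep_mat_carrier] P(1)])
    have P_Rm: "P * Rm g = rep_mat r R g * P" for g
    proof -
      have "Rm g = P' * (rep_mat r R g * P)" unfolding Rm_def by (rule assoc_mult_mat[OF P(2) rep_mat_carrier P(1)])
      then have "P * Rm g = P * P' * (rep_mat r R g * P)"
        using assoc_mult_mat[OF P(1,2) mult_carrier_mat[OF rep_mat_carrier P(1)]] by simp
      then show ?thesis using left_mult_one_mat[OF mult_carrier_mat[OF rep_mat_carrier P(1)]] by (simp add: P(3))
    qed
    have Rm_mult: "Rm (g * h) = Rm g * Rm h" if gh: "g \<in> G" "h \<in> G" for g h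
    proof -
      have "Rm g * Rm h = P' * rep_mat r R g * (P * Rm h)"
        unfolding Rm_def[of g] by (rule assoc_mult_mat[OF mult_carrier_mat[OF P(2) rep_mat_carrier] P(1) Rm_carrier])
      also have "\<dots> = P' * rep_mat r R g * rep_mat r R h * P"
        unfolding P_Rm by (rule assoc_mult_mat[symmetric, OF mult_carrier_mat[OF P(2) rep_mat_carrier] rep_mat_carrier P(1)])
      also have "P' * rep_mat r R g * rep_mat r R h = P' * rep_mat r R (g * h)"
        unfolding rep_mat_mult[OF R gh] by (rule assoc_mult_mat[OF P(2) rep_mat_carrier rep_mat_carrier])
      finally show ?thesis by (simp add: Rm_def)
    qed
    have Rm_one: "Rm (1\<^sub>m n) = 1\<^sub>m r"
      using P by (simp add: Rm_def rep_mat_one[OF R])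
    have R2_eq: "R2 g a b = (\<Sum>l<r. (\<Sum>k<r. P' $$ (a, k) * R g k l) * P $$ (l, b))" if ab: "a < r" "b < r" for g a b
    proof -
      have "R2 g a b = (\<Sum>l<r. (P' * rep_mat r R g) $$ (a, l) * P $$ (l, b))"
        unfolding R2_def Rm_def by (rule mult_mat_index_sum[OF mult_carrier_mat[OF P(2) rep_mat_carrier] P(1) ab])
      also have "\<dots> = (\<Sum>l<r. (\<Sum>k<r. P' $$ (a, k) * R g k l) * P $$ (l, b))"
      proof (intro sum.cong refl arg_cong2[where f = "(*)"])
        fix l assume "l \<in> {..<r}"
        then have l: "l < r" by simp
        show "(P' * rep_mat r R g) $$ (a, l) = (\<Sum>k<r. P' $$ (a, k) * R g k l)"
          unfolding mult_mat_index_sum[OF P(2) rep_mat_carrier ab(1) l]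
          using l by (intro sum.cong) (auto simp: rep_mat_def)
      qed
      finally show ?thesis .
    qed
    have rep2: "rep_on {..<r} R2"
      unfolding rep_on_def
    proof (intro conjI ballI)
      fix a b assume "a \<in> {..<r}" "b \<in> {..<r}"
      then have ab: "a < r" "b < r" by auto
      have "regular (\<lambda>g. \<Sum>l<r. (\<Sum>k<r. P' $$ (a, k) * R g k l) * P $$ (l, b))"
        by (intro regular_sum regular_mult regular_const rep_onD(2)[OF R]) auto
      then show "regular (\<lambda>g. R2 g a b)" by (simp only: R2_eq[OF ab])
      show "R2 (1\<^sub>m n) a b = (if a = b then 1 else 0)" using ab by (simp add: R2_def Rm_one)
      show "R2 (g * h) a b = (\<Sum>k\<in>{..<r}. R2 g a k * R2 h k b)" if "g \<in> G" "h \<in> G" for g h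
        unfolding R2_def Rm_mult[OF that] by (rule mult_mat_index_sum[OF Rm_carrier Rm_carrier ab])
    qed simp
    have rep_mat2: "rep_mat r R2 g = Rm g" for g
      using carrier_matD[OF Rm_carrier[of g]] by (intro eq_matI) (auto simp: rep_mat_def R2_def)
    have inf2: "infinite (rep_mat r R2 ` G)"
    proof
      assume fin: "finite (rep_mat r R2 ` G)"
      have "rep_mat r R g = P * Rm g * P'" for g
        unfolding P_Rm
        by (simp only: assoc_mult_mat[OF rep_mat_carrier P(1,2)] P(3) right_mult_one_mat[OF rep_mat_carrier])
      then have "?S \<subseteq> (\<lambda>X. P * X * P') ` (rep_mat r R2 ` G)" by (auto simp: rep_mat2)
      then show False using infR fin by (meson finite_imageI finite_subset)
    qed
    have block: "R2 g a b = 0" if g: "g \<in> G" and a: "a \<in> J'" and b: "b \<in> J" for g a b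
    proof -
      let ?e = "unit_vec r b :: 'k vec"
      have ab: "a < r" "a \<notin> J" "b < r" using a b J by (auto simp: J'_def)
      have "\<forall>j<r. j \<notin> J \<longrightarrow> ?e $ j = 0" using b ab by (auto simp: unit_vec_def)
      then have "P *\<^sub>v ?e \<in> W" using iff[OF unit_vec_carrier] by blast
      then obtain A where A: "A \<in> mat_span r ?S" "P *\<^sub>v ?e = A *\<^sub>v x" unfolding W_def by blast
      have "P *\<^sub>v (Rm g *\<^sub>v ?e) = (P * Rm g) *\<^sub>v ?e"
        by (rule assoc_mult_mat_vec[symmetric, OF P(1) Rm_carrier unit_vec_carrier])
      also have "\<dots> = rep_mat r R g *\<^sub>v (P *\<^sub>v ?e)"
        unfolding P_Rm by (rule assoc_mult_mat_vec[OF rep_mat_carrier P(1) unit_vec_carrier])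
      also have "\<dots> = (rep_mat r R g * A) *\<^sub>v x"
        unfolding A(2) by (rule assoc_mult_mat_vec[symmetric, OF rep_mat_carrier span_carrier[OF A(1)] x(1)])
      also have "\<dots> \<in> W"
        unfolding W_def using g by (intro imageI mat_span_mult[OF S S_mult] mat_span_base[OF S] A(1)) auto
      finally have "(Rm g *\<^sub>v ?e) $ a = 0"
        using iff[OF mult_mat_vec_carrier[OF Rm_carrier unit_vec_carrier]] ab by blast
      then show ?thesis using ab carrier_matD[OF Rm_carrier[of g]] by (simp add: R2_def)
    qed
    note RD = rep_onD[OF rep2]
    have finJ: "finite J" "finite J'" using J finite_subset by (auto simp: J'_def)
    have split: "(\<Sum>k<r. h k) = (\<Sum>k\<in>J. h k) + (\<Sum>k\<in>J'. h k)" for h :: "nat \<Rightarrow> 'k"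
      using sum.subset_diff[OF J, of h] by (simp add: J'_def add.commute)
    have less: "a < r" if "a \<in> J \<or> a \<in> J'" for a using that J by (auto simp: J'_def)
    \<comment> \<open>By the vanishing block, the sum in the product formula runs only over
      \<open>J\<close> or only over \<open>J'\<close>, so both diagonal blocks are
      representations.\<close>
    have rep_J: "rep_on J R2"
      unfolding rep_on_def using RD less finJ by (auto simp: split block)
    have rep_J': "rep_on J' R2"
      unfolding rep_on_def using RD less finJ by (auto simp: split block)
    have fin_sub: "finite ((\<lambda>g. R2 g a b) ` G)"
      if K: "rep_on K R2" "card K < r" and ab: "a \<in> K" "b \<in> K" for K a b
    proof -
      have "finite K" using rep_onD(1)[OF K(1)] .
      then obtain e where e: "bij_betw e {..<card K} K"
        using ex_bij_betw_nat_finite by (auto simp: lessThan_atLeast0)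
      have "finite (rep_mat (card K) (\<lambda>g x y. R2 g (e x) (e y)) ` G)"
        by (rule minimal[OF K(2) rep_on_reindex[OF K(1) e]])
      moreover have "a \<in> e ` {..<card K}" "b \<in> e ` {..<card K}" using e ab by (simp_all add: bij_betw_def)
      then obtain i j where ij: "i < card K" "j < card K" "e i = a" "e j = b" by blast
      have "(\<lambda>g. R2 g a b) ` G = (\<lambda>X. X $$ (i, j)) ` rep_mat (card K) (\<lambda>g x y. R2 g (e x) (e y)) ` G"
        using ij by (auto simp: rep_mat_def image_iff)
      ultimately show ?thesis by simp
    qed
    have card: "card J < r" "card J' < r"
      using psubset_card_mono[of "{..<r}" J] psubset_card_mono[of "{..<r}" J'] J J_ne J_ne' by (auto simp: J'_def)
    show ?thesis
    proof (rule less_sigma_of_block_triangular[OF char rep2 inf2 J J'_def block])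
      fix a b assume "(a, b) \<in> J \<times> J \<union> J' \<times> J'"
      then show "finite ((\<lambda>g. R2 g a b) ` G)"
        using fin_sub[OF rep_J card(1)] fin_sub[OF rep_J' card(2)] by blast
    qed
  qed
qed

section \<open>Finite groups\<close>

text \<open>Otherwise 1 plus the product of \<open>x - a\<close> over all field elements
  \<open>a\<close> would be a nonconstant polynomial without a root.\<close>

lemma infinite_UNIV_alg_closed_field: "infinite (UNIV :: 'k::alg_closed_field set)"
proof
  assume fin: "finite (UNIV :: 'k set)"
  define P where "P = (\<Prod>a\<in>UNIV. [:- a, 1 :: 'k:]) + 1"
  have "degree (\<Prod>a\<in>UNIV. [:- a, 1 :: 'k:]) = card (UNIV :: 'k set)"
    by (subst degree_prod_sum_eq) auto
  moreover have "card (UNIV :: 'k set) > 0" using fin by (simp add: card_gt_0_iff)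
  ultimately have "degree P > 0"
    unfolding P_def by (subst degree_add_eq_left) auto
  then obtain x where "poly P x = 0" using alg_closed_imp_poly_has_root by blast
  moreover have "poly (\<Prod>a\<in>UNIV. [:- a, 1 :: 'k:]) x = 0"
    using fin by (auto simp: poly_prod intro!: prod_zero bexI[of _ x])
  ultimately show False by (simp add: P_def)
qed

text \<open>Restrict to the linear forms with coefficients \<open>1, z, z ^ 2, ...\<close>: each
  nonzero \<open>v\<close> yields a nonzero polynomial in \<open>z\<close>, and finitely many of
  these have only finitely many roots in an infinite field.\<close>

lemma exists_nonvanishing_linear_form:
  fixes V :: "'k::alg_closed_field vec set"
  assumes "finite V" "\<And>v. v \<in> V \<Longrightarrow> v \<in> carrier_vec m \<and> v \<noteq> 0\<^sub>v m"
  shows "\<exists>z. \<forall>v\<in>V. (\<Sum>x<m. z ^ x * v $ x) \<noteq> 0"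
proof -
  define P where "P v = (\<Sum>x<m. monom (v $ x) x)" for v :: "'k vec"
  have P0: "P v \<noteq> 0" if "v \<in> V" for v
  proof
    assume P: "P v = 0"
    have "v $ x = 0" if x: "x < m" for x
    proof -
      have "coeff (P v) x = v $ x" using x by (simp add: P_def coeff_sum)
      then show ?thesis using P by simp
    qed
    then have "v = 0\<^sub>v m" using assms(2)[OF that] by (intro eq_vecI) auto
    then show False using assms(2)[OF that] by simp
  qed
  have "finite (\<Union>v\<in>V. {z. poly (P v) z = 0})"
    using assms(1) P0 by (intro finite_UN_I poly_roots_finite) auto
  then obtain z where "z \<notin> (\<Union>v\<in>V. {z. poly (P v) z = 0})"
    using infinite_UNIV_alg_closed_field ex_new_if_finite by blast
  then show ?thesis
    by (intro exI[of _ z]) (auto simp: P_def poly_sum poly_monom mult.commute)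
qed

lemma sigma_le_card:
  fixes G :: "'k::alg_closed_field mat set"
  assumes "linear_group n G" "finite G"
  shows "sigma n G \<le> enat (card G)"
  unfolding sigma_def
proof (rule SUP_least, clarify)
  fix m \<rho> assume module: "G_module n G m \<rho>"
  interpret linear_group n G by fact
  have hom: "\<rho> \<in> hom (GL n\<lparr>carrier := G\<rparr>) (GL m)" using module by (simp add: G_module_def)
  have \<rho>_GL: "\<rho> g \<in> carrier (GL m)" if "g \<in> G" for g using hom that by (auto simp: hom_def)
  have \<rho>: "\<rho> g \<in> carrier_mat m m" "det (\<rho> g) \<noteq> 0" if "g \<in> G" for g
    using \<rho>_GL[OF that] by (auto simp: carrier_GL)
  have \<rho>_mult: "\<rho> (g * h) = \<rho> g * \<rho> h" if "g \<in> G" "h \<in> G" for g h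
    using hom that by (simp add: hom_def mult_GL)
  have "sigma_set n G m \<rho> (invariants_le n G m \<rho> (card G))"
    unfolding sigma_set_def
  proof (intro conjI ballI)
    show "invariants_le n G m \<rho> (card G) \<subseteq> invariants n G m \<rho>" by (auto simp: invariants_le_def)
    fix v assume v: "v \<in> carrier_vec m - nullcone n G m \<rho>"
    have "v \<noteq> 0\<^sub>v m"
    proof
      assume "v = 0\<^sub>v m"
      then have "v \<in> nullcone n G m \<rho>"
        by (auto simp: nullcone_def plus_part_def invariants_def poly_fun_0)
      then show False using v by simp
    qed
    have "\<rho> g *\<^sub>v v \<in> carrier_vec m \<and> \<rho> g *\<^sub>v v \<noteq> 0\<^sub>v m" if "g \<in> G" for g
      using \<rho>[OF that] v \<open>v \<noteq> 0\<^sub>v m\<close> det_0_iff_vec_prod_zero_field[OF \<rho>(1)[OF that]]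
      by (auto intro: mult_mat_vec_carrier)
    then have "\<exists>z. \<forall>w\<in>(\<lambda>g. \<rho> g *\<^sub>v v) ` G. (\<Sum>x<m. z ^ x * w $ x) \<noteq> 0"
      using assms(2) by (intro exists_nonvanishing_linear_form) auto
    then obtain z where z: "\<And>g. g \<in> G \<Longrightarrow> (\<Sum>x<m. z ^ x * (\<rho> g *\<^sub>v v) $ x) \<noteq> 0" by auto
    \<comment> \<open>The product of the translates of one linear form, of degree at most
      \<open>card G\<close>; by the choice of \<open>z\<close> no factor vanishes at
      \<open>v\<close>.\<close>
    define F where "F u = (\<Prod>g\<in>G. \<Sum>x<m. z ^ x * (\<Sum>y<m. \<rho> g $$ (x, y) * u y))" for u
    have "polynomial_fun {..<m} (\<Sum>g\<in>G. 1) F"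
      unfolding F_def
      by (intro polynomial_fun_prod polynomial_fun_sum polynomial_fun_cmult polynomial_fun_linear) auto
    then obtain P where P: "mpoly_vars P \<subseteq> {..<m}" "mpoly_degree_le P (card G)" "\<And>u. F u = mpoly_eval u P"
      unfolding polynomial_fun_def by auto
    have P_coord: "P \<in> coord_ring m" using P(1) by (simp add: coord_ring_def)
    have P_eq: "poly_fun P w = (\<Prod>g\<in>G. \<Sum>x<m. z ^ x * (\<rho> g *\<^sub>v w) $ x)" if w: "w \<in> carrier_vec m" for w
      unfolding poly_fun_def P(3)[symmetric] F_def
      by (intro prod.cong sum.cong refl arg_cong2[where f = "(*)"])
         (simp add: mult_mat_vec_index_sum[OF \<rho>(1) w] del: index_mult_mat_vec)
    have "P \<in> invariants n G m \<rho>"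
      unfolding invariants_def
    proof (intro CollectI conjI ballI P_coord)
      fix g and w :: "'k vec" assume g: "g \<in> G" and w: "w \<in> carrier_vec m"
      note g' = G_inv[OF g]
      have "poly_fun P (\<rho> (ginv g) *\<^sub>v w) = (\<Prod>h\<in>G. \<Sum>x<m. z ^ x * (\<rho> h *\<^sub>v (\<rho> (ginv g) *\<^sub>v w)) $ x)"
        by (rule P_eq[OF mult_mat_vec_carrier[OF \<rho>(1)[OF g'] w]])
      also have "\<dots> = (\<Prod>h\<in>G. \<Sum>x<m. z ^ x * (\<rho> (h * ginv g) *\<^sub>v w) $ x)"
        by (intro prod.cong refl) (simp only: \<rho>_mult[OF _ g'] assoc_mult_mat_vec[OF \<rho>(1) \<rho>(1)[OF g'] w])
      also have "\<dots> = (\<Prod>h\<in>G. \<Sum>x<m. z ^ x * (\<rho> h *\<^sub>v w) $ x)"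
      \<comment> \<open>Right multiplication by \<open>ginv g\<close> permutes the factors.\<close>
      proof (rule prod.reindex_bij_witness[of _ "\<lambda>h. h * g" "\<lambda>h. h * ginv g"])
        fix h assume h: "h \<in> G"
        show "h * ginv g * g = h" using g g' h by (simp add: G_assoc G_inv_left G_mult_one)
        show "h * g * ginv g = h" using g g' h by (simp add: G_assoc G_inv_right G_mult_one)
        show "h * ginv g \<in> G" "h * g \<in> G" using g g' h by (auto intro: G_mult)
      qed simp
      finally show "poly_fun P (\<rho> (ginv g) *\<^sub>v w) = poly_fun P w" by (simp add: P_eq[OF w])
    qed
    moreover have "mpoly_const_term P = 0"
    proof -
      have "mpoly_const_term P = F (\<lambda>_. 0)" by (simp add: P(3) mpoly_eval_0)
      also have "\<dots> = 0" using G_one assms(2) by (auto simp: F_def card_gt_0_iff)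
      finally show ?thesis .
    qed
    moreover have "poly_fun P v \<noteq> 0" using v z assms(2) by (simp add: P_eq)
    ultimately show "\<exists>f\<in>plus_part (invariants_le n G m \<rho> (card G)). poly_fun f v \<noteq> 0"
      using P(2) by (intro bexI[of _ P]) (auto simp: plus_part_def invariants_le_def)
  qed
  then show "sigma_module n G m \<rho> \<le> enat (card G)"
    unfolding sigma_module_def by (intro INF_lower) simp
qed

theorem theorem1p5:
  fixes G :: "'k::alg_closed_field mat set" and n p :: nat
  assumes "CHAR('k) = p" and "p > 0"
    and "linear_algebraic_group n G"
  shows "sigma n G < \<infinity> \<longleftrightarrow> finite G"
proof -
  have group: "linear_group n G"
    using assms(3) by (simp add: linear_group_def linear_algebraic_group_def)
  have char: "prime CHAR('k)" using assms(1,2) by (intro prime_CHAR_semidom) simp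
  show ?thesis
  proof
    assume "sigma n G < \<infinity>"
    then obtain d where "sigma n G = enat d" by auto
    then show "finite G" using less_sigma_of_infinite[OF group char, of d] by auto
  next
    assume "finite G"
    then have "sigma n G \<le> enat (card G)" by (rule sigma_le_card[OF group])
    also have "\<dots> < \<infinity>" by simp
    finally show "sigma n G < \<infinity>" .
  qed
qed

end
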